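(* Let $F\in\mathrm{Diff}(\mathbb{C}^2,0)$ be a germ of biholomorphism with the finite orbits property. Then there exists an integer $m\ge 1$ such that $F^m$ has a germ $\Gamma$ at $0$ of complex analytic curve consisting of fixed points, i.e. $\Gamma$ is a germ of complex analytic curve through the origin with $F^m|_\Gamma=\mathrm{id}$.
   Context: $\mathrm{Diff}(\mathbb{C}^2,0)$ is the group of germs at $0$ of biholomorphisms of $\mathbb{C}^2$ fixing $0$. For a representative $F:U\to V$ (a biholomorphism between open neighborhoods of $0$ with $F(0)=0$), $A\subset U\cap V$ and $p\in A$, put $O^+_{F,A}(p)=\{F^j(p): j\ge 0,\ F^k(p)\in A\text{ for all }0\le k\le j\}$ and $O_{F,A}(p)=O^+_{F,A}(p)\cup O^+_{F^{-1},A}(p)$. $F$ has the finite orbits property in $A$ if $O_{F,A}(p)$ is finite for all $p\in A$. A germ $F$ has the finite orbits property if there exist a representative $F:U\to V$ and a neighborhood $A\subset U\cap V$ of $0$ such that $F$ has the finite orbits property in $A$. *)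

theory Defs
  imports "HOL-Analysis.Analysis"
begin

text \<open>
  Holomorphy in several variables: real Frechet differentiability on an open set with a
  complex-linear derivative at every point.
\<close>

definition mv_holomorphic_on :: "(complex ^ 'n \<Rightarrow> complex) \<Rightarrow> (complex ^ 'n) set \<Rightarrow> bool" where
  "mv_holomorphic_on f U \<longleftrightarrow> open U \<and>
     (\<forall>p\<in>U. \<exists>D. (f has_derivative D) (at p) \<and> (\<forall>c v. D (c *s v) = c * D v))"

definition holomorphic_map_on :: "(complex ^ 'n \<Rightarrow> complex ^ 'm) \<Rightarrow> (complex ^ 'n) set \<Rightarrow> bool" where
  "holomorphic_map_on F U \<longleftrightarrow> (\<forall>i. mv_holomorphic_on (\<lambda>p. F p $ i) U)"

definition biholomorphism ::
  "(complex ^ 'n \<Rightarrow> complex ^ 'n) \<Rightarrow> (complex ^ 'n) set \<Rightarrow> (complex ^ 'n) set \<Rightarrow> bool" where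
  "biholomorphism F U V \<longleftrightarrow> open U \<and> open V \<and> bij_betw F U V \<and>
     holomorphic_map_on F U \<and> holomorphic_map_on (inv_into U F) V"

text \<open>
  A germ at 0 is given by a total function, of which only the values near 0 matter; two
  functions define the same germ iff they agree eventually in \<open>nhds 0\<close>.  Since germs in
  \<open>Diff(C\<^sup>n,0)\<close> fix 0 and are continuous there, \<open>F ^^ m\<close> defines the \<open>m\<close>-th power of the germ.
\<close>

definition diff_rep ::
  "(complex ^ 'n \<Rightarrow> complex ^ 'n) \<Rightarrow> (complex ^ 'n) set \<Rightarrow> (complex ^ 'n) set \<Rightarrow> bool" where
  "diff_rep F U V \<longleftrightarrow> biholomorphism F U V \<and> 0 \<in> U \<and> 0 \<in> V \<and> F 0 = 0"

definition diff_germ :: "(complex ^ 'n \<Rightarrow> complex ^ 'n) \<Rightarrow> bool" where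
  "diff_germ F \<longleftrightarrow> (\<exists>U V. diff_rep F U V)"

definition pos_orbit :: "('a \<Rightarrow> 'a) \<Rightarrow> 'a set \<Rightarrow> 'a \<Rightarrow> 'a set" where
  "pos_orbit F A p = {(F ^^ j) p | j. \<forall>k\<le>j. (F ^^ k) p \<in> A}"

text \<open>
  Below, \<open>A \<subseteq> U \<inter> F ` U\<close>, so the iterates of \<open>F\<close> and of \<open>inv_into U F\<close> entering an orbit
  never use values outside the domains \<open>U\<close> and \<open>V = F ` U\<close>.
\<close>

definition local_orbit :: "('a \<Rightarrow> 'a) \<Rightarrow> 'a set \<Rightarrow> 'a set \<Rightarrow> 'a \<Rightarrow> 'a set" where
  "local_orbit F U A p = pos_orbit F A p \<union> pos_orbit (inv_into U F) A p"

definition finite_orbits_in :: "('a \<Rightarrow> 'a) \<Rightarrow> 'a set \<Rightarrow> 'a set \<Rightarrow> bool" where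
  "finite_orbits_in F U A \<longleftrightarrow> (\<forall>p\<in>A. finite (local_orbit F U A p))"

definition finite_orbits_property :: "(complex ^ 'n \<Rightarrow> complex ^ 'n) \<Rightarrow> bool" where
  "finite_orbits_property F \<longleftrightarrow>
     (\<exists>G U V A. diff_rep G U V \<and> eventually (\<lambda>p. G p = F p) (nhds 0) \<and>
        A \<subseteq> U \<inter> V \<and> 0 \<in> interior A \<and> finite_orbits_in G U A)"

text \<open>
  A germ at 0 of complex analytic curve in \<open>C\<^sup>2\<close> is the zero set, near 0, of a holomorphic
  function vanishing at 0 whose germ at 0 is not identically zero.  As for maps, only the
  part of \<open>\<Gamma>\<close> near 0 matters.
\<close>

definition curve_germ :: "(complex ^ 2) set \<Rightarrow> bool" where
  "curve_germ \<Gamma> \<longleftrightarrow>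
     (\<exists>W f. 0 \<in> W \<and> mv_holomorphic_on f W \<and> f 0 = 0 \<and>
        \<not> eventually (\<lambda>p. f p = 0) (nhds 0) \<and> \<Gamma> \<inter> W = {p \<in> W. f p = 0})"

end

theory Submission
  imports Defs "HOL-Complex_Analysis.Residue_Theorem" "HOL-Computational_Algebra.Fundamental_Theorem_Algebra"
begin

text \<open>
  Let \<open>K\<close> be the set of points whose forward orbit stays in a small closed ball around \<open>0\<close>.  By finiteness
  of orbits, \<open>K\<close> consists of periodic points and coincides with its analogue for the inverse map; hence it
  contains a continuum \<open>C\<close> joining \<open>0\<close> to the sphere.  Let \<open>E m\<close> be the set of points of \<open>K\<close> fixed by
  \<open>f = F\<^sup>m\<close> at which \<open>1\<close> is the only root of unity among the eigenvalues of \<open>Df\<close>.  Near such a point every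
  iterate of \<open>f\<close> has the same fixed points as \<open>f\<close>, so \<open>E m\<close> is relatively open in \<open>E (m k)\<close>.  It is also
  closed: a limit point outside \<open>E m\<close> would have eigenvalues \<open>1\<close> and a root of unity \<open>\<zeta> \<noteq> 1\<close>, so the fixed
  points would form a smooth curve there, on which the transversal multiplier is holomorphic.  It would have to
  be the constant \<open>\<zeta>\<close>, since a multiplier of modulus less than one produces infinite orbits converging
  to the curve.  Now \<open>C\<close> is covered by the pairwise disjoint closed sets \<open>E (j!) - E ((j-1)!)\<close>, so by
  Sierpinski's theorem it lies in one of them, and \<open>0\<close> is not an isolated fixed point of \<open>F\<^sup>m\<close> for \<open>m = j!\<close>.
  Finally a non-isolated common zero of two holomorphic functions lies on a curve of common zeros, namely the
  zero set of a Weierstrass polynomial.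
\<close>

section \<open>Continua and Sierpinski's theorem\<close>

text \<open>Being fixed by \<open>G ^^ m\<close> is not enough to define \<open>E m\<close>: where
  the derivative has a root of unity \<zeta> \<noteq> 1 as eigenvalue, periodic points of higher
  period may accumulate, and the fixed set of one power need not be relatively open in that of a
  multiple. Excluding such eigenvalues restores openness but endangers closedness. At a limit point
  where closedness could fail, accumulation of fixed points forces the eigenvalue 1, which together
  with \<zeta> exhausts the spectrum in dimension two; this is where the plane is used. Divisibility
  of exponents is not a linear order, hence the cofinal chain of factorials. Infinitely many pieces
  remain, so plain connectedness of \<open>C\<close> does not decide between them and compactness
  must enter through Sierpinski's theorem. The final step is an elimination done analytically: sums
  over the zeros in one variable are holomorphic in the other by the argument principle, and
  logarithms turn products over zeros into such sums.\<close>

text \<open>Keep the points of \<open>D\<close> that are at least as near to some other piece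
  \<open>P j\<close> as to \<open>P i\<close>, and take a component of this set meeting
  \<open>P j\<close>. Boundary bumping carries the component to the frontier of the set, where it
  has left \<open>P j\<close>; so it meets two pieces while missing \<open>P i\<close>.\<close>

lemma continuum_avoiding_piece:
  fixes D :: "'a::heine_borel set" and P :: "nat \<Rightarrow> 'a set"
  assumes D: "compact D" "connected D" "D \<subseteq> (\<Union>n. P n)" "\<And>n. \<not> D \<subseteq> P n"
    and P: "\<And>n. closed (P n)" "disjoint_family P"
  obtains D' where "compact D'" "connected D'" "D' \<subseteq> D" "\<And>n. \<not> D' \<subseteq> P n" "D' \<inter> P i = {}"
proof (cases "D \<inter> P i = {}")
  case True
  then show ?thesis using that[of D] D by blast
next
  case False
  obtain p where p: "p \<in> D" "p \<notin> P i" using D(4)[of i] by blast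
  then obtain j where j: "p \<in> P j" using D(3) by blast
  then have ij: "i \<noteq> j" using p by auto
  have dis: "P i \<inter> P j = {}" using P(2) ij unfolding disjoint_family_on_def by blast
  define S where "S = D \<inter> {x. infdist x (P j) \<le> infdist x (P i)}"
  have clS: "closed S" unfolding S_def
    by (intro closed_Int closed_Collect_le continuous_intros compact_imp_closed D)
  have SD: "S \<subseteq> D" by (auto simp: S_def)
  have cS: "compact S" using clS SD D(1) by (metis compact_Int_closed inf.absorb_iff2)
  have notS: "x \<notin> S" if "x \<in> P i" for x
  proof
    assume "x \<in> S"
    then have "infdist x (P j) \<le> 0" using that by (simp add: S_def)
    then have "infdist x (P j) = 0" using infdist_nonneg[of x "P j"] by linarith
    then have "x \<in> P j" using in_closed_iff_infdist_zero[OF P(1)[of j]] j by auto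
    then show False using dis that by auto
  qed
  have pS: "p \<in> S" using p j by (simp add: S_def infdist_nonneg)
  define D' where "D' = connected_component_set S p"
  have D'S: "D' \<subseteq> S" by (simp add: D'_def connected_component_subset)
  have pD': "p \<in> D'" using pS by (simp add: D'_def)
  have comp: "D' \<in> components S" using pS by (auto simp: D'_def components_def)
  have cD': "compact D'" using comp cS using compact_components by blast
  let ?X = "top_of_set D"
  have "D' \<inter> ?X frontier_of S \<noteq> {}"
  proof (rule boundary_bumping_theorem_closed)
    show "connected_space ?X" using D(2) connectedin_iff_connected[of D] by (simp add: connectedin_def)
    show "compact_space ?X" using D(1) by (simp add: compact_space_subtopology)
    show "Hausdorff_space ?X" by (simp add: Hausdorff_space_subtopology)
    show "closedin ?X S" using clS SD by (simp add: closed_subset)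
    show "S \<noteq> topspace ?X" using False notS by auto
    have "subtopology ?X S = top_of_set S"
      using SD by (simp add: subtopology_subtopology inf.absorb2)
    moreover have "D' \<in> connected_components_of (top_of_set S)"
      using comp pS unfolding D'_def
      by (auto simp: connected_components_of_def connected_component_of_def connected_component_def
          connectedin_subtopology)
    ultimately show "D' \<in> connected_components_of (subtopology ?X S)" by simp
  qed
  then obtain q where q: "q \<in> D'" "q \<in> ?X frontier_of S" by blast
  \<comment> \<open>Points of \<open>D\<close> in \<open>P j\<close> have distance 0 to
    \<open>P j\<close> and positive distance to \<open>P i\<close>, so they are interior to
    \<open>S\<close> relative to \<open>D\<close>.\<close>
  have "q \<notin> P j"
  proof
    assume qj: "q \<in> P j"
    define O' where "O' = D \<inter> {x. infdist x (P j) < infdist x (P i)}"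
    have "open {x. infdist x (P j) < infdist x (P i)}"
      by (intro open_Collect_less continuous_intros)
    then have "openin ?X O'" by (auto simp: O'_def openin_open)
    moreover have "O' \<subseteq> S" by (auto simp: O'_def S_def)
    moreover have "q \<in> O'"
    proof -
      have "q \<notin> P i" using dis qj by auto
      then have "infdist q (P i) > 0"
        using in_closed_iff_infdist_zero[OF P(1)[of i]] False infdist_nonneg[of q "P i"]
        by (metis Int_empty_right less_eq_real_def)
      then show ?thesis using qj q D'S SD by (auto simp: O'_def)
    qed
    ultimately have "q \<in> ?X interior_of S" by (meson in_mono interior_of_maximal)
    then show False using q by (simp add: frontier_of_def)
  qed
  moreover obtain l where l: "q \<in> P l" using q D'S SD D(3) by blast
  ultimately have lj: "l \<noteq> j" by auto
  show ?thesis
  proof (rule that[OF cD'])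
    show "connected D'" by (simp add: D'_def)
    show "D' \<subseteq> D" using D'S SD by blast
    show "D' \<inter> P i = {}" using D'S notS by blast
    show "\<not> D' \<subseteq> P n" for n
    proof
      assume "D' \<subseteq> P n"
      then have "p \<in> P n" "q \<in> P n" using pD' q by auto
      then have "n = j" "n = l" using j l P(2) unfolding disjoint_family_on_def by blast+
      then show False using lj by simp
    qed
  qed
qed

text \<open>If no piece contained \<open>C\<close>, cutting out one piece after another would give a
  decreasing sequence of continua, and a point of their intersection would lie in no piece.\<close>

lemma Sierpinski_continuum:
  fixes C :: "'a::heine_borel set" and P :: "nat \<Rightarrow> 'a set"
  assumes C: "compact C" "connected C" "C \<subseteq> (\<Union>n. P n)"
    and P: "\<And>n. closed (P n)" "disjoint_family P"
  shows "\<exists>n. C \<subseteq> P n"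
proof (rule ccontr)
  assume neg: "\<nexists>n. C \<subseteq> P n"
  define Q where "Q D \<longleftrightarrow> compact D \<and> connected D \<and> D \<subseteq> C \<and> (\<forall>n. \<not> D \<subseteq> P n)" for D
  have "\<exists>f. \<forall>n. Q (f n) \<and> (f (Suc n) \<subseteq> f n \<and> f (Suc n) \<inter> P n = {})"
  proof (rule dependent_nat_choice)
    show "\<exists>D. Q D" using C neg by (auto simp: Q_def)
    fix D n assume "Q D"
    then have "compact D" "connected D" "D \<subseteq> (\<Union>n. P n)" "\<And>n. \<not> D \<subseteq> P n" and DC: "D \<subseteq> C"
      using C(3) by (auto simp: Q_def)
    then obtain D' where "compact D'" "connected D'" "D' \<subseteq> D" "\<And>k. \<not> D' \<subseteq> P k" "D' \<inter> P n = {}"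
      using continuum_avoiding_piece[OF _ _ _ _ P, of D n] by metis
    then show "\<exists>D'. Q D' \<and> D' \<subseteq> D \<and> D' \<inter> P n = {}" using DC unfolding Q_def by (intro exI[of _ D']) auto
  qed
  then obtain f where f: "\<And>n. Q (f n)" "\<And>n. f (Suc n) \<subseteq> f n" "\<And>n. f (Suc n) \<inter> P n = {}" by blast
  have mono: "f n \<subseteq> f m" if "m \<le> n" for m n
    using f(2) that by (rule lift_Suc_antimono_le)
  have "f n \<noteq> {}" for n using f(1)[of n] by (auto simp: Q_def)
  then have "\<Inter> (range f) \<noteq> {}"
    using f(1) mono by (intro compact_nest) (auto simp: Q_def)
  then obtain x where x: "\<And>n. x \<in> f n" by blast
  then have "x \<in> C" using f(1)[of 0] by (auto simp: Q_def)
  then obtain n where "x \<in> P n" using C(3) by blast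
  then show False using x[of "Suc n"] f(3)[of n] by blast
qed

section \<open>Holomorphic maps of several variables\<close>

definition cderiv :: "(complex ^ 'n \<Rightarrow> complex ^ 'm) \<Rightarrow> (complex ^ 'n \<Rightarrow> complex ^ 'm) \<Rightarrow> complex ^ 'n \<Rightarrow> bool" where
  "cderiv F D p \<longleftrightarrow> (F has_derivative D) (at p) \<and> (\<forall>c v. D (c *s v) = c *s D v)"

lemma norm_vector_smult: "norm (s *s v) = norm s * norm (v :: complex ^ 'n)"
  by (simp add: norm_vec_def norm_mult L2_set_right_distrib)

lemma has_derivative_vec_components:
  fixes F :: "'a::real_normed_vector \<Rightarrow> complex ^ 'm"
  assumes "\<And>i. ((\<lambda>x. F x $ i) has_derivative (\<lambda>h. D h $ i)) (at x)"
  shows "(F has_derivative D) (at x)"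
proof -
  have "((\<lambda>x. F x \<bullet> b) has_derivative (\<lambda>h. D h \<bullet> b)) (at x)" if b: "b \<in> Basis" for b
  proof -
    obtain i u where "b = axis i u" using b by (auto simp: Basis_vec_def)
    then show ?thesis
      using bounded_linear.has_derivative[OF bounded_linear_inner_left assms[of i], of u]
      by (simp add: inner_axis)
  qed
  then show ?thesis using has_derivative_componentwise_within[of F D x UNIV] by simp
qed

lemma cderiv_component:
  assumes "cderiv F D p"
  shows "((\<lambda>x. F x $ i) has_derivative (\<lambda>h. D h $ i)) (at p)"
  using assms bounded_linear.has_derivative[OF bounded_linear_vec_nth] unfolding cderiv_def by blast

lemma holomorphic_map_on_iff:
  fixes F :: "complex ^ 'n \<Rightarrow> complex ^ 'm"
  shows "holomorphic_map_on F U \<longleftrightarrow> open U \<and> (\<forall>p\<in>U. \<exists>D. cderiv F D p)"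
proof
  assume H: "holomorphic_map_on F U"
  have "\<exists>D. cderiv F D p" if p: "p \<in> U" for p
  proof -
    have "\<forall>i. \<exists>D. ((\<lambda>x. F x $ i) has_derivative D) (at p) \<and> (\<forall>c v. D (c *s v) = c * D v)"
      using H p unfolding holomorphic_map_on_def mv_holomorphic_on_def by blast
    then obtain E where E: "\<And>i. ((\<lambda>x. F x $ i) has_derivative E i) (at p)"
      "\<And>i c v. E i (c *s v) = c * E i v" by metis
    have "cderiv F (\<lambda>h. \<chi> i. E i h) p"
      unfolding cderiv_def using E by (auto intro!: has_derivative_vec_components simp: vec_eq_iff)
    then show ?thesis by blast
  qed
  moreover have "open U" using H unfolding holomorphic_map_on_def mv_holomorphic_on_def by blast
  ultimately show "open U \<and> (\<forall>p\<in>U. \<exists>D. cderiv F D p)" by simp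
next
  assume H: "open U \<and> (\<forall>p\<in>U. \<exists>D. cderiv F D p)"
  have "\<exists>D. ((\<lambda>x. F x $ i) has_derivative D) (at p) \<and> (\<forall>c v. D (c *s v) = c * D v)" if "p \<in> U" for p i
  proof -
    from H that have "\<exists>D. cderiv F D p" by simp
    then obtain D where D: "cderiv F D p" ..
    show ?thesis
      using cderiv_component[OF D, of i] D unfolding cderiv_def
      by (intro exI[of _ "\<lambda>h. D h $ i"]) simp
  qed
  then show "holomorphic_map_on F U"
    using H unfolding holomorphic_map_on_def mv_holomorphic_on_def by simp
qed

lemma cderiv_unique: "cderiv F D p \<Longrightarrow> cderiv F D' p \<Longrightarrow> D = D'"
  unfolding cderiv_def using has_derivative_unique by blast

lemma cderiv_ident: "cderiv (\<lambda>x. x) (\<lambda>h. h) p"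
  unfolding cderiv_def by auto

lemma cderiv_compose:
  assumes "cderiv F D p" "cderiv G E (F p)"
  shows "cderiv (\<lambda>x. G (F x)) (\<lambda>h. E (D h)) p"
  using assms has_derivative_compose[of F D p UNIV G E] unfolding cderiv_def by auto

lemma linear_cderiv: "cderiv F D p \<Longrightarrow> linear D"
  unfolding cderiv_def by (auto intro: has_derivative_linear)

lemma cderiv_continuous: "cderiv F D p \<Longrightarrow> isCont F p"
  unfolding cderiv_def by (auto intro: has_derivative_continuous)

lemma mv_holomorphic_on_continuous: "mv_holomorphic_on f U \<Longrightarrow> continuous_on U f"
  unfolding mv_holomorphic_on_def
  by (meson continuous_at_imp_continuous_on has_derivative_continuous)

lemma mv_holomorphic_on_diff:
  assumes "mv_holomorphic_on f U" "mv_holomorphic_on g U"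
  shows "mv_holomorphic_on (\<lambda>p. f p - g p) U"
  unfolding mv_holomorphic_on_def
proof (intro conjI ballI)
  show "open U" using assms by (simp add: mv_holomorphic_on_def)
  fix p assume "p \<in> U"
  then obtain D E where "(f has_derivative D) (at p)" "\<forall>c v. D (c *s v) = c * D v"
    "(g has_derivative E) (at p)" "\<forall>c v. E (c *s v) = c * E v"
    using assms unfolding mv_holomorphic_on_def by metis
  then show "\<exists>D. ((\<lambda>p. f p - g p) has_derivative D) (at p) \<and> (\<forall>c v. D (c *s v) = c * D v)"
    by (intro exI[of _ "\<lambda>h. D h - E h"]) (auto intro!: has_derivative_diff simp: algebra_simps)
qed

text \<open>The reduction to one variable: along such curves Cauchy's estimate and the identity
  theorem become available for functions of several variables.\<close>

lemma mv_holomorphic_on_curve: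
  fixes f :: "complex ^ 'n \<Rightarrow> complex"
  assumes f: "mv_holomorphic_on f U" and S: "open S" and g: "\<And>i. (\<lambda>s. g s $ i) holomorphic_on S"
    and gU: "\<And>s. s \<in> S \<Longrightarrow> g s \<in> U"
  shows "(\<lambda>s. f (g s)) holomorphic_on S"
proof (subst holomorphic_on_open[OF S], intro ballI)
  fix s assume s: "s \<in> S"
  obtain D where D: "(f has_derivative D) (at (g s))" "\<And>c v. D (c *s v) = c * D v"
    using f gU[OF s] unfolding mv_holomorphic_on_def by blast
  define g' where "g' = (\<chi> i. deriv (\<lambda>s. g s $ i) s)"
  have "(g has_derivative (\<lambda>h. h *s g')) (at s)"
  proof (rule has_derivative_vec_components)
    fix i
    have "((\<lambda>s. g s $ i) has_field_derivative g' $ i) (at s)"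
      using holomorphic_derivI[OF g S s] by (simp add: g'_def)
    then show "((\<lambda>x. g x $ i) has_derivative (\<lambda>h. (h *s g') $ i)) (at s)"
      by (simp add: has_field_derivative_def mult.commute[of _ "g' $ i"])
  qed
  from has_derivative_compose[OF this D(1)]
  have "((\<lambda>s. f (g s)) has_derivative (\<lambda>h. D (h *s g'))) (at s)" .
  then have "((\<lambda>s. f (g s)) has_field_derivative D g') (at s)"
    by (simp add: has_field_derivative_def D(2) mult.commute[of _ "D g'"])
  then show "\<exists>f'. ((\<lambda>s. f (g s)) has_field_derivative f') (at s)" by blast
qed

text \<open>Restricted to complex lines the error term is small on discs that are large compared with
  \<^term>\<open>norm (z - w)\<close>, so Cauchy's estimate turns differentiability into strict differentiability.\<close>

lemma mv_holomorphic_strict: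
  fixes f :: "complex ^ 'n \<Rightarrow> complex"
  assumes f: "mv_holomorphic_on f U" and x: "x \<in> U" and D: "(f has_derivative D) (at x)"
    and e: "e > 0"
  obtains d where "d > 0" "\<And>z w. z \<in> ball x d \<Longrightarrow> w \<in> ball x d \<Longrightarrow> norm (f z - f w - D (z - w)) \<le> e * norm (z - w)"
proof -
  have "open U" using f by (simp add: mv_holomorphic_on_def)
  then obtain d1 where d1: "d1 > 0" "ball x d1 \<subseteq> U" using x openE by blast
  have lD: "linear D" using D by (rule has_derivative_linear)
  have cD: "D (c *s v) = c * D v" for c v
    using f x D has_derivative_unique unfolding mv_holomorphic_on_def by metis
  obtain d2 where d2: "d2 > 0" "\<And>y. norm (y - x) < d2 \<Longrightarrow> norm (f y - f x - D (y - x)) \<le> e/4 * norm (y - x)"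
    using D e unfolding has_derivative_at_alt by (metis divide_pos_pos zero_less_numeral)
  define d where "d = min d1 d2 / 4"
  have d: "d > 0" "4 * d \<le> d1" "4 * d \<le> d2" using d1 d2 by (auto simp: d_def)
  have main: "norm (f z - f w - D (z - w)) \<le> e * norm (z - w)"
    if z: "z \<in> ball x d" and w: "w \<in> ball x d" for z w
  proof (cases "z = w")
    case True then show ?thesis using linear_0[OF lD] by simp
  next
    case False
    define v where "v = z - w"
    define n where "n = norm v"
    have n0: "n > 0" using False by (simp add: n_def v_def)
    have n2: "n < 2 * d"
    proof -
      have "n \<le> dist z x + dist w x"
        unfolding n_def v_def by (metis dist_norm dist_triangle2)
      then show ?thesis using z w by (simp add: dist_commute)
    qed
    \<comment> \<open>For \<open>s\<close> in the disc of radius \<rho> the point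
      \<open>w + s *s v\<close> is within \<open>d + 3 * d\<close> of \<open>x\<close>. Since
      \<open>n < 2 * d\<close>, \<rho> exceeds 1 by at least \<open>d / n\<close>, which leaves room
      for Cauchy discs of radius below \<open>d / n\<close> around the points of the unit
      disc.\<close>
    define \<rho> where "\<rho> = 3 * d / n"
    define g where "g s = f (w + s *s v) - f x - D (w - x) - s * D v" for s
    have nsv: "norm (s *s v) = norm s * n" for s :: complex
      unfolding n_def by (rule norm_vector_smult)
    have inb: "norm (w + s *s v - x) < 4 * d" if "s \<in> ball 0 \<rho>" for s
    proof -
      have "norm s < 3 * d / n" using that by (simp add: \<rho>_def)
      then have "norm s * n < 3 * d" using n0 by (simp add: field_simps)
      moreover have "norm (w - x) < d" using w by (simp add: dist_norm norm_minus_commute)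
      moreover have "norm (w + s *s v - x) \<le> norm (w - x) + norm (s *s v)"
        by (metis add.commute add_diff_eq norm_triangle_ineq)
      ultimately show ?thesis using nsv[of s] by linarith
    qed
    have holg: "g holomorphic_on ball 0 \<rho>"
    proof -
      have "(\<lambda>s. f (w + s *s v)) holomorphic_on ball 0 \<rho>"
      proof (rule mv_holomorphic_on_curve[OF f open_ball])
        show "(\<lambda>s. (w + s *s v) $ i) holomorphic_on ball 0 \<rho>" for i
          by (simp) (intro holomorphic_intros)
        show "w + s *s v \<in> U" if "s \<in> ball 0 \<rho>" for s
          using inb[OF that] d d1 by (auto simp: subset_iff dist_norm norm_minus_commute)
      qed
      then show ?thesis unfolding g_def by (intro holomorphic_intros)
    qed
    have bg: "norm (g s) \<le> e * d" if "s \<in> ball 0 \<rho>" for s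
    proof -
      have "D (w + s *s v - x) = D (w - x) + s * D v"
        using linear_add[OF lD, of "w - x" "s *s v"] cD by (simp add: algebra_simps)
      then have "g s = f (w + s *s v) - f x - D (w + s *s v - x)" by (simp add: g_def)
      then have "norm (g s) \<le> e/4 * norm (w + s *s v - x)"
        using d2(2) inb[OF that] d by (metis less_le_trans)
      also have "\<dots> \<le> e/4 * (4 * d)" using inb[OF that] e by (intro mult_left_mono) auto
      finally show ?thesis by simp
    qed
    have \<rho>1: "\<rho> - 1 \<ge> d / n" "d / n > 0" using n0 n2 d by (auto simp: \<rho>_def field_simps)
    have dg: "norm (deriv g s) \<le> e * n" if s: "s \<in> cball 0 1" for s
    proof -
      \<comment> \<open>The factor \<open>t < 1\<close> keeps the closed disc inside the open one;
        it disappears at the end by letting \<open>t\<close> tend to 1.\<close>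
      have sub: "cball s (d / n * t) \<subseteq> ball 0 \<rho>" if "0 < t" "t < 1" for t
      proof
        fix y assume "y \<in> cball s (d / n * t)"
        then have "norm y \<le> 1 + d / n * t"
          using s norm_triangle_ineq[of s "y - s"] by (auto simp: dist_norm norm_minus_commute)
        moreover have "d / n * t < d / n * 1" using that \<rho>1 by (intro mult_strict_left_mono) auto
        ultimately show "y \<in> ball 0 \<rho>" using \<rho>1 by auto
      qed
      have *: "norm (deriv g s) \<le> e * d / (d / n * t)" if t: "0 < t" "t < 1" for t
      proof -
        have "norm ((deriv ^^ 1) g s) \<le> fact 1 * (e * d) / (d / n * t) ^ 1"
        proof (rule Cauchy_inequality)
          show "g holomorphic_on ball s (d / n * t)"
            by (rule holomorphic_on_subset[OF holg subset_trans[OF ball_subset_cball sub[OF t]]])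
          show "continuous_on (cball s (d / n * t)) g"
            by (rule continuous_on_subset[OF holomorphic_on_imp_continuous_on[OF holg] sub[OF t]])
          show "0 < d / n * t" using t \<rho>1 by (intro mult_pos_pos) auto
          show "norm (g y) \<le> e * d" if "norm (s - y) = d / n * t" for y
          proof -
            have "y \<in> cball s (d / n * t)" unfolding mem_cball dist_norm using that by linarith
            then show ?thesis using sub[OF t] bg by blast
          qed
        qed
        then show ?thesis by simp
      qed
      have "t * norm (deriv g s) \<le> e * n" if t: "0 < t" "t < 1" for t
        using *[OF t] t n0 d by (simp add: field_simps)
      then show ?thesis by (rule field_le_mult_one_interval)
    qed
    have "norm (g 1 - g 0) \<le> e * n * norm (1 - 0 :: complex)"
    proof (rule field_differentiable_bound[of "cball 0 1" g "deriv g"])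
      have "cball 0 1 \<subseteq> ball (0::complex) \<rho>" using \<rho>1 by auto
      then show "(g has_field_derivative deriv g z) (at z within cball 0 1)" if "z \<in> cball 0 1" for z
        using has_field_derivative_at_within[OF holomorphic_derivI[OF holg open_ball]] that by blast
    qed (use dg in auto)
    moreover have "g 1 - g 0 = f z - f w - D (z - w)" by (simp add: g_def v_def)
    ultimately show ?thesis by (simp add: n_def v_def)
  qed
  show ?thesis using that[OF d(1) main] .
qed

lemma holomorphic_map_strict:
  fixes F :: "complex ^ 'n \<Rightarrow> complex ^ 'm"
  assumes F: "holomorphic_map_on F U" and x: "x \<in> U" and D: "cderiv F D x" and e: "e > 0"
  obtains d where "d > 0"
    "\<And>z w. z \<in> ball x d \<Longrightarrow> w \<in> ball x d \<Longrightarrow> norm (F z - F w - D (z - w)) \<le> e * norm (z - w)"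
proof -
  let ?N = "real CARD('m)"
  have N: "?N > 0" by simp
  have "\<exists>d>0. \<forall>z\<in>ball x d. \<forall>w\<in>ball x d.
      norm (F z $ i - F w $ i - D (z - w) $ i) \<le> e / ?N * norm (z - w)" for i
  proof -
    have "mv_holomorphic_on (\<lambda>p. F p $ i) U" using F by (simp add: holomorphic_map_on_def)
    then show ?thesis
      using mv_holomorphic_strict[OF _ x cderiv_component[OF D, of i], of "e / ?N"] e N
      by (metis divide_pos_pos)
  qed
  then obtain d where d: "\<And>i. d i > 0" "\<And>i z w. z \<in> ball x (d i) \<Longrightarrow> w \<in> ball x (d i) \<Longrightarrow>
      norm (F z $ i - F w $ i - D (z - w) $ i) \<le> e / ?N * norm (z - w)"
    by metis
  define \<delta> where "\<delta> = Min (range d)"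
  have \<delta>: "\<delta> > 0" "\<And>i. \<delta> \<le> d i" using d(1) by (auto simp: \<delta>_def)
  show ?thesis
  proof (rule that[OF \<delta>(1)])
    fix z w assume zw: "z \<in> ball x \<delta>" "w \<in> ball x \<delta>"
    have "norm (F z - F w - D (z - w)) \<le> (\<Sum>i\<in>UNIV. norm ((F z - F w - D (z - w)) $ i))"
      unfolding norm_vec_def by (rule L2_set_le_sum) simp
    also have "\<dots> \<le> (\<Sum>i\<in>(UNIV::'m set). e / ?N * norm (z - w))"
    proof (rule sum_mono)
      fix i
      have "z \<in> ball x (d i)" "w \<in> ball x (d i)" using zw \<delta>(2)[of i] by auto
      then show "norm ((F z - F w - D (z - w)) $ i) \<le> e / ?N * norm (z - w)"
        using d(2) by simp
    qed
    also have "\<dots> = e * norm (z - w)" by simp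
    finally show "norm (F z - F w - D (z - w)) \<le> e * norm (z - w)" .
  qed
qed

text \<open>Strict differentiability at \<open>x\<close> compares increments of \<open>F\<close>
  between nearby points with \<open>D\<close>; shrinking the increment at \<open>z\<close> in the
  direction \<open>h\<close> compares the derivative at \<open>z\<close> with \<open>D\<close>.
  Continuity of the derivative is obtained without differentiating twice.\<close>

lemma holomorphic_map_deriv_close:
  fixes F :: "complex ^ 'n \<Rightarrow> complex ^ 'm"
  assumes F: "holomorphic_map_on F U" and x: "x \<in> U" and D: "cderiv F D x" and e: "e > 0"
  obtains d where "d > 0" "\<And>z E h. z \<in> ball x d \<Longrightarrow> cderiv F E z \<Longrightarrow> norm (E h - D h) \<le> e * norm h"
proof -
  obtain d where d: "d > 0" "\<And>z w. z \<in> ball x d \<Longrightarrow> w \<in> ball x d \<Longrightarrow>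
      norm (F z - F w - D (z - w)) \<le> e * norm (z - w)"
    using holomorphic_map_strict[OF assms] by metis
  have "norm (E h - D h) \<le> e * norm h" if z: "z \<in> ball x d" and E: "cderiv F E z" for z E h
  proof (cases "h = 0")
    case True then show ?thesis using linear_0[OF linear_cderiv[OF E]] linear_0[OF linear_cderiv[OF D]] by simp
  next
    case False
    have lE: "linear E" and lD: "linear D" using E D linear_cderiv by auto
    show ?thesis
    proof (rule field_le_epsilon)
      fix \<eta> :: real assume \<eta>: "\<eta> > 0"
      define \<eta>' where "\<eta>' = \<eta> / norm h"
      have \<eta>': "\<eta>' > 0" using \<eta> False by (simp add: \<eta>'_def)
      obtain \<delta> where \<delta>: "\<delta> > 0" "\<And>y. norm (y - z) < \<delta> \<Longrightarrow> norm (F y - F z - E (y - z)) \<le> \<eta>' * norm (y - z)"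
        using E \<eta>' unfolding cderiv_def has_derivative_at_alt by metis
      define \<rho> where "\<rho> = min \<delta> (d - dist x z) / (2 * norm h)"
      have \<rho>: "\<rho> > 0" using \<delta> z False by (simp add: \<rho>_def)
      have nr: "\<rho> * norm h = min \<delta> (d - dist x z) / 2" using False by (simp add: \<rho>_def)
      define y where "y = z + \<rho> *\<^sub>R h"
      have ny: "norm (y - z) = \<rho> * norm h" using \<rho> by (simp add: y_def)
      have m0: "min \<delta> (d - dist x z) > 0" using \<delta> z by simp
      then have "norm (y - z) < \<delta>" "norm (y - z) < d - dist x z" using ny nr by auto
      then have yb: "y \<in> ball x d"
        using dist_triangle[of x y z] by (simp add: dist_norm norm_minus_commute)
      have "norm (E (y - z) - D (y - z)) \<le> norm (F y - F z - D (y - z)) + norm (F y - F z - E (y - z))"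
        using norm_triangle_ineq4[of "F y - F z - D (y - z)" "F y - F z - E (y - z)"] by (simp add: algebra_simps)
      also have "\<dots> \<le> e * norm (y - z) + \<eta>' * norm (y - z)"
        using d(2)[OF yb z] \<delta>(2)[OF \<open>norm (y - z) < \<delta>\<close>] by (rule add_mono)
      finally have *: "norm (E (y - z) - D (y - z)) \<le> (e + \<eta>') * (\<rho> * norm h)"
        by (simp add: ny algebra_simps)
      have "E (y - z) - D (y - z) = \<rho> *\<^sub>R (E h - D h)"
        by (simp add: y_def linear_scale[OF lE] linear_scale[OF lD] scaleR_diff_right)
      then have "norm (E (y - z) - D (y - z)) = \<rho> * norm (E h - D h)" using \<rho> by simp
      then have "\<rho> * norm (E h - D h) \<le> \<rho> * ((e + \<eta>') * norm h)" using * by (simp add: algebra_simps)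
      then have "norm (E h - D h) \<le> (e + \<eta>') * norm h" using \<rho> by simp
      then show "norm (E h - D h) \<le> e * norm h + \<eta>" using False by (simp add: \<eta>'_def algebra_simps)
    qed
  qed
  then show ?thesis using that d(1) by blast
qed

section \<open>Complex-linear operators and roots of unity among their eigenvalues\<close>

definition clinear_op :: "(complex ^ 'n \<Rightarrow> complex ^ 'n) \<Rightarrow> bool" where
  "clinear_op D \<longleftrightarrow> linear D \<and> (\<forall>c v. D (c *s v) = c *s D v)"

definition eigenvalue :: "(complex ^ 'n \<Rightarrow> complex ^ 'n) \<Rightarrow> complex \<Rightarrow> bool" where
  "eigenvalue D \<zeta> \<longleftrightarrow> (\<exists>v. v \<noteq> 0 \<and> D v = \<zeta> *s v)"

definition torsion_free_spectrum :: "(complex ^ 'n \<Rightarrow> complex ^ 'n) \<Rightarrow> bool" where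
  "torsion_free_spectrum D \<longleftrightarrow> (\<forall>\<zeta> k. k \<ge> 1 \<longrightarrow> \<zeta> ^ k = 1 \<longrightarrow> eigenvalue D \<zeta> \<longrightarrow> \<zeta> = 1)"

lemma cderiv_clinear: "cderiv F D p \<Longrightarrow> clinear_op D"
  unfolding clinear_op_def cderiv_def using has_derivative_linear by blast

lemma clinear_op_funpow: "clinear_op D \<Longrightarrow> clinear_op (D ^^ k)"
proof (induction k)
  case 0 then show ?case by (simp add: clinear_op_def linear_id[unfolded id_def] id_def)
next
  case (Suc k) then show ?case
    using linear_compose[of "D ^^ k" D] unfolding clinear_op_def by (simp add: comp_def)
qed

text \<open>Off the spectrum \<open>D v - \<zeta> *s v\<close> is injective in \<open>v\<close>,
  hence bounded below by \<open>B * norm v\<close>; a perturbation of size \<open>B / 2\<close>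
  cannot create a kernel.\<close>

lemma not_eigenvalue_stable:
  fixes D :: "complex ^ 'n \<Rightarrow> complex ^ 'n"
  assumes D: "clinear_op D" and n: "\<not> eigenvalue D \<zeta>"
  obtains c where "c > 0" "\<And>E. (\<And>h. norm (E h - D h) \<le> c * norm h) \<Longrightarrow> \<not> eigenvalue E \<zeta>"
proof -
  have lin: "linear (\<lambda>v. D v - \<zeta> *s v)"
  proof (rule linear_compose_sub)
    show "linear D" using D by (simp add: clinear_op_def)
    show "linear (\<lambda>v. \<zeta> *s v)"
      by (rule linearI) (simp_all add: vec_eq_iff algebra_simps)
  qed
  have "inj (\<lambda>v. D v - \<zeta> *s v)"
    using n unfolding linear_injective_0[OF lin] eigenvalue_def by auto
  then obtain B where B: "B > 0" "\<And>v. B * norm v \<le> norm (D v - \<zeta> *s v)"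
    using linear_inj_bounded_below_pos[OF lin] by blast
  show ?thesis
  proof (rule that[of "B / 2"])
    show "B / 2 > 0" using B by simp
    fix E assume E: "\<And>h. norm (E h - D h) \<le> B / 2 * norm h"
    show "\<not> eigenvalue E \<zeta>"
    proof
      assume "eigenvalue E \<zeta>"
      then obtain v where v: "v \<noteq> 0" "E v = \<zeta> *s v" by (auto simp: eigenvalue_def)
      have "B * norm v \<le> norm (D v - E v)" using B(2)[of v] v by simp
      also have "\<dots> \<le> B / 2 * norm v" using E[of v] by (simp add: norm_minus_commute)
      finally show False using B(1) v(1) by (simp add: field_simps)
    qed
  qed
qed

definition poly_op :: "complex poly \<Rightarrow> (complex ^ 'n \<Rightarrow> complex ^ 'n) \<Rightarrow> complex ^ 'n \<Rightarrow> complex ^ 'n" where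
  "poly_op p D v = (\<Sum>i\<le>degree p. coeff p i *s (D ^^ i) v)"

lemma poly_op_bound: "degree p \<le> n \<Longrightarrow> poly_op p D v = (\<Sum>i\<le>n. coeff p i *s (D ^^ i) v)"
  unfolding poly_op_def by (intro sum.mono_neutral_left) (auto simp: coeff_eq_0)

lemma poly_op_linear_factor:
  assumes D: "clinear_op D"
  shows "poly_op ([:-r, 1:] * q) D v = poly_op q D (D v - r *s v)"
proof -
  let ?n = "degree q"
  have lk: "(D ^^ i) (D v - r *s v) = (D ^^ Suc i) v - r *s (D ^^ i) v" for i
    using clinear_op_funpow[OF D, of i] linear_diff[of "D ^^ i" "D v" "r *s v"]
    unfolding clinear_op_def by (simp add: funpow_swap1)
  have deg: "degree ([:-r, 1:] * q) \<le> Suc ?n"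
    using degree_mult_le[of "[:-r,1:]" q] by simp
  have "[:-r, 1:] * q = pCons 0 q - smult r q" by (simp add: mult_pCons_left)
  then have co: "coeff ([:-r, 1:] * q) i = coeff (pCons 0 q) i - r * coeff q i" for i by simp
  have "poly_op ([:-r, 1:] * q) D v = (\<Sum>i\<le>Suc ?n. coeff ([:-r, 1:] * q) i *s (D ^^ i) v)"
    by (rule poly_op_bound[OF deg])
  also have "\<dots> = (\<Sum>i\<le>Suc ?n. coeff (pCons 0 q) i *s (D ^^ i) v) - (\<Sum>i\<le>Suc ?n. (r * coeff q i) *s (D ^^ i) v)"
    unfolding co by (simp only: vector_sub_rdistrib sum_subtractf)
  also have "(\<Sum>i\<le>Suc ?n. coeff (pCons 0 q) i *s (D ^^ i) v) = (\<Sum>i\<le>?n. coeff q i *s (D ^^ Suc i) v)"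
    by (subst sum.atMost_Suc_shift) simp
  also have "(\<Sum>i\<le>Suc ?n. (r * coeff q i) *s (D ^^ i) v) = (\<Sum>i\<le>?n. coeff q i *s (r *s (D ^^ i) v))"
    by (simp add: coeff_eq_0 vector_smult_assoc mult.commute)
  finally show ?thesis
    unfolding poly_op_def lk by (simp only: vector_ssub_ldistrib sum_subtractf)
qed

text \<open>Apply the linear factors of \<open>p\<close> to \<open>v\<close> one after another: the
  factor that first produces 0 exhibits an eigenvector.\<close>

lemma poly_op_kernel_eigenvalue:
  assumes D: "clinear_op D"
  shows "p \<noteq> 0 \<Longrightarrow> poly_op p D v = 0 \<Longrightarrow> v \<noteq> 0 \<Longrightarrow> \<exists>\<zeta>. poly p \<zeta> = 0 \<and> eigenvalue D \<zeta>"
proof (induction "degree p" arbitrary: p v rule: less_induct)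
  case less
  show ?case
  proof (cases "degree p = 0")
    case True
    then obtain c where "p = [:c:]" by (metis degree_eq_zeroE)
    then show ?thesis using less.prems by (simp add: poly_op_def vec_eq_iff)
  next
    case False
    then have "\<not> constant (poly p)" by (simp add: constant_degree)
    then obtain r where r: "poly p r = 0" using fundamental_theorem_of_algebra by blast
    then obtain q where q: "p = [:-r, 1:] * q" by (metis dvdE poly_eq_0_iff_dvd)
    have q0: "q \<noteq> 0" using q less.prems by auto
    have dq: "degree q < degree p" unfolding q using q0 by (subst degree_mult_eq) auto
    show ?thesis
    proof (cases "D v - r *s v = 0")
      case True then show ?thesis using r less.prems by (auto simp: eigenvalue_def)
    next
      case nz: False
      have "poly_op q D (D v - r *s v) = 0"
        using less.prems(2) unfolding q by (simp only: poly_op_linear_factor[OF D])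
      then obtain \<zeta> where "poly q \<zeta> = 0" "eigenvalue D \<zeta>" using less.hyps[OF dq q0 _ nz] by blast
      then show ?thesis using q by auto
    qed
  qed
qed

text \<open>The roots of \<open>1 + X + \<dots> + X^(k-1)\<close> are the \<open>k\<close>-th roots
  of unity other than 1. This makes the operator sum in \<open>fixed_points_stabilize\<close>
  invertible.\<close>

lemma orbit_sum_kernel_eigenvalue:
  assumes D: "clinear_op D" and k: "k \<ge> 1" and v: "v \<noteq> 0" "(\<Sum>i<k. (D ^^ i) v) = 0"
  shows "\<exists>\<zeta>. \<zeta> ^ k = 1 \<and> \<zeta> \<noteq> 1 \<and> eigenvalue D \<zeta>"
proof -
  define p :: "complex poly" where "p = (\<Sum>i<k. monom 1 i)"
  have co: "coeff p i = (if i < k then 1 else 0)" for i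
    by (simp add: p_def coeff_sum)
  have deg: "degree p \<le> k - 1" by (rule degree_le) (auto simp: co)
  have "p \<noteq> 0" using co[of 0] k by (metis coeff_0 less_eq_Suc_le One_nat_def zero_neq_one)
  moreover have "poly_op p D v = (\<Sum>i<k. (D ^^ i) v)"
    unfolding poly_op_bound[OF deg] using k by (intro sum.cong) (auto simp: co)
  ultimately obtain \<zeta> where z: "poly p \<zeta> = 0" "eigenvalue D \<zeta>"
    using poly_op_kernel_eigenvalue[OF D, of p v] v by auto
  have s: "(\<Sum>i<k. \<zeta> ^ i) = 0" using z(1) by (simp add: p_def poly_sum poly_monom)
  have "\<zeta> \<noteq> 1" using s k by auto
  moreover have "\<zeta> ^ k = 1" using power_diff_1_eq[of \<zeta> k] s by simp
  ultimately show ?thesis using z by blast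
qed

text \<open>The kernel criterion is applied to the polynomial \<open>X^k - \<zeta>\<close>.\<close>

lemma eigenvalue_funpow_root:
  assumes D: "clinear_op D" and k: "k \<ge> 1" and e: "eigenvalue (D ^^ k) \<zeta>"
  shows "\<exists>l. l ^ k = \<zeta> \<and> eigenvalue D l"
proof -
  obtain v where v: "v \<noteq> 0" "(D ^^ k) v = \<zeta> *s v" using e by (auto simp: eigenvalue_def)
  define p where "p = monom 1 k - [:\<zeta>:]"
  have co: "coeff p i = (if i = k then 1 else if i = 0 then - \<zeta> else 0)" for i
    using k by (auto simp: p_def coeff_pCons split: nat.split)
  have deg: "degree p \<le> k" by (rule degree_le) (auto simp: co)
  have "p \<noteq> 0" using co[of k] by (metis coeff_0 zero_neq_one)
  moreover have "poly_op p D v = 0"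
  proof -
    have "poly_op p D v = (\<Sum>i\<in>{0, k}. coeff p i *s (D ^^ i) v)"
      unfolding poly_op_bound[OF deg] by (intro sum.mono_neutral_right) (auto simp: co)
    also have "\<dots> = 0" using k v(2) by (simp add: co vec_eq_iff)
    finally show ?thesis .
  qed
  ultimately obtain l where "poly p l = 0" "eigenvalue D l"
    using poly_op_kernel_eigenvalue[OF D, of p v] v by auto
  then show ?thesis by (auto simp: p_def poly_monom)
qed

lemma eigenvalue_funpow:
  assumes D: "clinear_op D" and e: "eigenvalue D l"
  shows "eigenvalue (D ^^ k) (l ^ k)"
proof -
  obtain v where v: "v \<noteq> 0" "D v = l *s v" using e by (auto simp: eigenvalue_def)
  have "(D ^^ k) v = l ^ k *s v"
    using D v(2) by (induction k) (auto simp: clinear_op_def vector_smult_assoc mult.commute)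
  then show ?thesis using v by (auto simp: eigenvalue_def)
qed

lemma torsion_free_spectrum_funpow:
  assumes D: "clinear_op D" and t: "torsion_free_spectrum D" and k: "k \<ge> 1"
  shows "torsion_free_spectrum (D ^^ k)"
  unfolding torsion_free_spectrum_def
proof (intro allI impI)
  fix \<zeta> j assume j: "j \<ge> (1::nat)" "\<zeta> ^ j = 1" "eigenvalue (D ^^ k) \<zeta>"
  then obtain l where l: "l ^ k = \<zeta>" "eigenvalue D l" using eigenvalue_funpow_root[OF D k] by blast
  then have "l ^ (k * j) = 1" using j by (simp add: power_mult)
  then have "l = 1" using t l j(1) k unfolding torsion_free_spectrum_def
    by (metis One_nat_def Suc_leI mult_pos_pos less_le_trans zero_less_one)
  then show "\<zeta> = 1" using l by simp
qed

lemma finite_eigenvalues_2: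
  fixes D :: "complex ^ 2 \<Rightarrow> complex ^ 2"
  assumes D: "clinear_op D"
  shows "finite {\<zeta>. eigenvalue D \<zeta>}"
proof -
  define a where "a i j = D (axis j 1) $ i" for i j :: 2
  have rep: "D v $ i = v $ 1 * a i 1 + v $ 2 * a i 2" for v i
  proof -
    have "v = v $ 1 *s axis 1 1 + v $ 2 *s axis 2 1"
      by (simp add: vec_eq_iff forall_2 axis_def)
    then have "D v = v $ 1 *s D (axis 1 1) + v $ 2 *s D (axis 2 1)"
      using D unfolding clinear_op_def by (metis linear_add)
    then show ?thesis by (simp add: a_def)
  qed
  \<comment> \<open>The characteristic polynomial. Its value at an eigenvalue, times either
    coordinate of an eigenvector, vanishes by eliminating between the two eigenvector
    equations.\<close>
  define p where "p = [:a 1 1 * a 2 2 - a 1 2 * a 2 1, - (a 1 1 + a 2 2), 1:]"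
  have "{\<zeta>. eigenvalue D \<zeta>} \<subseteq> {\<zeta>. poly p \<zeta> = 0}"
  proof safe
    fix \<zeta> assume "eigenvalue D \<zeta>"
    then obtain v where v: "v \<noteq> 0" "D v = \<zeta> *s v" by (auto simp: eigenvalue_def)
    have 1: "v $ 1 * a 1 1 + v $ 2 * a 1 2 = \<zeta> * v $ 1"
      and 2: "v $ 1 * a 2 1 + v $ 2 * a 2 2 = \<zeta> * v $ 2"
      using v(2) rep[of v] by (simp_all add: vec_eq_iff)
    have "v $ 1 * poly p \<zeta> = 0" "v $ 2 * poly p \<zeta> = 0"
      using 1 2 unfolding p_def by (simp, algebra)+
    moreover have "v $ 1 \<noteq> 0 \<or> v $ 2 \<noteq> 0" using v(1) by (auto simp: vec_eq_iff forall_2)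
    ultimately show "poly p \<zeta> = 0" by auto
  qed
  moreover have "p \<noteq> 0" by (simp add: p_def)
  ultimately show ?thesis using poly_roots_finite finite_subset by blast
qed

lemma common_torsion_exponent:
  fixes Z :: "complex set"
  assumes "finite Z" "\<And>z. z \<in> Z \<Longrightarrow> \<exists>k\<ge>1. z ^ k = 1"
  shows "\<exists>n::nat\<ge>1. \<forall>z\<in>Z. z ^ n = 1"
  using assms
proof (induction Z rule: finite_induct)
  case empty then show ?case by auto
next
  case (insert a Z)
  then obtain n where n: "n \<ge> 1" "\<forall>z\<in>Z. z ^ n = 1" by auto
  obtain k where k: "k \<ge> 1" "a ^ k = 1" using insert.prems by auto
  have "z ^ (n * k) = 1" if "z \<in> insert a Z" for z
  proof (cases "z = a")
    case True then show ?thesis using k by (simp add: mult.commute[of n k] power_mult)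
  next
    case False then show ?thesis using that n by (simp add: power_mult)
  qed
  moreover have "n * k \<ge> 1" using n k by (simp add: Suc_le_eq)
  ultimately show ?case by blast
qed

text \<open>A root of unity in the spectrum of \<open>D ^^ n\<close> is the \<open>n\<close>-th
  power of one in the spectrum of \<open>D\<close>. There are finitely many of the latter, so a
  common exponent sends them all to 1. This is what puts every point of \<open>K\<close> into some
  \<open>E m\<close>.\<close>

lemma torsion_free_power_exists:
  fixes D :: "complex ^ 2 \<Rightarrow> complex ^ 2"
  assumes D: "clinear_op D"
  obtains n where "n \<ge> 1" "torsion_free_spectrum (D ^^ n)"
proof -
  define Z where "Z = {\<zeta>. eigenvalue D \<zeta> \<and> (\<exists>k\<ge>1. \<zeta> ^ k = 1)}"
  have "finite Z" using finite_eigenvalues_2[OF D] by (rule finite_subset[rotated]) (auto simp: Z_def)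
  then obtain n :: nat where n: "n \<ge> 1" "\<forall>z\<in>Z. z ^ n = 1"
    using common_torsion_exponent[of Z] by (auto simp: Z_def)
  have "torsion_free_spectrum (D ^^ n)"
    unfolding torsion_free_spectrum_def
  proof (intro allI impI)
    fix \<zeta> j assume j: "j \<ge> (1::nat)" "\<zeta> ^ j = 1" "eigenvalue (D ^^ n) \<zeta>"
    then obtain l where l: "l ^ n = \<zeta>" "eigenvalue D l" using eigenvalue_funpow_root[OF D n(1)] by blast
    then have "l ^ (n * j) = 1" using j by (simp add: power_mult)
    moreover have "n * j \<ge> 1" using j n by (simp add: Suc_le_eq)
    ultimately have "l \<in> Z" using l unfolding Z_def by blast
    then show "\<zeta> = 1" using n l by simp
  qed
  then show ?thesis using that n by blast
qed

section \<open>The continuum of bounded orbits\<close>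

text \<open>Finiteness makes the orbit eventually periodic, and injectivity on \<open>S\<close>
  strips off the preperiod.\<close>

lemma finite_orbit_periodic:
  assumes S: "\<And>n. (f ^^ n) x \<in> S" and inj: "inj_on f S" and fin: "finite (range (\<lambda>n. (f ^^ n) x))"
  shows "\<exists>m\<ge>1. (f ^^ m) x = x"
proof -
  have "\<not> inj (\<lambda>n. (f ^^ n) x)" using fin finite_imageD infinite_UNIV_nat by blast
  then obtain i j where ij: "i < j" "(f ^^ i) x = (f ^^ j) x"
    unfolding inj_on_def by (metis nat_neq_iff)
  have canc: "(f ^^ (n + d)) x = (f ^^ n) x \<Longrightarrow> (f ^^ d) x = x" for n d
  proof (induction n)
    case (Suc n)
    then have "f ((f ^^ (n + d)) x) = f ((f ^^ n) x)" by simp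
    then have "(f ^^ (n + d)) x = (f ^^ n) x" using S by (meson inj inj_onD)
    then show ?case by (rule Suc.IH)
  qed simp
  have "(f ^^ (j - i)) x = x" using ij canc[of i "j - i"] by simp
  then show ?thesis using ij by (intro exI[of _ "j - i"]) auto
qed

lemma orbit_within_Suc:
  "{x. \<forall>j\<le>Suc N. (f ^^ j) x \<in> B} = B \<inter> f -` {x. \<forall>j\<le>N. (f ^^ j) x \<in> B}"
proof (intro set_eqI iffI)
  fix x assume x: "x \<in> {x. \<forall>j\<le>Suc N. (f ^^ j) x \<in> B}"
  have "(f ^^ j) (f x) \<in> B" if "j \<le> N" for j using x that by (auto dest!: spec[of _ "Suc j"] simp: funpow_swap1)
  moreover have "x \<in> B" using x by (auto dest: spec[of _ 0])
  ultimately show "x \<in> B \<inter> f -` {x. \<forall>j\<le>N. (f ^^ j) x \<in> B}" by simp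
next
  fix x assume x: "x \<in> B \<inter> f -` {x. \<forall>j\<le>N. (f ^^ j) x \<in> B}"
  have "(f ^^ j) x \<in> B" if "j \<le> Suc N" for j
    using x that by (cases j) (auto simp: funpow_swap1)
  then show "x \<in> {x. \<forall>j\<le>Suc N. (f ^^ j) x \<in> B}" by simp
qed

lemma closed_orbit_within:
  assumes "closed B" "continuous_on B f"
  shows "closed {x. \<forall>j\<le>N. (f ^^ j) x \<in> B}"
proof (induction N)
  case 0 then show ?case using assms by simp
next
  case (Suc N)
  show ?case unfolding orbit_within_Suc using continuous_closed_preimage[OF assms(2,1) Suc] by simp
qed

lemma open_orbit_within:
  assumes "open B" "continuous_on B f"
  shows "open {x. \<forall>j\<le>N. (f ^^ j) x \<in> B}"
proof (induction N)
  case 0 then show ?case using assms by simp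
next
  case (Suc N)
  show ?case unfolding orbit_within_Suc using continuous_open_preimage[OF assms(2,1) Suc] by simp
qed

lemma continuous_on_funpow_within:
  assumes "continuous_on B f" "\<And>x j. x \<in> S \<Longrightarrow> j < k \<Longrightarrow> (f ^^ j) x \<in> B"
  shows "continuous_on S (f ^^ k)"
  using assms(2)
proof (induction k)
  case 0 then show ?case by (simp add: continuous_on_id[unfolded id_def] id_def)
next
  case (Suc k)
  have "continuous_on S (f ^^ k)" using Suc by simp
  moreover have "(f ^^ k) ` S \<subseteq> B" using Suc.prems by blast
  ultimately have "continuous_on S (f \<circ> (f ^^ k))"
    using assms(1) continuous_on_compose continuous_on_subset by blast
  then show ?case by simp
qed

text \<open>The components of \<open>a\<close> in the sets \<open>K n\<close> are decreasing
  continua, each meeting \<open>S\<close>; compactness passes all of this to their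
  intersection.\<close>

lemma nested_continuum:
  fixes K :: "nat \<Rightarrow> 'a::euclidean_space set"
  assumes K: "\<And>n. compact (K n)" "\<And>m n. m \<le> n \<Longrightarrow> K n \<subseteq> K m"
    and D: "\<And>n. \<exists>D. connected D \<and> a \<in> D \<and> D \<subseteq> K n \<and> D \<inter> S \<noteq> {}" and S: "closed S"
  obtains C where "compact C" "connected C" "a \<in> C" "C \<subseteq> (\<Inter>n. K n)" "C \<inter> S \<noteq> {}"
proof -
  define C where "C n = connected_component_set (K n) a" for n
  have aK: "a \<in> K n" for n using D[of n] by blast
  have cC: "compact (C n)" for n
    using compact_components[OF K(1)[of n]] aK[of n] by (auto simp: C_def components_def)
  have nest: "C n \<subseteq> C m" if "m \<le> n" for m n
    unfolding C_def by (rule connected_component_mono[OF K(2)[OF that]])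
  have meet: "C n \<inter> S \<noteq> {}" for n
  proof -
    obtain E where E: "connected E" "a \<in> E" "E \<subseteq> K n" "E \<inter> S \<noteq> {}" using D[of n] by (elim exE conjE)
    have "E \<subseteq> C n" unfolding C_def by (rule connected_component_maximal[OF E(2,1,3)])
    then show ?thesis using E(4) by blast
  qed
  show ?thesis
  proof (rule that[of "\<Inter>(range C)"])
    show "connected (\<Inter>(range C))"
      using cC nest by (intro connected_nest) (auto simp: C_def)
    show "compact (\<Inter>(range C))" using cC by (intro compact_Inter) auto
    show "a \<in> \<Inter>(range C)" using aK by (auto simp: C_def)
    show "\<Inter>(range C) \<subseteq> (\<Inter>n. K n)"
      using connected_component_subset[of "K n" a for n] unfolding C_def by blast
    have "\<Inter>(range (\<lambda>n. C n \<inter> S)) \<noteq> {}"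
      using cC S nest meet by (intro compact_nest) (auto intro: compact_Int_closed)
    then show "\<Inter>(range C) \<inter> S \<noteq> {}" by auto
  qed
qed

text \<open>Two radii are used: \<open>K\<close> is cut out by the closed ball of radius
  \<open>R\<close>, while iterates are differentiated on the open ball of radius \<open>R0\<close>.
  The finite orbits property covers the larger ball too, so it also excludes infinite orbits that
  lie near \<open>K\<close> without lying in it.\<close>

locale finite_orbit_rep =
  fixes G :: "complex ^ 2 \<Rightarrow> complex ^ 2" and U V A :: "(complex ^ 2) set" and R0 R :: real
  assumes rep: "diff_rep G U V" and A: "A \<subseteq> U \<inter> V" and fin: "finite_orbits_in G U A"
    and R: "0 < R" "R < R0" "cball 0 R0 \<subseteq> A"
begin

abbreviation "H \<equiv> inv_into U G"

definition K :: "(complex ^ 2) set" where "K = {x. \<forall>n. (G ^^ n) x \<in> cball 0 R}"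

lemma BA: "cball 0 R \<subseteq> A" "cball 0 R \<subseteq> U" "cball 0 R \<subseteq> V"
proof -
  show "cball 0 R \<subseteq> A" using R subset_cball[of R R0 0] by (meson less_imp_le subset_trans)
  then show "cball 0 R \<subseteq> U" "cball 0 R \<subseteq> V" using A by auto
qed

lemma G_bij: "bij_betw G U V" and G_hol: "holomorphic_map_on G U" and H_hol: "holomorphic_map_on H V"
  and G0: "G 0 = 0"
  using rep unfolding diff_rep_def biholomorphism_def by auto

lemma zero_in: "0 \<in> U" "0 \<in> V" using BA R by auto

lemma G_inj: "inj_on G U" and H_inj: "inj_on H V"
  using G_bij bij_betw_inv_into unfolding bij_betw_def by blast+

lemma HG: "x \<in> U \<Longrightarrow> H (G x) = x" and GH: "y \<in> V \<Longrightarrow> G (H y) = y"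
  using G_bij by (auto simp: bij_betw_inv_into_left bij_betw_inv_into_right)

lemma G_cont: "continuous_on U G" and H_cont: "continuous_on V H"
  using G_hol H_hol cderiv_continuous unfolding holomorphic_map_on_iff
  by (meson continuous_at_imp_continuous_on)+

lemma forward_orbit_finite:
  assumes x: "\<And>n. (G ^^ n) x \<in> A"
  shows "finite (range (\<lambda>n. (G ^^ n) x))"
proof -
  have "pos_orbit G A x = range (\<lambda>n. (G ^^ n) x)" using x by (auto simp: pos_orbit_def)
  moreover have "x \<in> A" using x[of 0] by simp
  ultimately show ?thesis
    using fin unfolding finite_orbits_in_def local_orbit_def by auto
qed

lemma K_periodic:
  assumes "x \<in> K"
  shows "\<exists>m\<ge>1. (G ^^ m) x = x"
proof -
  have x: "(G ^^ n) x \<in> cball 0 R" for n using assms by (auto simp: K_def)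
  show ?thesis
  proof (rule finite_orbit_periodic[OF x])
    show "inj_on G (cball 0 R)" using G_inj BA inj_on_subset by blast
    show "finite (range (\<lambda>n. (G ^^ n) x))" using x BA by (intro forward_orbit_finite) blast
  qed
qed

text \<open>By finiteness \<open>x\<close> is periodic under \<open>H\<close>, and \<open>G\<close>
  runs through the same cycle in the opposite order. A continuum of bounded backward orbits
  therefore serves as well as one of bounded forward orbits.\<close>

lemma backward_orbit_in_K:
  assumes x: "\<And>n. (H ^^ n) x \<in> cball 0 R"
  shows "x \<in> K"
proof -
  have "pos_orbit H A x = range (\<lambda>n. (H ^^ n) x)" using x BA unfolding pos_orbit_def by blast
  moreover have "x \<in> A" using x[of 0] BA by auto
  ultimately have "finite (range (\<lambda>n. (H ^^ n) x))"
    using fin unfolding finite_orbits_in_def local_orbit_def by auto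
  moreover have "inj_on H (cball 0 R)" using H_inj BA inj_on_subset by blast
  ultimately obtain m where m: "m \<ge> 1" "(H ^^ m) x = x" using finite_orbit_periodic[OF x] by blast
  have V: "(H ^^ i) x \<in> V" for i using x[of i] BA by blast
  have step: "\<exists>j. G ((H ^^ i) x) = (H ^^ j) x" for i
  proof (cases i)
    case 0
    obtain l where l: "m = Suc l" using m by (cases m) auto
    have "G x = G (H ((H ^^ l) x))" using m l by simp
    also have "\<dots> = (H ^^ l) x" by (rule GH[OF V])
    finally show ?thesis using 0 by auto
  next
    case (Suc l)
    have "G ((H ^^ i) x) = (H ^^ l) x" using GH[OF V[of l]] Suc by simp
    then show ?thesis by blast
  qed
  have "\<exists>j. (G ^^ n) x = (H ^^ j) x" for n
  proof (induction n)
    case 0 show ?case by (rule exI[of _ 0]) simp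
  next
    case (Suc n)
    then obtain i where "(G ^^ n) x = (H ^^ i) x" by blast
    then show ?case using step[of i] by simp
  qed
  then have "(G ^^ n) x \<in> cball 0 R" for n using x by metis
  then show ?thesis unfolding K_def by blast
qed

text \<open>The component \<open>W\<close> of 0 among the points whose first \<open>N\<close>
  iterates stay in the open ball has in its closure a point whose \<open>j\<close>-th iterate
  reaches the sphere. The time \<open>j\<close> is not under control; pushing forward by
  \<open>G ^^ j\<close> moves the contact to time 0 and splits the \<open>N\<close> steps into
  \<open>N - j\<close> future and \<open>j\<close> past ones.\<close>

lemma escaping_continuum:
  obtains j D where "j \<le> N" "connected D" "0 \<in> D" "D \<inter> sphere 0 R \<noteq> {}"
    "D \<subseteq> {x. \<forall>i\<le>N - j. (G ^^ i) x \<in> cball 0 R}" "D \<subseteq> {x. \<forall>i\<le>j. (H ^^ i) x \<in> cball 0 R}"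
proof -
  define \<Omega> where "\<Omega> = {x. \<forall>j\<le>N. (G ^^ j) x \<in> ball 0 R}"
  define Kf where "Kf = {x. \<forall>j\<le>N. (G ^^ j) x \<in> cball 0 R}"
  have cB: "continuous_on (cball 0 R) G" using G_cont BA continuous_on_subset by blast
  have cb: "continuous_on (ball 0 R) G" using cB ball_subset_cball continuous_on_subset by blast
  have op: "open \<Omega>" unfolding \<Omega>_def by (rule open_orbit_within[OF open_ball cb])
  have cl: "closed Kf" unfolding Kf_def by (rule closed_orbit_within[OF closed_cball cB])
  have \<Omega>K: "\<Omega> \<subseteq> Kf" by (auto simp: \<Omega>_def Kf_def less_imp_le)
  have G0j: "(G ^^ j) 0 = 0" for j by (induction j) (simp_all add: G0)
  have 0: "0 \<in> \<Omega>" using R by (simp add: \<Omega>_def G0j)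
  define W where "W = connected_component_set \<Omega> 0"
  have W: "open W" "connected W" "0 \<in> W" "W \<subseteq> \<Omega>"
    using op 0 by (auto simp: W_def open_connected_component connected_component_subset[THEN subsetD])
  have "\<Omega> \<subseteq> ball 0 R" by (auto simp: \<Omega>_def)
  then have bW: "bounded W" using W bounded_subset bounded_ball by metis
  have "\<not> closed W"
  proof
    assume "closed W"
    then have "W = UNIV" using clopen[of W] W by blast
    then show False using bW by (simp add: not_bounded_UNIV)
  qed
  then have "\<not> closure W \<subseteq> W"
    using closure_subset[of W] closed_closure[of W] by (metis subset_antisym)
  then obtain p where p: "p \<in> closure W" "p \<notin> W" by (meson subsetI)
  \<comment> \<open>Otherwise \<open>p\<close> could be added to \<open>W\<close> without losing
    connectedness, against the maximality of the component.\<close>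
  have pn: "p \<notin> \<Omega>"
  proof
    assume "p \<in> \<Omega>"
    have "insert p W \<subseteq> closure W" using p(1) closure_subset[of W] by (simp only: insert_subset simp_thms)
    then have con: "connected (insert p W)"
      by (rule connected_intermediate_closure[OF W(2) subset_insertI])
    have "0 \<in> insert p W" "insert p W \<subseteq> \<Omega>" using W(3,4) \<open>p \<in> \<Omega>\<close> by (simp_all only: insert_subset insert_iff simp_thms)
    then have "insert p W \<subseteq> connected_component_set \<Omega> 0"
      by (rule connected_component_maximal[OF _ con])
    then have "insert p W \<subseteq> W" by (simp only: W_def[symmetric])
    then show False using p(2) by (simp only: insert_subset simp_thms)
  qed
  have cWK: "closure W \<subseteq> Kf" using W \<Omega>K cl by (meson closure_minimal subset_trans)
  then have "p \<in> Kf" using p by blast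
  then obtain j where j: "j \<le> N" "norm ((G ^^ j) p) = R"
    using pn unfolding \<Omega>_def Kf_def by (auto simp: not_less intro: antisym)
  define D where "D = (G ^^ j) ` closure W"
  have orb: "(G ^^ i) x \<in> cball 0 R" if "x \<in> closure W" "i \<le> N" for x i
    using cWK that by (auto simp: Kf_def)
  show ?thesis
  proof (rule that[OF j(1)])
    have "continuous_on (closure W) (G ^^ j)"
      using orb j by (intro continuous_on_funpow_within[OF cB]) auto
    moreover have "connected (closure W)"
      by (rule connected_intermediate_closure[OF W(2) closure_subset order_refl])
    ultimately show "connected D" unfolding D_def by (rule connected_continuous_image)
    have "0 \<in> closure W" using W(3) closure_subset[of W] by (rule subsetD[rotated])
    then show "0 \<in> D" unfolding D_def using G0j[of j] by (metis image_eqI)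
    have "(G ^^ j) p \<in> D \<inter> sphere 0 R" using p j by (simp add: D_def)
    then show "D \<inter> sphere 0 R \<noteq> {}" by blast
    show "D \<subseteq> {x. \<forall>i\<le>N - j. (G ^^ i) x \<in> cball 0 R}"
    proof (safe)
      fix y i assume "y \<in> D" "i \<le> N - j"
      then obtain x where x: "x \<in> closure W" "y = (G ^^ j) x" by (auto simp: D_def)
      then have "(G ^^ i) y = (G ^^ (i + j)) x" by (simp add: funpow_add)
      then show "(G ^^ i) y \<in> cball 0 R" using orb[OF x(1), of "i + j"] \<open>i \<le> N - j\<close> j by simp
    qed
    show "D \<subseteq> {x. \<forall>i\<le>j. (H ^^ i) x \<in> cball 0 R}"
    proof (safe)
      fix y i assume "y \<in> D" and i: "i \<le> j"
      then obtain x where x: "x \<in> closure W" "y = (G ^^ j) x" by (auto simp: D_def)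
      have "(H ^^ i) y = (G ^^ (j - i)) x" using i
      proof (induction i)
        case 0 then show ?case using x by simp
      next
        case (Suc i)
        have "(H ^^ Suc i) y = H ((G ^^ (j - i)) x)" using Suc by simp
        also have "j - i = Suc (j - Suc i)" using Suc.prems by simp
        also have "H ((G ^^ Suc (j - Suc i)) x) = (G ^^ (j - Suc i)) x"
        proof -
          have "(G ^^ (j - Suc i)) x \<in> U" using orb[OF x(1), of "j - Suc i"] j BA by auto
          then show ?thesis by (simp add: HG)
        qed
        finally show ?case .
      qed
      then show "(H ^^ i) y \<in> cball 0 R" using orb[OF x(1), of "j - i"] j by simp
    qed
  qed
qed

text \<open>If forward continua failed at depth \<open>a\<close> and backward ones at depth
  \<open>b\<close>, then \<open>N = a + b\<close> would contradict
  \<open>escaping_continuum\<close>, as \<open>b \<le> j\<close> or \<open>a \<le> N - j\<close>. So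
  one kind exists at every depth, and a nested intersection can be formed.\<close>

lemma continuum_of_bounded_orbits:
  obtains C where "compact C" "connected C" "0 \<in> C" "C \<subseteq> K" "C \<inter> sphere 0 R \<noteq> {}"
proof -
  define Kf where "Kf N = {x. \<forall>i\<le>N. (G ^^ i) x \<in> cball 0 R}" for N :: nat
  define Kb where "Kb N = {x. \<forall>i\<le>N. (H ^^ i) x \<in> cball 0 R}" for N :: nat
  define P where "P D \<longleftrightarrow> connected D \<and> 0 \<in> D \<and> D \<inter> sphere 0 R \<noteq> {}" for D :: "(complex ^ 2) set"
  have clo: "closed (Kf N)" "closed (Kb N)" for N
    unfolding Kf_def Kb_def
    using closed_orbit_within[OF closed_cball] G_cont H_cont BA continuous_on_subset by blast+
  have sub: "Kf N \<subseteq> cball 0 R" "Kb N \<subseteq> cball 0 R" for N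
    by (auto simp: Kf_def Kb_def dest: spec[of _ 0])
  have com: "compact (Kf N)" "compact (Kb N)" for N
    using clo bounded_subset[OF bounded_cball sub(1)] bounded_subset[OF bounded_cball sub(2)]
    by (simp_all add: compact_eq_bounded_closed)
  have dec: "Kf n \<subseteq> Kf m" "Kb n \<subseteq> Kb m" if "m \<le> n" for m n
    using that by (auto simp: Kf_def Kb_def)
  have "(\<forall>N. \<exists>D. P D \<and> D \<subseteq> Kf N) \<or> (\<forall>N. \<exists>D. P D \<and> D \<subseteq> Kb N)"
  proof (rule ccontr)
    assume "\<not> ?thesis"
    then obtain a b where ab: "\<And>D. P D \<Longrightarrow> \<not> D \<subseteq> Kf a" "\<And>D. P D \<Longrightarrow> \<not> D \<subseteq> Kb b" by blast
    show False
    proof (rule escaping_continuum[of "a + b"])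
      fix j D
      assume D: "j \<le> a + b" "connected D" "0 \<in> D" "D \<inter> sphere 0 R \<noteq> {}"
        "D \<subseteq> {x. \<forall>i\<le>a + b - j. (G ^^ i) x \<in> cball 0 R}" "D \<subseteq> {x. \<forall>i\<le>j. (H ^^ i) x \<in> cball 0 R}"
      have PD: "P D" using D(2-4) by (simp add: P_def)
      have Da: "D \<subseteq> Kf (a + b - j)" and Db: "D \<subseteq> Kb j" using D(5,6) by (simp_all only: Kf_def Kb_def)
      show False
      proof (cases "b \<le> j")
        case True then show False using ab(2)[OF PD] subset_trans[OF Db dec(2)[OF True]] by simp
      next
        case False
        then have "a \<le> a + b - j" by simp
        then show False using ab(1)[OF PD] subset_trans[OF Da dec(1)[of a "a + b - j"]] by simp
      qed
    qed
  qed
  then show ?thesis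
  proof
    assume H: "\<forall>N. \<exists>D. P D \<and> D \<subseteq> Kf N"
    show ?thesis
    proof (rule nested_continuum[where K = Kf and a = 0 and S = "sphere 0 R", OF com(1) dec(1) _ closed_sphere])
      show "\<exists>D. connected D \<and> 0 \<in> D \<and> D \<subseteq> Kf n \<and> D \<inter> sphere 0 R \<noteq> {}" for n
        using H[rule_format, of n] unfolding P_def by (elim exE conjE) (intro exI conjI)
      fix C assume C: "compact C" "connected C" "0 \<in> C" "C \<subseteq> (\<Inter>n. Kf n)" "C \<inter> sphere 0 R \<noteq> {}"
      have "(\<Inter>n. Kf n) \<subseteq> K" by (auto simp: Kf_def K_def)
      then show ?thesis using that[OF C(1-3) _ C(5)] C(4) by (simp add: subset_trans)
    qed
  next
    assume H: "\<forall>N. \<exists>D. P D \<and> D \<subseteq> Kb N"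
    show ?thesis
    proof (rule nested_continuum[where K = Kb and a = 0 and S = "sphere 0 R", OF com(2) dec(2) _ closed_sphere])
      show "\<exists>D. connected D \<and> 0 \<in> D \<and> D \<subseteq> Kb n \<and> D \<inter> sphere 0 R \<noteq> {}" for n
        using H[rule_format, of n] unfolding P_def by (elim exE conjE) (intro exI conjI)
      fix C assume C: "compact C" "connected C" "0 \<in> C" "C \<subseteq> (\<Inter>n. Kb n)" "C \<inter> sphere 0 R \<noteq> {}"
      have "(\<Inter>n. Kb n) \<subseteq> K"
      proof
        fix x assume x: "x \<in> (\<Inter>n. Kb n)"
        then have "(H ^^ n) x \<in> cball 0 R" for n unfolding Kb_def by blast
        then show "x \<in> K" by (rule backward_orbit_in_K)
      qed
      then show ?thesis using that[OF C(1-3) _ C(5)] C(4) by (simp add: subset_trans)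
    qed
  qed
qed

section \<open>Fixed points of powers with torsion-free spectrum\<close>

text \<open>Open neighbourhoods of the closed set \<open>K\<close>, needed because holomorphy and
  derivatives of the powers of \<open>G\<close> require open domains.\<close>

definition staying :: "nat \<Rightarrow> (complex ^ 2) set" where
  "staying m = {x. \<forall>j\<le>m. (G ^^ j) x \<in> ball 0 R0}"

text \<open>The choice is meaningful on \<open>staying m\<close>, where the derivative exists and is
  unique.\<close>

definition dG :: "nat \<Rightarrow> complex ^ 2 \<Rightarrow> complex ^ 2 \<Rightarrow> complex ^ 2" where
  "dG m x = (SOME D. cderiv (G ^^ m) D x)"

definition E :: "nat \<Rightarrow> (complex ^ 2) set" where
  "E m = {x \<in> K. (G ^^ m) x = x \<and> torsion_free_spectrum (dG m x)}"

lemma ball_subset_U: "ball 0 R0 \<subseteq> U"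
  using R A ball_subset_cball[of 0 R0] by blast

lemma open_staying: "open (staying m)"
proof -
  have "continuous_on (ball 0 R0) G" by (rule continuous_on_subset[OF G_cont ball_subset_U])
  then show ?thesis unfolding staying_def by (rule open_orbit_within[OF open_ball])
qed

lemma K_staying: "K \<subseteq> staying m"
proof
  fix x assume x: "x \<in> K"
  have "(G ^^ j) x \<in> ball 0 R0" for j
  proof -
    have "(G ^^ j) x \<in> cball 0 R" using x by (simp add: K_def)
    then show ?thesis using R by simp
  qed
  then show "x \<in> staying m" by (simp add: staying_def)
qed

lemma cderiv_funpow_exists: "x \<in> staying m \<Longrightarrow> k \<le> Suc m \<Longrightarrow> \<exists>D. cderiv (G ^^ k) D x"
proof (induction k)
  case 0
  have "cderiv (G ^^ 0) (\<lambda>h. h) x" using cderiv_ident[of x] by (simp add: id_def)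
  then show ?case by (intro exI)
next
  case (Suc k)
  then obtain D where D: "cderiv (G ^^ k) D x" by auto
  have "(G ^^ k) x \<in> ball 0 R0" using Suc.prems by (simp add: staying_def)
  then have "(G ^^ k) x \<in> U" using ball_subset_U by blast
  then obtain D' where "cderiv G D' ((G ^^ k) x)" using G_hol unfolding holomorphic_map_on_iff by blast
  from cderiv_compose[OF D this] have "cderiv (G ^^ Suc k) (\<lambda>h. D' (D h)) x" by (simp add: comp_def)
  then show ?case by (intro exI)
qed

lemma hol_funpow: "holomorphic_map_on (G ^^ m) (staying m)"
  unfolding holomorphic_map_on_iff using open_staying cderiv_funpow_exists[of _ m m] by simp

lemma cderiv_dG: "x \<in> staying m \<Longrightarrow> cderiv (G ^^ m) (dG m x) x"
  unfolding dG_def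
  by (rule someI_ex[where P = "\<lambda>D. cderiv (G ^^ m) D x"]) (rule cderiv_funpow_exists[OF _ le_SucI[OF order_refl]])

lemma dG_eq: "cderiv (G ^^ m) D x \<Longrightarrow> dG m x = D"
  unfolding dG_def by (rule some_equality) (auto intro: cderiv_unique)

lemma cderiv_iterate_fixed:
  assumes "(G ^^ m) x = x" "x \<in> staying m"
  shows "cderiv ((G ^^ m) ^^ k) ((dG m x) ^^ k) x"
proof (induction k)
  case 0 show ?case using cderiv_ident[of x] by (simp add: id_def)
next
  case (Suc k)
  have "((G ^^ m) ^^ k) x = x" using assms(1) by (induction k) auto
  then have "cderiv (G ^^ m) (dG m x) (((G ^^ m) ^^ k) x)" using cderiv_dG assms by simp
  from cderiv_compose[OF Suc this] show ?case by (simp add: comp_def)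
qed

lemma dG_mult:
  assumes "(G ^^ m) x = x" "x \<in> staying m"
  shows "dG (m * k) x = (dG m x) ^^ k"
  using cderiv_iterate_fixed[OF assms, of k] by (intro dG_eq) (simp add: funpow_mult)

lemma dG_clinear: "x \<in> staying m \<Longrightarrow> clinear_op (dG m x)"
  using cderiv_dG cderiv_clinear by blast

lemma E_subset_mult:
  assumes "k \<ge> 1"
  shows "E m \<subseteq> E (m * k)"
proof
  fix x assume x: "x \<in> E m"
  then have K: "x \<in> K" and f: "(G ^^ m) x = x" and t: "torsion_free_spectrum (dG m x)" by (auto simp: E_def)
  have w: "x \<in> staying m" using K K_staying by blast
  have "((G ^^ m) ^^ k) x = x" using f by (induction k) auto
  moreover have "torsion_free_spectrum (dG (m * k) x)"
    unfolding dG_mult[OF f w] by (rule torsion_free_spectrum_funpow[OF dG_clinear[OF w] t assms])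
  ultimately show "x \<in> E (m * k)" using K by (simp add: E_def funpow_mult)
qed

lemma E_cover:
  assumes "x \<in> K"
  obtains m where "m \<ge> 1" "x \<in> E m"
proof -
  obtain p where p: "p \<ge> 1" "(G ^^ p) x = x" using K_periodic[OF assms] by blast
  have w: "x \<in> staying p" using assms K_staying by blast
  obtain n where n: "n \<ge> 1" "torsion_free_spectrum (dG p x ^^ n)"
    using torsion_free_power_exists[OF dG_clinear[OF w]] by blast
  have "((G ^^ p) ^^ n) x = x" using p(2) by (induction n) auto
  then have "x \<in> E (p * n)" using assms n by (simp add: E_def funpow_mult dG_mult[OF p(2) w])
  moreover have "p * n \<ge> 1" using p n by (simp add: Suc_le_eq)
  ultimately show ?thesis using that by blast
qed

text \<open>Telescoping \<open>f\<^sup>k z - z = \<Sum>\<^sub>i (f\<^sup>i (f z) - f\<^sup>i z)\<close> for \<open>f = G\<^sup>m\<close> gives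
  \<open>f\<^sup>k z - z = S (f z - z) + o(|f z - z|)\<close> where \<open>S = \<Sum>\<^sub>i A\<^sup>i\<close> is invertible.\<close>

lemma fixed_points_stabilize:
  assumes x: "x \<in> E m" and k: "k \<ge> 1"
  shows "\<exists>d>0. \<forall>z\<in>ball x d. (G ^^ (m * k)) z = z \<longrightarrow> (G ^^ m) z = z"
proof -
  define f where "f = G ^^ m"
  define a where "a = dG m x"
  have xK: "x \<in> K" and fx: "f x = x" and t: "torsion_free_spectrum a" using x by (auto simp: E_def f_def a_def)
  have w: "x \<in> staying n" for n using xK K_staying by blast
  have cla: "clinear_op a" unfolding a_def by (rule dG_clinear[OF w])
  have da: "cderiv (f ^^ i) (a ^^ i) x" for i
    using cderiv_iterate_fixed[OF _ w, of m i] fx by (simp add: f_def a_def)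
  have lai: "linear (a ^^ i)" for i using clinear_op_funpow[OF cla, of i] by (simp add: clinear_op_def)
  define S where "S = (\<lambda>v. \<Sum>i<k. (a ^^ i) v)"
  have lS: "linear S" unfolding S_def by (intro linear_compose_sum ballI lai)
  have "v = 0" if "S v = 0" for v
  proof (rule ccontr)
    assume "v \<noteq> 0"
    then obtain \<zeta> where "\<zeta> ^ k = 1" "\<zeta> \<noteq> 1" "eigenvalue a \<zeta>"
      using orbit_sum_kernel_eigenvalue[OF cla k] \<open>S v = 0\<close> by (auto simp: S_def)
    then show False using t k unfolding torsion_free_spectrum_def by blast
  qed
  then have "inj S" using linear_injective_0[OF lS] by blast
  then obtain B where B: "B > 0" "\<And>v. B * norm v \<le> norm (S v)"
    using linear_inj_bounded_below_pos[OF lS] by blast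
  \<comment> \<open>The \<open>k\<close> error terms of the telescoped sum then add up to at most
    half of the lower bound \<open>B * norm v\<close>.\<close>
  define e where "e = B / (2 * real k)"
  have e: "e > 0" using B k by (simp add: e_def)
  have "\<exists>d>0. \<forall>z\<in>ball x d. \<forall>y\<in>ball x d. norm ((f ^^ i) z - (f ^^ i) y - (a ^^ i) (z - y)) \<le> e * norm (z - y)" for i
  proof -
    have "holomorphic_map_on (f ^^ i) (staying (i * m))"
      using hol_funpow[of "i * m"] by (simp add: f_def funpow_mult mult.commute)
    from holomorphic_map_strict[OF this w da e] show ?thesis by metis
  qed
  then obtain d where d: "\<And>i. d i > 0" "\<And>i z y. z \<in> ball x (d i) \<Longrightarrow> y \<in> ball x (d i) \<Longrightarrow>
      norm ((f ^^ i) z - (f ^^ i) y - (a ^^ i) (z - y)) \<le> e * norm (z - y)" by metis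
  define \<delta> where "\<delta> = Min (d ` {..<k})"
  have k0: "{..<k} \<noteq> {}" using k by (simp add: lessThan_empty_iff)
  have \<delta>: "\<delta> > 0" "\<And>i. i < k \<Longrightarrow> \<delta> \<le> d i" using d(1) k0 by (auto simp: \<delta>_def)
  have "isCont f x" using cderiv_continuous[OF da[of 1]] by simp
  then obtain \<eta> where \<eta>: "\<eta> > 0" "\<And>z. dist z x < \<eta> \<Longrightarrow> dist (f z) (f x) < \<delta>"
    using \<delta>(1) unfolding continuous_at_eps_delta by metis
  show ?thesis
  proof (intro exI[of _ "min \<delta> \<eta>"] conjI ballI impI)
    show "min \<delta> \<eta> > 0" using \<delta> \<eta> by simp
    fix z assume z: "z \<in> ball x (min \<delta> \<eta>)" and fk: "(G ^^ (m * k)) z = z"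
    have fkz: "(f ^^ k) z = z" using fk by (simp add: f_def funpow_mult)
    have z1: "z \<in> ball x \<delta>" using z by simp
    have z2: "f z \<in> ball x \<delta>" using \<eta>(2)[of z] z fx by (simp add: dist_commute)
    define v where "v = f z - z"
    have tel: "(\<Sum>i<k. (f ^^ i) (f z) - (f ^^ i) z) = 0"
    proof -
      have "(\<Sum>i<k. (f ^^ i) (f z) - (f ^^ i) z) = (\<Sum>i<k. (f ^^ Suc i) z - (f ^^ i) z)"
        by (simp add: funpow_swap1)
      also have "\<dots> = (f ^^ k) z - (f ^^ 0) z" by (rule sum_lessThan_telescope)
      finally show ?thesis using fkz by simp
    qed
    have "B * norm v \<le> norm (S v)" by (rule B)
    also have "S v = - (\<Sum>i<k. (f ^^ i) (f z) - (f ^^ i) z - (a ^^ i) v)"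
      unfolding S_def using tel by (simp add: sum_subtractf)
    also have "norm \<dots> \<le> (\<Sum>i<k. norm ((f ^^ i) (f z) - (f ^^ i) z - (a ^^ i) v))"
      unfolding norm_minus_cancel by (rule norm_sum)
    also have "\<dots> \<le> (\<Sum>i<k. e * norm v)"
    proof (rule sum_mono)
      fix i assume "i \<in> {..<k}"
      then have "\<delta> \<le> d i" using \<delta> by simp
      then have "z \<in> ball x (d i)" "f z \<in> ball x (d i)" using z1 z2 by auto
      then show "norm ((f ^^ i) (f z) - (f ^^ i) z - (a ^^ i) v) \<le> e * norm v"
        unfolding v_def by (rule d(2)[rotated])
    qed
    also have "\<dots> = B / 2 * norm v" using k by (simp add: e_def)
    finally have "v = 0" using B(1) by (simp add: field_simps)
    then show "(G ^^ m) z = z" by (simp add: v_def f_def)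
  qed
qed

text \<open>Fixed points are handled by \<open>fixed_points_stabilize\<close>; the spectrum remains.
  If \<zeta> is a root of unity and an eigenvalue of \<open>dG m z\<close>, then
  \<open>\<zeta> ^ k\<close> is one of \<open>dG (m * k) z\<close>, so
  \<open>\<zeta> ^ k = 1\<close>. The finitely many such \<zeta> \<noteq> 1 are not eigenvalues at
  \<open>x\<close>, hence not at nearby points either.\<close>

lemma E_relatively_open:
  assumes x: "x \<in> E m" and k: "k \<ge> 1"
  shows "\<exists>d>0. \<forall>z\<in>ball x d. z \<in> E (m * k) \<longrightarrow> z \<in> E m"
proof -
  have xK: "x \<in> K" and t: "torsion_free_spectrum (dG m x)" using x by (auto simp: E_def)
  have w: "y \<in> staying n" if "y \<in> K" for n y using that K_staying by blast
  obtain d1 where d1: "d1 > 0" "\<And>z. z \<in> ball x d1 \<Longrightarrow> (G ^^ (m * k)) z = z \<Longrightarrow> (G ^^ m) z = z"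
    using fixed_points_stabilize[OF assms] by metis
  define Z where "Z = {\<zeta>::complex. \<zeta> ^ k = 1 \<and> \<zeta> \<noteq> 1}"
  have "Z \<subseteq> {\<zeta>. \<zeta> ^ k = 1}" by (auto simp: Z_def)
  then have finZ: "finite Z" using finite_roots_unity[OF k] finite_subset by blast
  have "\<exists>c>0. \<forall>D. (\<forall>h. norm (D h - dG m x h) \<le> c * norm h) \<longrightarrow> \<not> eigenvalue D \<zeta>" if "\<zeta> \<in> Z" for \<zeta>
  proof -
    have "\<not> eigenvalue (dG m x) \<zeta>" using t that k unfolding torsion_free_spectrum_def Z_def by blast
    from not_eigenvalue_stable[OF dG_clinear[OF w[OF xK]] this] show ?thesis by metis
  qed
  then obtain c where c: "\<And>\<zeta>. \<zeta> \<in> Z \<Longrightarrow> c \<zeta> > 0"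
    "\<And>\<zeta> D. \<zeta> \<in> Z \<Longrightarrow> (\<And>h. norm (D h - dG m x h) \<le> c \<zeta> * norm h) \<Longrightarrow> \<not> eigenvalue D \<zeta>"
    by metis
  define e where "e = Min (insert 1 (c ` Z))"
  have e: "e > 0" "\<And>\<zeta>. \<zeta> \<in> Z \<Longrightarrow> e \<le> c \<zeta>" using c(1) finZ by (auto simp: e_def)
  obtain d2 where d2: "d2 > 0" "\<And>z D h. z \<in> ball x d2 \<Longrightarrow> cderiv (G ^^ m) D z \<Longrightarrow> norm (D h - dG m x h) \<le> e * norm h"
    using holomorphic_map_deriv_close[OF hol_funpow w[OF xK] cderiv_dG[OF w[OF xK]] e(1)] by metis
  show ?thesis
  proof (intro exI[of _ "min d1 d2"] conjI ballI impI)
    show "min d1 d2 > 0" using d1 d2 by simp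
    fix z assume z: "z \<in> ball x (min d1 d2)" and zE: "z \<in> E (m * k)"
    have zK: "z \<in> K" using zE by (simp add: E_def)
    have fz: "(G ^^ m) z = z" using d1(2)[of z] z zE by (simp add: E_def)
    have "torsion_free_spectrum (dG m z)"
      unfolding torsion_free_spectrum_def
    proof (intro allI impI)
      fix \<zeta> j assume j: "j \<ge> (1::nat)" "\<zeta> ^ j = 1" and ev: "eigenvalue (dG m z) \<zeta>"
      have "eigenvalue (dG (m * k) z) (\<zeta> ^ k)"
        unfolding dG_mult[OF fz w[OF zK]] by (rule eigenvalue_funpow[OF dG_clinear[OF w[OF zK]] ev])
      moreover have "(\<zeta> ^ k) ^ j = 1" using j by (metis power_mult mult.commute power_one)
      ultimately have zk: "\<zeta> ^ k = 1"
        using zE j(1) unfolding E_def torsion_free_spectrum_def by blast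
      show "\<zeta> = 1"
      proof (rule ccontr)
        assume "\<zeta> \<noteq> 1"
        then have "\<zeta> \<in> Z" using zk by (simp add: Z_def)
        have "norm (dG m z h - dG m x h) \<le> c \<zeta> * norm h" for h
        proof -
          have "norm (dG m z h - dG m x h) \<le> e * norm h"
            using d2(2)[OF _ cderiv_dG[OF w[OF zK]]] z by simp
          also have "\<dots> \<le> c \<zeta> * norm h" using e(2)[OF \<open>\<zeta> \<in> Z\<close>] by (simp add: mult_right_mono)
          finally show ?thesis .
        qed
        then show False using c(2)[OF \<open>\<zeta> \<in> Z\<close>] ev by blast
      qed
    qed
    then show "z \<in> E m" using zK fz by (simp add: E_def)
  qed
qed

lemma K_closed: "closed K"
proof -
  have "continuous_on (cball 0 R) G" using G_cont BA continuous_on_subset by blast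
  then have "closed {x. \<forall>j\<le>N. (G ^^ j) x \<in> cball 0 R}" for N by (rule closed_orbit_within[OF closed_cball])
  moreover have "K = (\<Inter>N. {x. \<forall>j\<le>N. (G ^^ j) x \<in> cball 0 R})" unfolding K_def by blast
  ultimately show ?thesis by auto
qed

end

section \<open>Curves of fixed points with a neutral transversal multiplier\<close>

text \<open>Cauchy's estimate on discs of radius \<open>r / 4\<close> bounds the second derivative
  by \<open>2 * M / (r / 4)^2\<close>, whence the 32.\<close>

lemma holomorphic_second_order_bound:
  fixes g :: "complex \<Rightarrow> complex"
  assumes g: "g holomorphic_on ball 0 r" and r: "r > 0"
    and M: "\<And>w. w \<in> ball 0 r \<Longrightarrow> norm (g w) \<le> M" and w: "norm w < r / 2"
  shows "norm (g w - g 0 - deriv g 0 * w) \<le> 32 * M / r\<^sup>2 * (norm w)\<^sup>2"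
proof -
  let ?S = "ball (0::complex) (r / 2)"
  have sub: "?S \<subseteq> ball 0 r" using r by auto
  have "norm ((deriv ^^ 0) g w - (\<Sum>i\<le>1. (deriv ^^ i) g 0 * (w - 0) ^ i / fact i)) \<le> 32 * M / r\<^sup>2 * norm (w - 0) ^ Suc 1 / fact 1"
  proof (rule complex_Taylor[where S = ?S])
    show "convex ?S" by simp
    show "((deriv ^^ i) g has_field_derivative (deriv ^^ Suc i) g x) (at x within ?S)" if "x \<in> ?S" for i x
    proof -
      have "(deriv ^^ i) g holomorphic_on ball 0 r" by (rule holomorphic_higher_deriv[OF g open_ball])
      then have "((deriv ^^ i) g has_field_derivative deriv ((deriv ^^ i) g) x) (at x)"
        using holomorphic_derivI[OF _ open_ball] that sub by blast
      then show ?thesis by (simp add: has_field_derivative_at_within)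
    qed
    show "norm ((deriv ^^ Suc 1) g x) \<le> 32 * M / r\<^sup>2" if x: "x \<in> ?S" for x
    proof -
      have sub2: "cball x (r / 4) \<subseteq> ball 0 r"
      proof
        fix y assume "y \<in> cball x (r / 4)"
        then have "dist x y \<le> r / 4" by simp
        then show "y \<in> ball 0 r" using x r dist_triangle[of 0 y x] by simp
      qed
      have "norm ((deriv ^^ 2) g x) \<le> fact 2 * M / (r / 4) ^ 2"
      proof (rule Cauchy_inequality)
        show "g holomorphic_on ball x (r / 4)"
          by (rule holomorphic_on_subset[OF g subset_trans[OF ball_subset_cball sub2]])
        show "continuous_on (cball x (r / 4)) g"
          by (rule continuous_on_subset[OF holomorphic_on_imp_continuous_on[OF g] sub2])
        show "0 < r / 4" using r by simp
        show "norm (g y) \<le> M" if "norm (x - y) = r / 4" for y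
        proof -
          have "y \<in> cball x (r / 4)" using that by (simp add: dist_norm)
          then show ?thesis using sub2 M by blast
        qed
      qed
      then show ?thesis by (simp add: power2_eq_square numeral_2_eq_2)
    qed
    show "0 \<in> ?S" "w \<in> ?S" using r w by auto
  qed
  then show ?thesis by (simp add: power2_eq_square algebra_simps)
qed

lemma pos_lower_bound:
  fixes a b c d :: real
  assumes "0 < a" "0 < b" "0 < c" "0 < d"
  shows "\<exists>s>0. s \<le> a \<and> s \<le> b \<and> s \<le> c \<and> s \<le> d"
  using assms by (intro exI[of _ "min (min a b) (min c d)"]) auto

text \<open>\<open>F1\<close> and \<open>F2\<close> are the coordinates of a map in an eigenbasis for the eigenvalues \<open>1\<close> and \<open>\<zeta>\<close> of its
  derivative at the origin.  Its holomorphy is needed, and stated, only along holomorphic curves.\<close>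

locale neutral_saddle =
  fixes F1 F2 :: "complex \<Rightarrow> complex \<Rightarrow> complex" and \<zeta> :: complex and d :: real
  assumes d: "d > 0" and \<zeta>1: "\<zeta> \<noteq> 1" and \<zeta>n: "norm \<zeta> = 1"
    and F0: "F1 0 0 = 0" "F2 0 0 = 0"
    and hol1: "\<And>S u v. open S \<Longrightarrow> u holomorphic_on S \<Longrightarrow> v holomorphic_on S \<Longrightarrow>
      (\<And>s. s \<in> S \<Longrightarrow> norm (u s) < d \<and> norm (v s) < d) \<Longrightarrow> (\<lambda>s. F1 (u s) (v s)) holomorphic_on S"
    and hol2: "\<And>S u v. open S \<Longrightarrow> u holomorphic_on S \<Longrightarrow> v holomorphic_on S \<Longrightarrow>
      (\<And>s. s \<in> S \<Longrightarrow> norm (u s) < d \<and> norm (v s) < d) \<Longrightarrow> (\<lambda>s. F2 (u s) (v s)) holomorphic_on S"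
    and lip1: "\<And>a b a' b'. norm a < d \<Longrightarrow> norm b < d \<Longrightarrow> norm a' < d \<Longrightarrow> norm b' < d \<Longrightarrow>
      norm (F1 a b - F1 a' b' - (a - a')) \<le> 1 / 4 * (norm (a - a') + norm (b - b'))"
    and lip2: "\<And>a b a' b'. norm a < d \<Longrightarrow> norm b < d \<Longrightarrow> norm a' < d \<Longrightarrow> norm b' < d \<Longrightarrow>
      norm (F2 a b - F2 a' b' - \<zeta> * (b - b')) \<le> norm (\<zeta> - 1) / 4 * (norm (a - a') + norm (b - b'))"
    and small: "\<And>e. e > 0 \<Longrightarrow> \<exists>\<delta>>0. \<forall>w. norm w < \<delta> \<longrightarrow> norm (F1 0 w) \<le> e * norm w \<and> norm (F2 0 w - \<zeta> * w) \<le> e * norm w"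
    and accum: "\<And>e. e > 0 \<Longrightarrow> \<exists>a b. norm a < e \<and> norm b < e \<and> (a \<noteq> 0 \<or> b \<noteq> 0) \<and> F1 a b = a \<and> F2 a b = b"
begin

section \<open>The fixed curve as a holomorphic graph\<close>

text \<open>A Newton step in \<open>b\<close> for the equation \<open>F2 a b = b\<close>, with the
  derivative frozen at its value \<open>\<zeta> - 1\<close> at the origin; \<open>lip2\<close> makes
  it a contraction in \<open>b\<close> with factor 1/4.\<close>

definition T :: "complex \<Rightarrow> complex \<Rightarrow> complex" where
  "T a b = b - (F2 a b - b) / (\<zeta> - 1)"

fun picard :: "nat \<Rightarrow> complex \<Rightarrow> complex" where
  "picard 0 a = 0"
| "picard (Suc n) a = T a (picard n a)"

lemma T_lip:
  assumes "norm a < d" "norm b < d" "norm a' < d" "norm b' < d"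
  shows "norm (T a b - T a' b') \<le> 1 / 4 * (norm (a - a') + norm (b - b'))"
proof -
  have z: "\<zeta> - 1 \<noteq> 0" using \<zeta>1 by simp
  have "T a b - T a' b' = - ((F2 a b - F2 a' b' - \<zeta> * (b - b')) / (\<zeta> - 1))"
    unfolding T_def using z by (simp add: divide_simps) (simp add: algebra_simps)
  then have "norm (T a b - T a' b') = norm (F2 a b - F2 a' b' - \<zeta> * (b - b')) / norm (\<zeta> - 1)"
    by (simp add: norm_divide)
  also have "\<dots> \<le> (norm (\<zeta> - 1) / 4 * (norm (a - a') + norm (b - b'))) / norm (\<zeta> - 1)"
    by (rule divide_right_mono[OF lip2[OF assms] norm_ge_zero])
  also have "\<dots> = 1 / 4 * (norm (a - a') + norm (b - b'))" using z by simp
  finally show ?thesis .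
qed

lemma T0: "T 0 0 = 0" by (simp add: T_def F0)

lemma T_fixed_iff: "T a b = b \<longleftrightarrow> F2 a b = b"
  using \<zeta>1 by (simp add: T_def)

lemma picard_bound: "norm a < d \<Longrightarrow> norm (picard n a) \<le> norm a"
proof (induction n)
  case (Suc n)
  have "norm (T a (picard n a) - T 0 0) \<le> 1 / 4 * (norm (a - 0) + norm (picard n a - 0))"
    using Suc d by (intro T_lip) auto
  then have "norm (T a (picard n a)) \<le> 1 / 4 * (norm a + norm (picard n a))" by (simp add: T0)
  moreover have "norm (picard n a) \<le> norm a" using Suc by simp
  moreover have "0 \<le> norm a" by simp
  ultimately have "norm (T a (picard n a)) \<le> norm a" by argo
  then show ?case by simp
qed simp

lemma picard_step: "norm a < d \<Longrightarrow> norm (picard (Suc n) a - picard n a) \<le> d * (1 / 4) ^ n"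
proof (induction n)
  case 0
  then show ?case using picard_bound[of a "Suc 0"] by simp
next
  case (Suc n)
  have lt: "norm (picard i a) < d" for i using picard_bound[OF Suc.prems, of i] Suc.prems by simp
  have "norm (T a (picard (Suc n) a) - T a (picard n a)) \<le> 1 / 4 * (norm (a - a) + norm (picard (Suc n) a - picard n a))"
    by (intro T_lip Suc.prems lt)
  also have "\<dots> \<le> 1 / 4 * (d * (1 / 4) ^ n)" using Suc by simp
  finally show ?case by simp
qed

lemma picard_holomorphic: "picard n holomorphic_on ball 0 d"
proof (induction n)
  case 0
  have "picard 0 = (\<lambda>a. 0)" by (simp add: fun_eq_iff)
  then show ?case by simp
next
  case (Suc n)
  have "(\<lambda>a. F2 a (picard n a)) holomorphic_on ball 0 d"
  proof (rule hol2[OF open_ball _ Suc])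
    show "norm a < d \<and> norm (picard n a) < d" if "a \<in> ball 0 d" for a
      using that picard_bound[of a n] by simp
  qed (intro holomorphic_intros)
  then have "(\<lambda>a. picard n a - (F2 a (picard n a) - picard n a) / (\<zeta> - 1)) holomorphic_on ball 0 d"
    using \<zeta>1 by (intro holomorphic_intros Suc) auto
  moreover have "picard (Suc n) = (\<lambda>a. picard n a - (F2 a (picard n a) - picard n a) / (\<zeta> - 1))"
    by (simp add: fun_eq_iff T_def)
  ultimately show ?case by simp
qed

text \<open>The limit of the Picard iterates, written as a telescoping series so that the M-test
  gives uniform convergence and thereby holomorphy.\<close>

definition \<eta> :: "complex \<Rightarrow> complex" where
  "\<eta> a = (\<Sum>n. picard (Suc n) a - picard n a)"

lemma picard_uniform: "uniform_limit (ball 0 d) picard \<eta> sequentially"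
proof -
  have "uniform_limit (ball 0 d) (\<lambda>n a. \<Sum>i<n. picard (Suc i) a - picard i a) \<eta> sequentially"
    unfolding \<eta>_def
  proof (rule Weierstrass_m_test)
    show "norm (picard (Suc n) a - picard n a) \<le> d * (1 / 4) ^ n" if "a \<in> ball 0 d" for n a
      using that picard_step by simp
    show "summable (\<lambda>n. d * (1 / 4) ^ n)" by (intro summable_mult summable_geometric) simp
  qed
  moreover have "(\<Sum>i<n. picard (Suc i) a - picard i a) = picard n a" for n a
    by (subst sum_lessThan_telescope) simp
  ultimately show ?thesis by simp
qed

lemma \<eta>_lim: "norm a < d \<Longrightarrow> (\<lambda>n. picard n a) \<longlonglongrightarrow> \<eta> a"
  using tendsto_uniform_limitI[OF picard_uniform] by simp

lemma \<eta>_holomorphic: "\<eta> holomorphic_on ball 0 d"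
proof (rule holomorphic_uniform_sequence[OF open_ball picard_holomorphic])
  fix x :: complex assume "x \<in> ball 0 d"
  then obtain e where "e > 0" "cball x e \<subseteq> ball 0 d" by (meson open_ball open_contains_cball)
  then show "\<exists>e>0. cball x e \<subseteq> ball 0 d \<and> uniform_limit (cball x e) picard \<eta> sequentially"
    using uniform_limit_on_subset[OF picard_uniform] by blast
qed

lemma \<eta>_bound: "norm a < d \<Longrightarrow> norm (\<eta> a) \<le> norm a"
  using tendsto_norm[OF \<eta>_lim] picard_bound by (intro LIMSEQ_le_const2[of "\<lambda>n. norm (picard n a)"]) auto

lemma \<eta>_0: "\<eta> 0 = 0" using \<eta>_bound[of 0] d by simp

lemma \<eta>_fixed:
  assumes a: "norm a < d"
  shows "F2 a (\<eta> a) = \<eta> a"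
proof -
  have lt: "norm (picard i a) < d" "norm (\<eta> a) < d" for i
    using picard_bound[OF a, of i] \<eta>_bound[OF a] a by auto
  have "(\<lambda>n. T a (picard n a)) \<longlonglongrightarrow> T a (\<eta> a)"
  proof (rule metric_tendsto_imp_tendsto[OF \<eta>_lim[OF a]], intro always_eventually allI)
    fix n
    have "dist (T a (picard n a)) (T a (\<eta> a)) \<le> 1 / 4 * (norm (a - a) + norm (picard n a - \<eta> a))"
      unfolding dist_norm by (intro T_lip a lt)
    also have "\<dots> = 1 / 4 * dist (picard n a) (\<eta> a)" by (simp add: dist_norm)
    also have "\<dots> \<le> dist (picard n a) (\<eta> a)"
      using zero_le_dist[of "picard n a" "\<eta> a"] by argo
    finally show "dist (T a (picard n a)) (T a (\<eta> a)) \<le> dist (picard n a) (\<eta> a)" .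
  qed
  moreover have "(\<lambda>n. T a (picard n a)) \<longlonglongrightarrow> \<eta> a"
    using LIMSEQ_Suc[OF \<eta>_lim[OF a]] by simp
  ultimately have "T a (\<eta> a) = \<eta> a" by (rule LIMSEQ_unique)
  then show ?thesis by (simp add: T_fixed_iff)
qed

lemma \<eta>_unique:
  assumes "norm a < d" "norm b < d" "F2 a b = b"
  shows "b = \<eta> a"
proof -
  have lt: "norm (\<eta> a) < d" using \<eta>_bound assms by force
  have "norm (T a b - T a (\<eta> a)) \<le> 1 / 4 * (norm (a - a) + norm (b - \<eta> a))"
    by (intro T_lip assms lt)
  moreover have "T a b = b" "T a (\<eta> a) = \<eta> a" using assms \<eta>_fixed by (auto simp: T_fixed_iff)
  ultimately show ?thesis by simp
qed

text \<open>Every fixed point in the bidisc lies on the graph of \<eta>. As fixed points accumulate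
  at the origin, the holomorphic function \<open>F1 a (\<eta> a) - a\<close> has accumulating zeros
  and vanishes identically: the whole graph is fixed.\<close>

lemma graph_fixed:
  assumes a: "norm a < d"
  shows "F1 a (\<eta> a) = a"
proof -
  define g where "g a = F1 a (\<eta> a) - a" for a
  have holg: "g holomorphic_on ball 0 d"
  proof -
    have "(\<lambda>a. F1 a (\<eta> a)) holomorphic_on ball 0 d"
    proof (rule hol1[OF open_ball _ \<eta>_holomorphic])
      show "norm s < d \<and> norm (\<eta> s) < d" if "s \<in> ball 0 d" for s
        using that \<eta>_bound[of s] by simp
    qed (intro holomorphic_intros)
    then show ?thesis unfolding g_def by (intro holomorphic_intros)
  qed
  define Z where "Z = {a \<in> ball 0 d. g a = 0}"
  have "0 islimpt Z"
    unfolding islimpt_approachable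
  proof (intro allI impI)
    fix e :: real assume "e > 0"
    then have "min e d > 0" using d by simp
    from accum[OF this] obtain a b where ab: "norm a < min e d" "norm b < min e d" "a \<noteq> 0 \<or> b \<noteq> 0"
      "F1 a b = a" "F2 a b = b" by blast
    have b: "b = \<eta> a" using ab by (intro \<eta>_unique) auto
    then have "a \<noteq> 0" using ab(3) \<eta>_0 by auto
    moreover have "a \<in> Z" using ab b by (simp add: Z_def g_def)
    ultimately show "\<exists>x'\<in>Z. x' \<noteq> 0 \<and> dist x' 0 < e" using ab by auto
  qed
  then have "g a = 0"
  proof (rule analytic_continuation[OF holg open_ball connected_ball, rotated 2])
    show "Z \<subseteq> ball 0 d" by (auto simp: Z_def)
    show "g z = 0" if "z \<in> Z" for z using that by (simp add: Z_def)
    show "0 \<in> ball 0 d" "a \<in> ball 0 d" using a d by simp_all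
  qed
  then show ?thesis by (simp add: g_def)
qed

section \<open>The transversal multiplier\<close>

text \<open>With heights measured from the graph of \<eta>, the point over \<open>a\<close> at
  height \<open>w\<close> is mapped to a point of height \<open>\<psi> a w\<close>. The first
  coordinate moves as well, so \<eta> is evaluated over the image.\<close>

definition \<psi> :: "complex \<Rightarrow> complex \<Rightarrow> complex" where
  "\<psi> a w = F2 a (\<eta> a + w) - \<eta> (F1 a (\<eta> a + w))"

definition \<mu> :: "complex \<Rightarrow> complex" where "\<mu> a = deriv (\<psi> a) 0"

lemma shift_bound:
  assumes "norm a < d / 4" "norm w < d / 4"
  shows "norm (\<eta> a + w) < d" "norm (F1 a (\<eta> a + w)) < d" "norm (F1 a (\<eta> a + w) - a) \<le> 1 / 4 * norm w"
proof -
  have n: "norm (\<eta> a) \<le> norm a" "norm (\<eta> a) < d" "norm a < d" using \<eta>_bound[of a] assms d by auto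
  have "norm (\<eta> a + w) \<le> norm a + norm w" using norm_triangle_ineq[of "\<eta> a" w] n by simp
  then show 1: "norm (\<eta> a + w) < d" using assms d by linarith
  have "norm (F1 a (\<eta> a + w) - F1 a (\<eta> a) - (a - a)) \<le> 1 / 4 * (norm (a - a) + norm (\<eta> a + w - \<eta> a))"
    by (intro lip1 1 n)
  then show 2: "norm (F1 a (\<eta> a + w) - a) \<le> 1 / 4 * norm w" using graph_fixed[OF n(3)] by simp
  have "norm (F1 a (\<eta> a + w)) \<le> norm a + norm (F1 a (\<eta> a + w) - a)"
    by (metis add_diff_cancel_left' diff_add_cancel norm_triangle_sub)
  then show "norm (F1 a (\<eta> a + w)) < d" using 2 assms d by linarith
qed

lemma \<psi>_0: "norm a < d / 4 \<Longrightarrow> \<psi> a 0 = 0"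
  using \<eta>_fixed[of a] graph_fixed[of a] d by (simp add: \<psi>_def)

lemma \<psi>_bound:
  assumes "norm a < d / 4" "norm w < d / 4"
  shows "norm (\<psi> a w) \<le> 6 * d"
proof -
  note s = shift_bound[OF assms]
  have "norm (\<zeta> - 1) \<le> 2" using norm_triangle_ineq4[of \<zeta> 1] \<zeta>n by simp
  have "norm (F2 a (\<eta> a + w) - F2 0 0 - \<zeta> * (\<eta> a + w - 0)) \<le> norm (\<zeta> - 1) / 4 * (norm (a - 0) + norm (\<eta> a + w - 0))"
    using assms s d by (intro lip2) auto
  also have "\<dots> \<le> 2 / 4 * (d + d)"
    using assms s d \<open>norm (\<zeta> - 1) \<le> 2\<close> by (intro mult_mono add_mono) auto
  finally have "norm (F2 a (\<eta> a + w) - \<zeta> * (\<eta> a + w)) \<le> d" by (simp add: F0)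
  moreover have "norm (\<zeta> * (\<eta> a + w)) \<le> d" using s \<zeta>n by (simp add: norm_mult)
  ultimately have "norm (F2 a (\<eta> a + w)) \<le> 2 * d"
    using norm_triangle_sub[of "F2 a (\<eta> a + w)" "\<zeta> * (\<eta> a + w)"] by simp
  moreover have "norm (\<eta> (F1 a (\<eta> a + w))) \<le> d" using \<eta>_bound[OF s(2)] s(2) by simp
  ultimately show ?thesis unfolding \<psi>_def
    using norm_triangle_ineq4[of "F2 a (\<eta> a + w)" "\<eta> (F1 a (\<eta> a + w))"] d by simp
qed

lemma holomorphic_compose_\<eta>:
  assumes "open S" "u holomorphic_on S" "\<And>s. s \<in> S \<Longrightarrow> norm (u s) < d"
  shows "(\<lambda>s. \<eta> (u s)) holomorphic_on S"
proof -
  have "u ` S \<subseteq> ball 0 d" using assms(3) by auto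
  then show ?thesis using holomorphic_on_compose_gen[OF assms(2) \<eta>_holomorphic] by (simp add: comp_def)
qed

lemma \<psi>_holomorphic_w:
  assumes "norm a < d / 4"
  shows "\<psi> a holomorphic_on ball 0 (d / 4)"
proof -
  have 1: "(\<lambda>w. F1 a (\<eta> a + w)) holomorphic_on ball 0 (d / 4)"
    using shift_bound[OF assms] assms d by (intro hol1 holomorphic_intros) auto
  have 2: "(\<lambda>w. F2 a (\<eta> a + w)) holomorphic_on ball 0 (d / 4)"
    using shift_bound[OF assms] assms d by (intro hol2 holomorphic_intros) auto
  have "(\<lambda>w. \<eta> (F1 a (\<eta> a + w))) holomorphic_on ball 0 (d / 4)"
    using shift_bound[OF assms] by (intro holomorphic_compose_\<eta> 1) auto
  with 2 have "(\<lambda>w. F2 a (\<eta> a + w) - \<eta> (F1 a (\<eta> a + w))) holomorphic_on ball 0 (d / 4)"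
    by (rule holomorphic_on_diff)
  then show ?thesis by (simp add: \<psi>_def[abs_def])
qed

lemma \<psi>_holomorphic_a:
  assumes w: "norm w < d / 4"
  shows "(\<lambda>a. \<psi> a w) holomorphic_on ball 0 (d / 4)"
proof -
  have sub: "ball 0 (d / 4) \<subseteq> ball (0::complex) d" using d by auto
  have e: "\<eta> holomorphic_on ball 0 (d / 4)" by (rule holomorphic_on_subset[OF \<eta>_holomorphic sub])
  have 1: "(\<lambda>a. F1 a (\<eta> a + w)) holomorphic_on ball 0 (d / 4)"
    using shift_bound(1)[OF _ w] d by (intro hol1 holomorphic_intros e) auto
  have 2: "(\<lambda>a. F2 a (\<eta> a + w)) holomorphic_on ball 0 (d / 4)"
    using shift_bound(1)[OF _ w] d by (intro hol2 holomorphic_intros e) auto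
  have "(\<lambda>a. \<eta> (F1 a (\<eta> a + w))) holomorphic_on ball 0 (d / 4)"
    using shift_bound(2)[OF _ w] by (intro holomorphic_compose_\<eta> 1) auto
  with 2 show ?thesis unfolding \<psi>_def by (rule holomorphic_on_diff)
qed

lemma \<psi>_second_order:
  "\<exists>B>0. \<forall>a w. norm a < d / 4 \<longrightarrow> norm w < d / 8 \<longrightarrow> norm (\<psi> a w - \<mu> a * w) \<le> B * (norm w)\<^sup>2"
proof (intro exI[of _ "32 * (6 * d) / (d / 4)\<^sup>2"] conjI allI impI)
  show "0 < 32 * (6 * d) / (d / 4)\<^sup>2" using d by simp
  fix a w :: complex assume aw: "norm a < d / 4" "norm w < d / 8"
  have "norm (\<psi> a w - \<psi> a 0 - deriv (\<psi> a) 0 * w) \<le> 32 * (6 * d) / (d / 4)\<^sup>2 * (norm w)\<^sup>2"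
    using d aw by (intro holomorphic_second_order_bound \<psi>_holomorphic_w \<psi>_bound) auto
  then show "norm (\<psi> a w - \<mu> a * w) \<le> 32 * (6 * d) / (d / 4)\<^sup>2 * (norm w)\<^sup>2"
    using \<psi>_0[OF aw(1)] by (simp add: \<mu>_def)
qed

text \<open>The quotients \<open>\<psi> a w / w\<close> are holomorphic in \<open>a\<close> for
  fixed \<open>w\<close> and, the second-order bound being uniform in \<open>a\<close>, converge
  uniformly to \<mu> as \<open>w\<close> tends to 0. Separate holomorphy of \<psi> suffices for
  this.\<close>

lemma \<mu>_holomorphic: "\<mu> holomorphic_on ball 0 (d / 4)"
proof -
  obtain B where B: "B > 0" "\<And>a w. norm a < d / 4 \<Longrightarrow> norm w < d / 8 \<Longrightarrow> norm (\<psi> a w - \<mu> a * w) \<le> B * (norm w)\<^sup>2"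
    using \<psi>_second_order by blast
  \<comment> \<open>The shift by 9 puts \<open>w n\<close> into the disc of radius
    \<open>d / 8\<close> already for \<open>n = 0\<close>.\<close>
  define w where "w n = complex_of_real (d / (real n + 9))" for n
  have w: "norm (w n) = d / (real n + 9)" "w n \<noteq> 0" "norm (w n) < d / 8" "norm (w n) < d / 4" for n
  proof -
    show n: "norm (w n) = d / (real n + 9)" for n
      using d unfolding w_def norm_of_real by simp
    have "norm (w n) > 0" using n[of n] d by simp
    then show "w n \<noteq> 0" by simp
    have "d / (real n + 9) \<le> d / 9" using d by (intro divide_left_mono) auto
    then show "norm (w n) < d / 8" "norm (w n) < d / 4" using n[of n] d by auto
  qed
  have w0: "(\<lambda>n. norm (w n)) \<longlonglongrightarrow> 0"
    unfolding w(1)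
  proof (rule real_tendsto_divide_at_top[OF tendsto_const])
    show "filterlim (\<lambda>n. real n + 9) at_top sequentially"
      using filterlim_tendsto_add_at_top[OF tendsto_const filterlim_real_sequentially, of 9] by (simp add: add.commute)
  qed
  have ul: "uniform_limit (ball 0 (d / 4)) (\<lambda>n a. \<psi> a (w n) / w n) \<mu> sequentially"
    unfolding uniform_limit_iff
  proof (intro allI impI)
    fix e :: real assume e: "e > 0"
    have "eventually (\<lambda>n. norm (w n) < e / B) sequentially"
      using w0 e B(1) order_tendstoD(2)[OF w0, of "e / B"] by simp
    then show "\<forall>\<^sub>F n in sequentially. \<forall>a\<in>ball 0 (d / 4). dist (\<psi> a (w n) / w n) (\<mu> a) < e"
    proof (rule eventually_mono, intro ballI)
      fix n a assume n: "norm (w n) < e / B" and a: "a \<in> ball (0::complex) (d / 4)"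
      have "\<psi> a (w n) / w n - \<mu> a = (\<psi> a (w n) - \<mu> a * w n) / w n" using w(2) by (simp add: field_simps)
      then have "norm (\<psi> a (w n) / w n - \<mu> a) = norm (\<psi> a (w n) - \<mu> a * w n) / norm (w n)"
        by (simp add: norm_divide)
      also have "\<dots> \<le> (B * (norm (w n))\<^sup>2) / norm (w n)"
      proof (rule divide_right_mono)
        show "norm (\<psi> a (w n) - \<mu> a * w n) \<le> B * (norm (w n))\<^sup>2" using B(2)[of a "w n"] a w(3) by simp
      qed simp
      also have "\<dots> = B * norm (w n)" using w(2) by (simp add: power2_eq_square)
      also have "\<dots> < e" using n B(1) by (simp add: field_simps)
      finally show "dist (\<psi> a (w n) / w n) (\<mu> a) < e" by (simp add: dist_norm)
    qed
  qed
  show ?thesis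
  proof (rule holomorphic_uniform_sequence[OF open_ball])
    show "(\<lambda>a. \<psi> a (w n) / w n) holomorphic_on ball 0 (d / 4)" for n
      using w by (intro holomorphic_intros \<psi>_holomorphic_a) auto
    fix x :: complex assume "x \<in> ball 0 (d / 4)"
    then obtain e where "e > 0" "cball x e \<subseteq> ball 0 (d / 4)" by (meson open_ball open_contains_cball)
    then show "\<exists>e>0. cball x e \<subseteq> ball 0 (d / 4) \<and> uniform_limit (cball x e) (\<lambda>n a. \<psi> a (w n) / w n) \<mu> sequentially"
      using uniform_limit_on_subset[OF ul] by blast
  qed
qed

text \<open>Because \<open>\<eta> 0 = 0\<close> and \<eta> does not increase norms,
  \<open>small\<close> makes both \<open>F2 0 w - \<zeta> * w\<close> and
  \<open>\<eta> (F1 0 w)\<close> of order o(|w|).\<close>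

lemma \<mu>_0: "\<mu> 0 = \<zeta>"
proof -
  obtain B where B: "B > 0" "\<And>a w. norm a < d / 4 \<Longrightarrow> norm w < d / 8 \<Longrightarrow> norm (\<psi> a w - \<mu> a * w) \<le> B * (norm w)\<^sup>2"
    using \<psi>_second_order by blast
  have "norm (\<mu> 0 - \<zeta>) \<le> 0"
  proof (rule field_le_epsilon)
    fix e :: real assume e: "e > 0"
    then obtain \<delta> where \<delta>: "\<delta> > 0" "\<And>w. norm w < \<delta> \<Longrightarrow> norm (F1 0 w) \<le> e / 3 * norm w \<and> norm (F2 0 w - \<zeta> * w) \<le> e / 3 * norm w"
      using small[of "e / 3"] by auto
    have "0 < d / 8" "0 < e / (3 * B)" using d e B by simp_all
    from pos_lower_bound[OF \<delta>(1) this \<delta>(1)]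
    obtain m where m: "m > 0" "m \<le> \<delta>" "m \<le> d / 8" "m \<le> e / (3 * B)" by blast
    define t where "t = m / 2"
    have t: "t > 0" "t < \<delta>" "t < d / 8" "t < e / (3 * B)" using m unfolding t_def by linarith+
    define w where "w = complex_of_real t"
    have nw: "norm w = t" using t by (simp add: w_def)
    have 1: "norm (\<psi> 0 w - \<mu> 0 * w) \<le> B * t\<^sup>2" using B(2)[of 0 w] nw t d by simp
    have "B * t\<^sup>2 \<le> e / 3 * t" using t(1,4) B(1) by (simp add: power2_eq_square field_simps)
    have "norm (F1 0 w) < d" using shift_bound(2)[of 0 w] \<eta>_0 nw t d by simp
    then have 2: "norm (\<eta> (F1 0 w)) \<le> e / 3 * t" using \<eta>_bound \<delta>(2)[of w] nw t by fastforce
    have 3: "norm (F2 0 w - \<zeta> * w) \<le> e / 3 * t" using \<delta>(2)[of w] nw t by simp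
    have "(\<mu> 0 - \<zeta>) * w = (F2 0 w - \<zeta> * w) - \<eta> (F1 0 w) - (\<psi> 0 w - \<mu> 0 * w)"
      by (simp add: \<psi>_def \<eta>_0 algebra_simps)
    then have "norm ((\<mu> 0 - \<zeta>) * w) \<le> norm (F2 0 w - \<zeta> * w) + norm (\<eta> (F1 0 w)) + norm (\<psi> 0 w - \<mu> 0 * w)"
      using norm_triangle_ineq4[of "F2 0 w - \<zeta> * w - \<eta> (F1 0 w)" "\<psi> 0 w - \<mu> 0 * w"]
        norm_triangle_ineq4[of "F2 0 w - \<zeta> * w" "\<eta> (F1 0 w)"] by simp
    also have "\<dots> \<le> e / 3 * t + e / 3 * t + e / 3 * t" using 1 2 3 \<open>B * t\<^sup>2 \<le> e / 3 * t\<close> by linarith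
    finally have "norm (\<mu> 0 - \<zeta>) * t \<le> e * t" by (simp add: norm_mult nw)
    then show "norm (\<mu> 0 - \<zeta>) \<le> 0 + e" using t by simp
  qed
  then show ?thesis by simp
qed

definition \<Phi> :: "complex \<times> complex \<Rightarrow> complex \<times> complex" where
  "\<Phi> p = (F1 (fst p) (snd p), F2 (fst p) (snd p))"

definition infinite_orbit_within :: "real \<Rightarrow> bool" where
  "infinite_orbit_within e \<longleftrightarrow> (\<exists>p. (\<forall>n. norm (fst ((\<Phi> ^^ n) p)) < e \<and> norm (snd ((\<Phi> ^^ n) p)) < e) \<and> infinite (range (\<lambda>n. (\<Phi> ^^ n) p)))"

text \<open>A point slightly above the graph over \<open>a0\<close> has heights that decrease
  geometrically, so the total drift of its first coordinate is controlled and the multiplier stays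
  close to \<open>\<mu> a0\<close>. Since \<open>\<mu> a0\<close> is not 0 the heights never vanish;
  being strictly decreasing, they make the orbit infinite.\<close>

lemma contracting_orbit:
  assumes a0: "norm a0 < e / 2" "norm a0 < d / 8" and \<mu>0: "\<mu> a0 \<noteq> 0" "norm (\<mu> a0) < 1"
  shows "infinite_orbit_within e"
proof -
  obtain B where B: "B > 0" "\<And>a w. norm a < d / 4 \<Longrightarrow> norm w < d / 8 \<Longrightarrow> norm (\<psi> a w - \<mu> a * w) \<le> B * (norm w)\<^sup>2"
    using \<psi>_second_order by blast
  define m where "m = norm (\<mu> a0)"
  have m: "0 < m" "m < 1" using \<mu>0 by (auto simp: m_def)
  \<comment> \<open>Variation of the multiplier and the quadratic term cost \<kappa> each. The first
    bound gives \<open>m + 2 * \<kappa> \<le> \<theta>\<close> with \<theta> midway between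
    \<open>m\<close> and 1, the second gives \<open>2 * \<kappa> < m\<close>, so the image height is
    not 0.\<close>
  define \<kappa> where "\<kappa> = min ((1 - m) / 4) (m / 4)"
  have \<kappa>: "\<kappa> > 0" "\<kappa> \<le> (1 - m) / 4" "\<kappa> \<le> m / 4" using m unfolding \<kappa>_def by (auto intro: min.cobounded1 min.cobounded2 simp del: divide_le_eq_numeral1 le_divide_eq_numeral1)
  define \<theta> where "\<theta> = (1 + m) / 2"
  have \<theta>: "0 < \<theta>" "\<theta> < 1" using m by (auto simp: \<theta>_def)
  have "isCont \<mu> a0"
    using holomorphic_on_imp_continuous_on[OF \<mu>_holomorphic] a0(2) d
    by (simp add: continuous_on_eq_continuous_at)
  then obtain s1 where s1: "s1 > 0" "\<And>a. dist a a0 < s1 \<Longrightarrow> dist (\<mu> a) (\<mu> a0) < \<kappa>"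
    using \<kappa>(1) unfolding continuous_at_eps_delta by metis
  have "e > 0" using a0(1) norm_ge_zero[of a0] by linarith
  have "0 < s1 / 2" "0 < \<kappa> / B" "0 < d / 16" "0 < e / 8" using s1 \<kappa> B d \<open>e > 0\<close> by simp_all
  from pos_lower_bound[OF this]
  obtain s where s: "s > 0" "s \<le> s1 / 2" "s \<le> \<kappa> / B" "s \<le> d / 16" "s \<le> e / 8" by blast
  have step: "norm (\<psi> a w) \<le> \<theta> * norm w" "w \<noteq> 0 \<Longrightarrow> \<psi> a w \<noteq> 0"
    if a: "norm (a - a0) \<le> s" and w: "norm w \<le> s" for a w
  proof -
    have "norm a \<le> norm a0 + norm (a - a0)" by (metis norm_triangle_sub)
    then have na: "norm a < d / 4" using a a0 s by linarith
    have nw: "norm w < d / 8" using w s d by linarith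
    have "dist (\<mu> a) (\<mu> a0) < \<kappa>" using s1(1) s(2) a by (intro s1(2)) (simp add: dist_norm)
    then have d1: "norm (\<mu> a - \<mu> a0) \<le> \<kappa>" by (simp add: dist_norm)
    have "norm w \<le> \<kappa> / B" using w s by linarith
    then have "B * norm w \<le> \<kappa>" using B(1) by (simp add: field_simps)
    then have "B * (norm w)\<^sup>2 \<le> \<kappa> * norm w"
      using mult_right_mono[of "B * norm w" \<kappa> "norm w"] by (simp add: power2_eq_square mult.assoc)
    then have d2: "norm (\<psi> a w - \<mu> a * w) \<le> \<kappa> * norm w" using B(2)[OF na nw] by linarith
    have "norm ((\<mu> a - \<mu> a0) * w) \<le> \<kappa> * norm w" using d1 by (simp add: norm_mult mult_right_mono)
    moreover have "norm (\<psi> a w - \<mu> a0 * w) \<le> norm (\<psi> a w - \<mu> a * w) + norm ((\<mu> a - \<mu> a0) * w)"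
      using norm_triangle_ineq[of "\<psi> a w - \<mu> a * w" "(\<mu> a - \<mu> a0) * w"] by (simp add: left_diff_distrib)
    ultimately have d3: "norm (\<psi> a w - \<mu> a0 * w) \<le> 2 * \<kappa> * norm w"
      using d2 by linarith
    have n0: "norm (\<mu> a0 * w) = m * norm w" by (simp add: norm_mult m_def)
    have "norm (\<psi> a w) \<le> m * norm w + 2 * \<kappa> * norm w"
      using d3 norm_triangle_sub[of "\<psi> a w" "\<mu> a0 * w"] n0 by simp
    also have "\<dots> = (m + 2 * \<kappa>) * norm w" by (simp add: algebra_simps)
    also have "\<dots> \<le> \<theta> * norm w" using \<kappa>(2) by (intro mult_right_mono) (auto simp: \<theta>_def field_simps)
    finally show "norm (\<psi> a w) \<le> \<theta> * norm w" .
    show "\<psi> a w \<noteq> 0" if "w \<noteq> 0"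
    proof
      assume "\<psi> a w = 0"
      then have "m * norm w \<le> 2 * \<kappa> * norm w" using d3 n0 by simp
      then have "m \<le> 2 * \<kappa>" using that by simp
      then show False using \<kappa>(3) m(1) by linarith
    qed
  qed
  \<comment> \<open>The drift of the first coordinate is at most the sum of
    \<open>t * \<theta> ^ n\<close> over all \<open>n\<close>, which equals \<open>s\<close> for
    this \<open>t\<close>.\<close>
  define t where "t = s * (1 - \<theta>)"
  have t: "t > 0" "t \<le> s" using s(1) \<theta> by (auto simp: t_def mult_le_cancel_left1)
  define p where "p = (a0, \<eta> a0 + complex_of_real t)"
  define W where "W q = snd q - \<eta> (fst q)" for q
  have inv: "norm (fst ((\<Phi> ^^ n) p) - a0) \<le> s * (1 - \<theta> ^ n) \<and> W ((\<Phi> ^^ n) p) \<noteq> 0 \<and> norm (W ((\<Phi> ^^ n) p)) \<le> t * \<theta> ^ n \<and>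
    norm (W ((\<Phi> ^^ Suc n) p)) \<le> \<theta> * norm (W ((\<Phi> ^^ n) p))" for n
  proof -
    have pw: "0 \<le> \<theta> ^ k" "\<theta> ^ k \<le> 1" for k using \<theta> by (auto simp: power_le_one)
    have key: "W (\<Phi> q) = \<psi> (fst q) (W q)" "norm (fst (\<Phi> q) - fst q) \<le> norm (W q)"
      if q: "norm (fst q - a0) \<le> s" "norm (W q) \<le> s" for q
    proof -
      have e: "\<eta> (fst q) + W q = snd q" by (simp add: W_def)
      show "W (\<Phi> q) = \<psi> (fst q) (W q)" unfolding \<psi>_def e by (simp add: W_def \<Phi>_def)
      have "norm (fst q) \<le> norm a0 + norm (fst q - a0)" by (metis norm_triangle_sub)
      then have "norm (fst q) < d / 4" "norm (W q) < d / 4" using q a0 s d by linarith+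
      then have "norm (F1 (fst q) (\<eta> (fst q) + W q) - fst q) \<le> 1 / 4 * norm (W q)" by (rule shift_bound(3))
      then show "norm (fst (\<Phi> q) - fst q) \<le> norm (W q)" unfolding e \<Phi>_def fst_conv
        using norm_ge_zero[of "W q"] by argo
    qed
    have le: "s * (1 - \<theta> ^ k) \<le> s" "t * \<theta> ^ k \<le> s" for k
    proof -
      show "s * (1 - \<theta> ^ k) \<le> s" using s(1) pw(1)[of k] by (simp add: mult_le_cancel_left1)
      have "t * \<theta> ^ k \<le> t * 1" using t(1) pw(2)[of k] by (intro mult_left_mono) auto
      then show "t * \<theta> ^ k \<le> s" using t(2) by linarith
    qed
    have main: "norm (fst ((\<Phi> ^^ n) p) - a0) \<le> s * (1 - \<theta> ^ n) \<and> W ((\<Phi> ^^ n) p) \<noteq> 0 \<and> norm (W ((\<Phi> ^^ n) p)) \<le> t * \<theta> ^ n" for n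
    proof (induction n)
      case 0 show ?case using t by (simp add: p_def W_def)
    next
      case (Suc n)
      define q where "q = (\<Phi> ^^ n) p"
      have q: "norm (fst q - a0) \<le> s * (1 - \<theta> ^ n)" "W q \<noteq> 0" "norm (W q) \<le> t * \<theta> ^ n"
        using Suc by (auto simp: q_def)
      have qs: "norm (fst q - a0) \<le> s" "norm (W q) \<le> s" using q le[of n] by linarith+
      have "norm (fst (\<Phi> q) - a0) \<le> norm (fst (\<Phi> q) - fst q) + norm (fst q - a0)"
        using norm_triangle_ineq[of "fst (\<Phi> q) - fst q" "fst q - a0"] by simp
      also have "\<dots> \<le> t * \<theta> ^ n + s * (1 - \<theta> ^ n)" using key(2)[OF qs] q by linarith
      also have "\<dots> = s * (1 - \<theta> ^ Suc n)" by (simp add: t_def algebra_simps)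
      finally have 1: "norm (fst (\<Phi> q) - a0) \<le> s * (1 - \<theta> ^ Suc n)" .
      have "norm (\<psi> (fst q) (W q)) \<le> \<theta> * (t * \<theta> ^ n)"
        using step(1)[OF qs] mult_left_mono[OF q(3), of \<theta>] \<theta> by linarith
      then show ?case using 1 key(1)[OF qs] step(2)[OF qs q(2)] by (simp add: q_def mult_ac)
    qed
    define q where "q = (\<Phi> ^^ n) p"
    have qs: "norm (fst q - a0) \<le> s" "norm (W q) \<le> s" using main[of n] le[of n] unfolding q_def by linarith+
    show ?thesis using main[of n] step(1)[OF qs] key(1)[OF qs] by (simp add: q_def)
  qed
  have "\<theta> ^ k \<ge> 0" for k using \<theta> by simp
  have bnd: "norm (fst ((\<Phi> ^^ n) p)) < e \<and> norm (snd ((\<Phi> ^^ n) p)) < e" for n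
  proof -
    define q where "q = (\<Phi> ^^ n) p"
    have "s * (1 - \<theta> ^ n) \<le> s" using s(1) \<theta> by (simp add: mult_le_cancel_left1)
    moreover have "t * \<theta> ^ n \<le> t * 1" using t(1) \<theta> by (intro mult_left_mono) (auto simp: power_le_one)
    ultimately have q: "norm (fst q - a0) \<le> s" "norm (W q) \<le> s"
      using inv[of n] t(2) unfolding q_def by linarith+
    have f: "norm (fst q) \<le> norm a0 + norm (fst q - a0)" by (metis norm_triangle_sub)
    then have "norm (fst q) < d" using q a0 s d by linarith
    then have "norm (\<eta> (fst q)) \<le> norm (fst q)" by (rule \<eta>_bound)
    moreover have "norm (snd q) \<le> norm (\<eta> (fst q)) + norm (W q)"
      unfolding W_def by (rule norm_triangle_sub)
    ultimately show ?thesis using f q a0 s \<open>e > 0\<close> unfolding q_def[symmetric] by linarith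
  qed
  have "inj (\<lambda>n. (\<Phi> ^^ n) p)"
  proof -
    have dec: "norm (W ((\<Phi> ^^ Suc n) p)) < norm (W ((\<Phi> ^^ n) p))" for n
    proof -
      have "\<theta> * norm (W ((\<Phi> ^^ n) p)) < 1 * norm (W ((\<Phi> ^^ n) p))"
        using inv[of n] \<theta> by (intro mult_strict_right_mono) auto
      then show ?thesis using inv[of n] by linarith
    qed
    have "norm (W ((\<Phi> ^^ j) p)) < norm (W ((\<Phi> ^^ i) p))" if "i < j" for i j
      using lift_Suc_mono_less[of "\<lambda>n. - norm (W ((\<Phi> ^^ n) p))" i j] dec that by simp
    then show ?thesis unfolding inj_on_def by (metis less_irrefl nat_neq_iff)
  qed
  then have "infinite (range (\<lambda>n. (\<Phi> ^^ n) p))" by (rule range_inj_infinite)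
  with bnd show ?thesis unfolding infinite_orbit_within_def by blast
qed

text \<open>A nonconstant \<mu> is an open map, so arbitrarily near 0 it takes a value
  \<open>(1 - u) * \<zeta>\<close> with \<open>0 < u \<le> 1 / 2\<close>: its modulus is below 1,
  which attracts orbits to the curve, and it is nonzero, which keeps them from reaching it.\<close>

lemma multiplier_dichotomy:
  "(\<forall>a. norm a < d / 4 \<longrightarrow> \<mu> a = \<zeta>) \<or>
   (\<forall>e>0. infinite_orbit_within e)"
proof (rule disjCI, intro allI impI)
  fix a :: complex assume neg: "\<not> (\<forall>e>0. infinite_orbit_within e)"
    and a: "norm a < d / 4"
  then obtain e where e: "e > 0" "\<not> infinite_orbit_within e"
    by blast
  have "0 < e / 2" "0 < d / 8" using e d by simp_all
  from pos_lower_bound[OF this e(1) e(1)]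
  obtain r where r: "r > 0" "r \<le> e / 2" "r \<le> d / 8" by blast
  have "\<mu> constant_on ball 0 (d / 4)"
  proof (rule ccontr)
    assume nc: "\<not> \<mu> constant_on ball 0 (d / 4)"
    have "open (\<mu> ` ball 0 r)"
      using r d by (intro open_mapping_thm[OF \<mu>_holomorphic open_ball connected_ball open_ball _ nc]) auto
    moreover have "\<zeta> \<in> \<mu> ` ball 0 r" using \<mu>_0 r by (metis centre_in_ball image_eqI)
    ultimately obtain \<delta> where \<delta>: "\<delta> > 0" "ball \<zeta> \<delta> \<subseteq> \<mu> ` ball 0 r" by (meson open_contains_ball)
    define u where "u = min (\<delta> / 2) (1 / 2)"
    have u: "0 < u" "u < \<delta>" "u \<le> 1 / 2" using \<delta> by (auto simp: u_def)
    have "dist \<zeta> (complex_of_real (1 - u) * \<zeta>) = norm (complex_of_real u * \<zeta>)"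
      by (simp add: dist_norm algebra_simps)
    also have "\<dots> = u" using u \<zeta>n by (simp add: norm_mult)
    finally have "complex_of_real (1 - u) * \<zeta> \<in> ball \<zeta> \<delta>" using u by simp
    then have "complex_of_real (1 - u) * \<zeta> \<in> \<mu> ` ball 0 r" by (rule subsetD[OF \<delta>(2)])
    then obtain a0 where a0: "a0 \<in> ball 0 r" "\<mu> a0 = complex_of_real (1 - u) * \<zeta>" by (elim imageE) simp
    have "norm (\<mu> a0) = norm (complex_of_real (1 - u))" unfolding a0(2) norm_mult \<zeta>n by simp
    also have "\<dots> = 1 - u" unfolding norm_of_real using u by simp
    finally have "norm (\<mu> a0) = 1 - u" .
    then have "norm (\<mu> a0) < 1" "\<mu> a0 \<noteq> 0" using u by auto
    moreover have "norm a0 < e / 2" "norm a0 < d / 8" using a0 r by auto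
    ultimately show False using contracting_orbit[of a0 e] e(2) by blast
  qed
  then obtain c where "\<And>a. a \<in> ball 0 (d / 4) \<Longrightarrow> \<mu> a = c" unfolding constant_on_def by blast
  then have "\<mu> a = \<mu> 0" using a d by simp
  then show "\<mu> a = \<zeta>" by (simp add: \<mu>_0)
qed

end

section \<open>Linear coordinates in the plane\<close>

text \<open>The determinant of the matrix with columns \<open>u\<close> and \<open>v\<close>;
  coordinates in a basis are then given by Cramer's rule.\<close>

definition cross2 :: "complex ^ 2 \<Rightarrow> complex ^ 2 \<Rightarrow> complex" where
  "cross2 u v = u $ 1 * v $ 2 - u $ 2 * v $ 1"

lemma cross2_coordinates:
  assumes "cross2 e1 e2 \<noteq> 0"
  shows "v = (cross2 v e2 / cross2 e1 e2) *s e1 + (cross2 e1 v / cross2 e1 e2) *s e2"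
proof -
  have "cross2 e1 e2 * v $ i = cross2 v e2 * e1 $ i + cross2 e1 v * e2 $ i" for i :: 2
    using exhaust_2[of i] by (auto simp: cross2_def algebra_simps)
  then have "v $ i = cross2 v e2 / cross2 e1 e2 * e1 $ i + cross2 e1 v / cross2 e1 e2 * e2 $ i" for i
    using assms by (simp add: field_simps)
  then show ?thesis by (simp add: vec_eq_iff)
qed

lemma cross2_combination:
  "cross2 (a *s e1 + b *s e2) e2 = a * cross2 e1 e2" "cross2 e1 (a *s e1 + b *s e2) = b * cross2 e1 e2"
  by (simp_all add: cross2_def algebra_simps)

lemma cross2_eigenvectors:
  assumes A: "clinear_op A" and e: "A e1 = e1" "e1 \<noteq> 0" "A e2 = \<zeta> *s e2" "e2 \<noteq> 0" "\<zeta> \<noteq> 1"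
  shows "cross2 e1 e2 \<noteq> 0"
proof
  assume c: "cross2 e1 e2 = 0"
  have "e1 $ j = 0" for j :: 2
  proof -
    have rel: "e2 $ j *s e1 - e1 $ j *s e2 = 0"
      using c exhaust_2[of j] by (auto simp: vec_eq_iff forall_2 cross2_def algebra_simps)
    have lin: "linear A" "\<And>c v. A (c *s v) = c *s A v" using A by (auto simp: clinear_op_def)
    have "A (e2 $ j *s e1 - e1 $ j *s e2) = e2 $ j *s e1 - e1 $ j *s (\<zeta> *s e2)"
      by (simp add: linear_diff[OF lin(1)] lin(2) e)
    then have "e2 $ j *s e1 - e1 $ j *s (\<zeta> *s e2) = 0" using rel linear_0[OF lin(1)] by simp
    then have "(1 - \<zeta>) *s (e1 $ j *s e2) = 0" using rel by (simp add: vec_eq_iff algebra_simps)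
    moreover have "1 - \<zeta> \<noteq> 0" using e by simp
    ultimately show "e1 $ j = 0" using e(4) by (auto simp: vec_eq_iff)
  qed
  then show False using e(2) by (simp add: vec_eq_iff)
qed

locale plane_coords =
  fixes x e1 e2 :: "complex ^ 2"
  assumes ind: "cross2 e1 e2 \<noteq> 0"
begin

definition \<alpha> :: "complex ^ 2 \<Rightarrow> complex" where "\<alpha> v = cross2 v e2 / cross2 e1 e2"
definition \<beta> :: "complex ^ 2 \<Rightarrow> complex" where "\<beta> v = cross2 e1 v / cross2 e1 e2"
definition P :: "complex \<Rightarrow> complex \<Rightarrow> complex ^ 2" where "P a b = x + (a *s e1 + b *s e2)"

lemma decompose: "v = \<alpha> v *s e1 + \<beta> v *s e2"
  unfolding \<alpha>_def \<beta>_def by (rule cross2_coordinates[OF ind])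

lemma \<alpha>_comb: "\<alpha> (a *s e1 + b *s e2) = a" and \<beta>_comb: "\<beta> (a *s e1 + b *s e2) = b"
  using ind by (simp_all add: \<alpha>_def \<beta>_def cross2_combination)

lemma P_coords: "P (\<alpha> (z - x)) (\<beta> (z - x)) = z"
  using decompose[of "z - x"] by (simp add: P_def)

lemma coords_P: "\<alpha> (P a b - x) = a" "\<beta> (P a b - x) = b"
  by (simp_all add: P_def \<alpha>_comb \<beta>_comb)

lemma P_eq_iff: "P a b = P a' b' \<longleftrightarrow> a = a' \<and> b = b'"
  using coords_P by metis

lemma P_diff: "P a b - P a' b' = (a - a') *s e1 + (b - b') *s e2"
  by (simp add: P_def vec_eq_iff algebra_simps)

lemma linear_\<alpha>: "linear \<alpha>" and linear_\<beta>: "linear \<beta>"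
proof -
  have "cross2 (u + v) w = cross2 u w + cross2 v w" "cross2 w (u + v) = cross2 w u + cross2 w v"
    "cross2 (r *\<^sub>R u) w = r *\<^sub>R cross2 u w" "cross2 w (r *\<^sub>R u) = r *\<^sub>R cross2 w u" for u v w :: "complex ^ 2" and r
    by (simp_all add: cross2_def scaleR_diff_right algebra_simps)
  then show "linear \<alpha>" "linear \<beta>"
    by (auto intro!: linearI simp: \<alpha>_def \<beta>_def divide_inverse distrib_right)
qed

lemma \<alpha>_smult: "\<alpha> (c *s v) = c * \<alpha> v" and \<beta>_smult: "\<beta> (c *s v) = c * \<beta> v"
  by (simp_all add: \<alpha>_def \<beta>_def cross2_def algebra_simps)

lemma coords_bound:
  "\<exists>C>0. (\<forall>v. norm (\<alpha> v) \<le> C * norm v) \<and> (\<forall>v. norm (\<beta> v) \<le> C * norm v) \<and>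
    (\<forall>a b. norm (a *s e1 + b *s e2) \<le> C * (norm a + norm b))"
proof -
  obtain A where A: "A > 0" "\<And>v. norm (\<alpha> v) \<le> A * norm v" using linear_bounded_pos[OF linear_\<alpha>] by metis
  obtain B where B: "B > 0" "\<And>v. norm (\<beta> v) \<le> B * norm v" using linear_bounded_pos[OF linear_\<beta>] by metis
  define C where "C = A + B + norm e1 + norm e2"
  have C: "A \<le> C" "B \<le> C" "norm e1 \<le> C" "norm e2 \<le> C" using A B by (auto simp: C_def add_increasing add_increasing2)
  show ?thesis
  proof (intro exI[of _ C] conjI allI)
    show "C > 0" using A C by linarith
    show "norm (\<alpha> v) \<le> C * norm v" for v using A(2)[of v] mult_right_mono[OF C(1), of "norm v"] by simp
    show "norm (\<beta> v) \<le> C * norm v" for v using B(2)[of v] mult_right_mono[OF C(2), of "norm v"] by simp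
    fix a b
    have "norm (a *s e1 + b *s e2) \<le> norm (a *s e1) + norm (b *s e2)" by (rule norm_triangle_ineq)
    also have "\<dots> \<le> norm a * C + norm b * C"
      unfolding norm_vector_smult using C by (intro add_mono mult_left_mono) auto
    finally show "norm (a *s e1 + b *s e2) \<le> C * (norm a + norm b)" by (simp add: algebra_simps)
  qed
qed

lemma P_near:
  assumes "r > 0"
  shows "\<exists>d>0. \<forall>a b. norm a < d \<longrightarrow> norm b < d \<longrightarrow> P a b \<in> ball x r"
proof -
  obtain C where C: "C > 0" "\<And>a b. norm (a *s e1 + b *s e2) \<le> C * (norm a + norm b)"
    using coords_bound by blast
  show ?thesis
  proof (intro exI[of _ "r / (2 * C)"] conjI allI impI)
    show "r / (2 * C) > 0" using assms C by simp
    fix a b :: complex assume "norm a < r / (2 * C)" "norm b < r / (2 * C)"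
    then have "norm a + norm b < r / C" by simp
    then have "C * (norm a + norm b) < r" using C(1) by (simp add: field_simps)
    then have "norm (a *s e1 + b *s e2) < r" using C(2)[of a b] by linarith
    moreover have "dist (P a b) x = norm (a *s e1 + b *s e2)" by (simp add: P_def dist_norm)
    ultimately show "P a b \<in> ball x r" by (simp add: dist_commute)
  qed
qed

lemma coords_near:
  assumes "r > 0"
  shows "\<exists>d>0. \<forall>z\<in>ball x d. norm (\<alpha> (z - x)) < r \<and> norm (\<beta> (z - x)) < r"
proof -
  obtain C where C: "C > 0" "\<And>v. norm (\<alpha> v) \<le> C * norm v" "\<And>v. norm (\<beta> v) \<le> C * norm v"
    using coords_bound by blast
  show ?thesis
  proof (intro exI[of _ "r / C"] conjI ballI)
    show "r / C > 0" using assms C by simp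
    fix z assume "z \<in> ball x (r / C)"
    then have "C * norm (z - x) < r" using C(1) by (simp add: dist_norm norm_minus_commute field_simps)
    then show "norm (\<alpha> (z - x)) < r" "norm (\<beta> (z - x)) < r"
      using C(2,3)[of "z - x"] by linarith+
  qed
qed

lemma mv_holomorphic_on_P:
  assumes g: "mv_holomorphic_on g W" and S: "open S" and u: "u holomorphic_on S" and v: "v holomorphic_on S"
    and W: "\<And>s. s \<in> S \<Longrightarrow> P (u s) (v s) \<in> W"
  shows "(\<lambda>s. g (P (u s) (v s))) holomorphic_on S"
proof (rule mv_holomorphic_on_curve[OF g S _ W])
  show "(\<lambda>s. P (u s) (v s) $ i) holomorphic_on S" for i
    unfolding P_def by simp (intro holomorphic_intros u v)
qed

lemma holomorphic_coords_P:
  assumes f: "holomorphic_map_on f W" and S: "open S" and u: "u holomorphic_on S" and v: "v holomorphic_on S"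
    and W: "\<And>s. s \<in> S \<Longrightarrow> P (u s) (v s) \<in> W"
  shows "(\<lambda>s. \<alpha> (f (P (u s) (v s)) - x)) holomorphic_on S" "(\<lambda>s. \<beta> (f (P (u s) (v s)) - x)) holomorphic_on S"
proof -
  have "(\<lambda>s. f (P (u s) (v s)) $ i) holomorphic_on S" for i
    using f mv_holomorphic_on_P[OF _ S u v W] unfolding holomorphic_map_on_def by blast
  then show "(\<lambda>s. \<alpha> (f (P (u s) (v s)) - x)) holomorphic_on S" "(\<lambda>s. \<beta> (f (P (u s) (v s)) - x)) holomorphic_on S"
    unfolding \<alpha>_def \<beta>_def cross2_def using ind by (auto intro!: holomorphic_intros simp: cross2_def)
qed

end

text \<open>If 1 were not an eigenvalue, \<open>A v - v\<close> would be bounded below, and strict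
  differentiability would leave \<open>x\<close> as the only fixed point nearby.\<close>

lemma nonisolated_fixed_point_eigenvalue:
  fixes f :: "complex ^ 2 \<Rightarrow> complex ^ 2"
  assumes f: "holomorphic_map_on f W" "x \<in> W" "f x = x" "cderiv f A x" and lim: "x islimpt {z. f z = z}"
  shows "eigenvalue A 1"
proof (rule ccontr)
  assume n: "\<not> eigenvalue A 1"
  have lA: "linear A" using f linear_cderiv by blast
  have lin: "linear (\<lambda>v. A v - v)" by (intro linear_compose_sub lA linear_ident)
  have "inj (\<lambda>v. A v - v)" using n unfolding linear_injective_0[OF lin] eigenvalue_def by auto
  then obtain B where B: "B > 0" "\<And>v. B * norm v \<le> norm (A v - v)"
    using linear_inj_bounded_below_pos[OF lin] by blast
  obtain d where d: "d > 0" "\<And>z w. z \<in> ball x d \<Longrightarrow> w \<in> ball x d \<Longrightarrow> norm (f z - f w - A (z - w)) \<le> B / 2 * norm (z - w)"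
    using holomorphic_map_strict[OF f(1,2,4), of "B / 2"] B(1) half_gt_zero[OF B(1)] by metis
  obtain z where z: "f z = z" "z \<noteq> x" "dist z x < d" using lim d(1) unfolding islimpt_approachable by auto
  have "norm (z - x - A (z - x)) \<le> B / 2 * norm (z - x)" using d(2)[of z x] z d(1) f(3) by (simp add: dist_commute)
  then have "B * norm (z - x) \<le> B / 2 * norm (z - x)" using B(2)[of "z - x"] by (simp add: norm_minus_commute)
  then show False using B(1) z(2) by simp
qed

text \<open>In an eigenbasis \<open>f\<close> becomes a \<open>neutral_saddle\<close>. A constant
  multiplier has to be translated back into an eigenvalue of the derivative at each nearby fixed
  point, all of which lie on the curve.\<close>

lemma fixed_curve_dichotomy:
  fixes f :: "complex ^ 2 \<Rightarrow> complex ^ 2"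
  assumes f: "holomorphic_map_on f W" "x \<in> W" "f x = x" "cderiv f A x"
    and e: "A e1 = e1" "e1 \<noteq> 0" "A e2 = \<zeta> *s e2" "e2 \<noteq> 0" and \<zeta>: "\<zeta> \<noteq> 1" "norm \<zeta> = 1"
    and lim: "x islimpt {z. f z = z}"
  shows "(\<exists>r>0. \<forall>z\<in>ball x r. \<forall>D. f z = z \<longrightarrow> cderiv f D z \<longrightarrow> eigenvalue D \<zeta>) \<or>
    (\<forall>r>0. \<exists>z. (\<forall>n. (f ^^ n) z \<in> ball x r) \<and> infinite (range (\<lambda>n. (f ^^ n) z)))"
proof -
  have clA: "clinear_op A" using f(4) by (rule cderiv_clinear)
  interpret plane_coords x e1 e2 using cross2_eigenvectors[OF clA e \<zeta>(1)] by unfold_locales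
  define F1 where "F1 a b = \<alpha> (f (P a b) - x)" for a b
  define F2 where "F2 a b = \<beta> (f (P a b) - x)" for a b
  have fP: "f (P a b) = P (F1 a b) (F2 a b)" for a b unfolding F1_def F2_def by (simp add: P_coords)
  obtain C where C: "C > 0" "\<And>v. norm (\<alpha> v) \<le> C * norm v" "\<And>v. norm (\<beta> v) \<le> C * norm v"
    "\<And>a b. norm (a *s e1 + b *s e2) \<le> C * (norm a + norm b)" using coords_bound by blast
  have strict: "\<exists>d>0. \<forall>a b a' b'. norm a < d \<longrightarrow> norm b < d \<longrightarrow> norm a' < d \<longrightarrow> norm b' < d \<longrightarrow>
      norm (F1 a b - F1 a' b' - (a - a')) \<le> \<epsilon> * (norm (a - a') + norm (b - b')) \<and>
      norm (F2 a b - F2 a' b' - \<zeta> * (b - b')) \<le> \<epsilon> * (norm (a - a') + norm (b - b'))" if \<epsilon>: "\<epsilon> > 0" for \<epsilon>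
  proof -
    \<comment> \<open>One factor \<open>C\<close> compares increments of points with increments of
      coordinates, the other takes coordinates of the error.\<close>
    have "\<epsilon> / (C * C) > 0" using \<epsilon> C by simp
    from holomorphic_map_strict[OF f(1,2,4) this] obtain r where r: "r > 0"
      "\<And>z w. z \<in> ball x r \<Longrightarrow> w \<in> ball x r \<Longrightarrow> norm (f z - f w - A (z - w)) \<le> \<epsilon> / (C * C) * norm (z - w)" by metis
    obtain d where d: "d > 0" "\<And>a b. norm a < d \<Longrightarrow> norm b < d \<Longrightarrow> P a b \<in> ball x r" using P_near[OF r(1)] by blast
    show ?thesis
    proof (intro exI[of _ d] conjI allI impI d(1))
      fix a b a' b' :: complex assume n: "norm a < d" "norm b < d" "norm a' < d" "norm b' < d"
      define E where "E = f (P a b) - f (P a' b') - A (P a b - P a' b')"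
      have "norm E \<le> \<epsilon> / (C * C) * norm (P a b - P a' b')" unfolding E_def using n by (intro r(2) d(2))
      also have "\<dots> \<le> \<epsilon> / (C * C) * (C * (norm (a - a') + norm (b - b')))"
        unfolding P_diff using \<epsilon> C by (intro mult_left_mono C(4)) simp
      also have "\<dots> = \<epsilon> * (norm (a - a') + norm (b - b')) / C" using C(1) by simp
      finally have E: "C * norm E \<le> \<epsilon> * (norm (a - a') + norm (b - b'))"
        using C(1) by (simp only: pos_le_divide_eq mult.commute[of C])
      have "A (P a b - P a' b') = A ((a - a') *s e1) + A ((b - b') *s e2)"
        unfolding P_diff using clA by (simp only: clinear_op_def linear_add)
      also have "\<dots> = (a - a') *s A e1 + (b - b') *s A e2" using clA by (simp only: clinear_op_def)
      finally have "A (P a b - P a' b') = (a - a') *s e1 + (\<zeta> * (b - b')) *s e2"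
        by (simp only: e vector_smult_assoc mult.commute)
      then have AP: "\<alpha> (A (P a b - P a' b')) = a - a'" "\<beta> (A (P a b - P a' b')) = \<zeta> * (b - b')"
        by (simp_all only: \<alpha>_comb \<beta>_comb)
      have "\<alpha> E = F1 a b - F1 a' b' - (a - a')"
        unfolding F1_def E_def by (simp add: linear_diff[OF linear_\<alpha>] AP)
      then show "norm (F1 a b - F1 a' b' - (a - a')) \<le> \<epsilon> * (norm (a - a') + norm (b - b'))"
        using C(2)[of E] E by simp
      have "\<beta> E = F2 a b - F2 a' b' - \<zeta> * (b - b')"
        unfolding F2_def E_def by (simp add: linear_diff[OF linear_\<beta>] AP)
      then show "norm (F2 a b - F2 a' b' - \<zeta> * (b - b')) \<le> \<epsilon> * (norm (a - a') + norm (b - b'))"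
        using C(3)[of E] E by simp
    qed
  qed
  have P00: "P 0 0 = x" by (simp add: P_def)
  have F0: "F1 0 0 = 0" "F2 0 0 = 0"
    using f(3) linear_0[OF linear_\<alpha>] linear_0[OF linear_\<beta>] by (simp_all add: F1_def F2_def P00)
  have \<zeta>0: "norm (\<zeta> - 1) > 0" using \<zeta> by simp
  have "0 < min (1 / 4) (norm (\<zeta> - 1) / 4)" using \<zeta>0 by simp
  from strict[OF this] obtain d1 where d1: "d1 > 0" "\<And>a b a' b'. norm a < d1 \<Longrightarrow> norm b < d1 \<Longrightarrow> norm a' < d1 \<Longrightarrow> norm b' < d1 \<Longrightarrow>
      norm (F1 a b - F1 a' b' - (a - a')) \<le> min (1 / 4) (norm (\<zeta> - 1) / 4) * (norm (a - a') + norm (b - b')) \<and>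
      norm (F2 a b - F2 a' b' - \<zeta> * (b - b')) \<le> min (1 / 4) (norm (\<zeta> - 1) / 4) * (norm (a - a') + norm (b - b'))"
    by blast
  obtain \<rho> where \<rho>: "\<rho> > 0" "ball x \<rho> \<subseteq> W" using f(1,2) unfolding holomorphic_map_on_iff by (meson openE)
  obtain d2 where d2: "d2 > 0" "\<And>a b. norm a < d2 \<Longrightarrow> norm b < d2 \<Longrightarrow> P a b \<in> ball x \<rho>" using P_near[OF \<rho>(1)] by blast
  define d where "d = min d1 d2"
  have d: "d > 0" "d \<le> d1" "d \<le> d2" using d1 d2 by (auto simp: d_def)
  have inW: "P a b \<in> W" if "norm a < d \<and> norm b < d" for a b using d2(2)[of a b] that d \<rho> by auto
  interpret S: neutral_saddle F1 F2 \<zeta> d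
  proof
    show "d > 0" "\<zeta> \<noteq> 1" "norm \<zeta> = 1" "F1 0 0 = 0" "F2 0 0 = 0" by (fact d \<zeta> F0)+
    show "(\<lambda>s. F1 (u s) (v s)) holomorphic_on S" "(\<lambda>s. F2 (u s) (v s)) holomorphic_on S"
      if "open S" "u holomorphic_on S" "v holomorphic_on S" "\<And>s. s \<in> S \<Longrightarrow> norm (u s) < d \<and> norm (v s) < d" for S u v
      unfolding F1_def F2_def using holomorphic_coords_P[OF f(1) that(1-3)] inW that(4) by blast+
    fix a b a' b' :: complex assume n: "norm a < d" "norm b < d" "norm a' < d" "norm b' < d"
    have s0: "norm (a - a') + norm (b - b') \<ge> 0" by simp
    have q: "norm (F1 a b - F1 a' b' - (a - a')) \<le> min (1 / 4) (norm (\<zeta> - 1) / 4) * (norm (a - a') + norm (b - b'))"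
      "norm (F2 a b - F2 a' b' - \<zeta> * (b - b')) \<le> min (1 / 4) (norm (\<zeta> - 1) / 4) * (norm (a - a') + norm (b - b'))"
      using d1(2)[of a b a' b'] n d by auto
    show "norm (F1 a b - F1 a' b' - (a - a')) \<le> 1 / 4 * (norm (a - a') + norm (b - b'))"
      by (rule order_trans[OF q(1) mult_right_mono[OF min.cobounded1 s0]])
    show "norm (F2 a b - F2 a' b' - \<zeta> * (b - b')) \<le> norm (\<zeta> - 1) / 4 * (norm (a - a') + norm (b - b'))"
      by (rule order_trans[OF q(2) mult_right_mono[OF min.cobounded2 s0]])
  next
    fix \<epsilon> :: real assume \<epsilon>: "\<epsilon> > 0"
    from strict[OF \<epsilon>] obtain r where r: "r > 0" "\<And>a b a' b'. norm a < r \<Longrightarrow> norm b < r \<Longrightarrow> norm a' < r \<Longrightarrow> norm b' < r \<Longrightarrow>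
      norm (F1 a b - F1 a' b' - (a - a')) \<le> \<epsilon> * (norm (a - a') + norm (b - b')) \<and>
      norm (F2 a b - F2 a' b' - \<zeta> * (b - b')) \<le> \<epsilon> * (norm (a - a') + norm (b - b'))" by blast
    show "\<exists>\<delta>>0. \<forall>w. norm w < \<delta> \<longrightarrow> norm (F1 0 w) \<le> \<epsilon> * norm w \<and> norm (F2 0 w - \<zeta> * w) \<le> \<epsilon> * norm w"
    proof (intro exI[of _ r] conjI allI impI r(1))
      fix w :: complex assume "norm w < r"
      then show "norm (F1 0 w) \<le> \<epsilon> * norm w" "norm (F2 0 w - \<zeta> * w) \<le> \<epsilon> * norm w"
        using r(2)[of 0 w 0 0] r(1) F0 by simp_all
    qed
    obtain r' where r': "r' > 0" "\<And>z. z \<in> ball x r' \<Longrightarrow> norm (\<alpha> (z - x)) < \<epsilon> \<and> norm (\<beta> (z - x)) < \<epsilon>"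
      using coords_near[OF \<epsilon>] by blast
    obtain z where z: "f z = z" "z \<noteq> x" "dist z x < r'" using lim r'(1) unfolding islimpt_approachable by auto
    have zP: "P (\<alpha> (z - x)) (\<beta> (z - x)) = z" by (rule P_coords)
    have "\<alpha> (z - x) \<noteq> 0 \<or> \<beta> (z - x) \<noteq> 0" using zP z(2) P00 by metis
    moreover have "norm (\<alpha> (z - x)) < \<epsilon> \<and> norm (\<beta> (z - x)) < \<epsilon>" using r'(2) z(3) by (simp add: dist_commute)
    moreover have "F1 (\<alpha> (z - x)) (\<beta> (z - x)) = \<alpha> (z - x)" "F2 (\<alpha> (z - x)) (\<beta> (z - x)) = \<beta> (z - x)"
      by (simp_all add: F1_def F2_def zP z(1))
    ultimately show "\<exists>a b. norm a < \<epsilon> \<and> norm b < \<epsilon> \<and> (a \<noteq> 0 \<or> b \<noteq> 0) \<and> F1 a b = a \<and> F2 a b = b" by blast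
  qed
  from S.multiplier_dichotomy show ?thesis
  proof
    assume \<mu>: "\<forall>a. norm a < d / 4 \<longrightarrow> S.\<mu> a = \<zeta>"
    obtain r where r: "r > 0" "\<And>z. z \<in> ball x r \<Longrightarrow> norm (\<alpha> (z - x)) < d / 4 \<and> norm (\<beta> (z - x)) < d / 4"
      using coords_near[of "d / 4"] d by auto
    have "eigenvalue D \<zeta>" if z: "z \<in> ball x r" "f z = z" and D: "cderiv f D z" for z D
    proof -
      define a b where "a = \<alpha> (z - x)" and "b = \<beta> (z - x)"
      have zP: "P a b = z" unfolding a_def b_def by (rule P_coords)
      have ab: "norm a < d / 4" "norm b < d / 4" using r(2)[OF z(1)] by (auto simp: a_def b_def)
      then have abd: "norm a < d" "norm b < d" using d(1) by linarith+
      have fx: "F1 a b = a" "F2 a b = b" using fP[of a b] zP z(2) P_eq_iff by metis+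
      have b: "b = S.\<eta> a" using S.\<eta>_unique abd fx by blast
      define h where "h = deriv S.\<eta> a"
      have eta: "(S.\<eta> has_field_derivative h) (at a)"
        unfolding h_def using holomorphic_derivI[OF S.\<eta>_holomorphic open_ball] abd by simp
      \<comment> \<open>The tangent vector of the fixed curve at \<open>z\<close>; differentiating
        \<open>f = id\<close> along the curve gives \<open>D t = t\<close>.\<close>
      define t where "t = e1 + h *s e2"
      have clD: "linear D" "\<And>c v. D (c *s v) = c *s D v" using cderiv_clinear[OF D] by (auto simp: clinear_op_def)
      have Dz: "(f has_derivative D) (at z)" using D by (simp add: cderiv_def)
      have Dt: "D t = t"
      proof -
        have g: "((\<lambda>s. P s (S.\<eta> s)) has_derivative (\<lambda>s. s *s t)) (at a)"
        proof (rule has_derivative_vec_components)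
          fix i
          have "((\<lambda>s. x $ i + (s * e1 $ i + S.\<eta> s * e2 $ i)) has_field_derivative (e1 $ i + h * e2 $ i)) (at a)"
            by (auto intro!: derivative_eq_intros eta)
          then show "((\<lambda>s. P s (S.\<eta> s) $ i) has_derivative (\<lambda>s. (s *s t) $ i)) (at a)"
            unfolding has_field_derivative_def
          proof -
            assume "((\<lambda>s. x $ i + (s * e1 $ i + S.\<eta> s * e2 $ i)) has_derivative (*) (e1 $ i + h * e2 $ i)) (at a)"
            moreover have "(\<lambda>s. (s *s t) $ i) = (*) (e1 $ i + h * e2 $ i)"
              by (auto simp: t_def algebra_simps fun_eq_iff)
            ultimately show ?thesis by (simp add: P_def)
          qed
        qed
        have "(f has_derivative D) (at (P a (S.\<eta> a)))" using Dz zP b by simp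
        from has_derivative_compose[OF g this]
        have c: "((\<lambda>s. f (P s (S.\<eta> s))) has_derivative (\<lambda>s. D (s *s t))) (at a)" .
        have ev: "eventually (\<lambda>s. f (P s (S.\<eta> s)) = P s (S.\<eta> s)) (nhds a)"
          using eventually_nhds_in_open[OF open_ball, of a 0 d] abd
          by (auto elim!: eventually_mono simp: fP S.graph_fixed S.\<eta>_fixed)
        have "((\<lambda>s. P s (S.\<eta> s)) has_derivative (\<lambda>s. D (s *s t))) (at a)"
          using has_derivative_transform_eventually[OF c, of "\<lambda>s. P s (S.\<eta> s)"] ev eventually_nhds_x_imp_x[OF ev]
          by (simp add: eventually_at_filter eventually_mono)
        from has_derivative_unique[OF g this] have "(\<lambda>s. s *s t) = (\<lambda>s. D (s *s t))" .
        then have "1 *s t = D (1 *s t)" by (rule fun_cong)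
        then show ?thesis by simp
      qed
      define p1 p2 where "p1 = \<alpha> (D e2)" and "p2 = \<beta> (D e2)"
      have De2: "D e2 = p1 *s e1 + p2 *s e2" unfolding p1_def p2_def by (rule decompose)
      have dF: "((\<lambda>w. F1 a (b + w)) has_field_derivative p1) (at 0)" "((\<lambda>w. F2 a (b + w)) has_field_derivative p2) (at 0)"
      proof -
        have g: "((\<lambda>w. P a (b + w)) has_derivative (\<lambda>w. w *s e2)) (at 0)"
        proof (rule has_derivative_vec_components)
          fix i
          have "((\<lambda>w. x $ i + (a * e1 $ i + (b + w) * e2 $ i)) has_field_derivative e2 $ i) (at 0)"
            by (auto intro!: derivative_eq_intros)
          then show "((\<lambda>w. P a (b + w) $ i) has_derivative (\<lambda>w. (w *s e2) $ i)) (at 0)"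
            by (simp add: P_def has_field_derivative_def algebra_simps mult_commute_abs)
        qed
        have "(f has_derivative D) (at (P a (b + 0)))" using Dz zP by simp
        from has_derivative_diff[OF has_derivative_compose[OF g this] has_derivative_const[of x]]
        have c: "((\<lambda>w. f (P a (b + w)) - x) has_derivative (\<lambda>w. w *s D e2)) (at 0)" by (simp add: clD(2))
        from bounded_linear.has_derivative[OF linear_conv_bounded_linear[THEN iffD1, OF linear_\<alpha>] c]
        show "((\<lambda>w. F1 a (b + w)) has_field_derivative p1) (at 0)"
          by (simp add: F1_def has_field_derivative_def \<alpha>_smult p1_def mult.commute[of _ "\<alpha> (D e2)"])
        from bounded_linear.has_derivative[OF linear_conv_bounded_linear[THEN iffD1, OF linear_\<beta>] c]
        show "((\<lambda>w. F2 a (b + w)) has_field_derivative p2) (at 0)"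
          by (simp add: F2_def has_field_derivative_def \<beta>_smult p2_def mult.commute[of _ "\<beta> (D e2)"])
      qed
      have "((\<lambda>w. S.\<eta> (F1 a (b + w))) has_field_derivative h * p1) (at 0)"
      proof (rule DERIV_chain2[OF _ dF(1)])
        show "(S.\<eta> has_field_derivative h) (at (F1 a (b + 0)))" using eta fx by simp
      qed
      from DERIV_diff[OF dF(2) this] have "(S.\<psi> a has_field_derivative (p2 - h * p1)) (at 0)"
        unfolding S.\<psi>_def[abs_def] b .
      then have "S.\<mu> a = p2 - h * p1" unfolding S.\<mu>_def by (rule DERIV_imp_deriv)
      then have p2: "p2 = \<zeta> + h * p1" using \<mu> ab by simp
      \<comment> \<open>In the basis \<open>t\<close>, \<open>e2\<close> the derivative is
        triangular: \<open>D e2 = p1 *s t + \<zeta> *s e2\<close>. This \<open>s\<close> solves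
        \<open>p1 + s = \<zeta> * s\<close>, which makes \<open>e2 + s *s t\<close> an eigenvector
        for \<zeta>.\<close>
      define s where "s = p1 / (\<zeta> - 1)"
      have s: "p1 + s = \<zeta> * s" using \<zeta> unfolding s_def by (simp add: divide_simps) (simp add: algebra_simps)
      define v where "v = e2 + s *s t"
      have De2': "D e2 = p1 *s t + \<zeta> *s e2" unfolding De2 p2 t_def by (simp add: vec_eq_iff algebra_simps)
      have "D v = D e2 + s *s t" unfolding v_def using linear_add[OF clD(1)] clD(2) Dt by simp
      also have "\<dots> = (p1 + s) *s t + \<zeta> *s e2" unfolding De2' by (simp add: vec_eq_iff algebra_simps)
      also have "\<dots> = \<zeta> *s v" unfolding s v_def by (simp add: vec_eq_iff algebra_simps)
      finally have "D v = \<zeta> *s v" .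
      moreover have "v \<noteq> 0"
      proof
        assume v0: "v = 0"
        have "v = s *s e1 + (1 + s * h) *s e2" by (simp add: v_def t_def vec_eq_iff algebra_simps)
        then have "\<alpha> v = s" by (simp only: \<alpha>_comb)
        then have "s = 0" using v0 linear_0[OF linear_\<alpha>] by simp
        then show False using v0 e(4) by (simp add: v_def)
      qed
      ultimately show ?thesis unfolding eigenvalue_def by blast
    qed
    then show ?thesis using r(1) by blast
  next
    assume inf: "\<forall>e>0. S.infinite_orbit_within e"
    have "\<exists>z. (\<forall>n. (f ^^ n) z \<in> ball x r) \<and> infinite (range (\<lambda>n. (f ^^ n) z))" if r: "r > 0" for r
    proof -
      obtain d' where d': "d' > 0" "\<And>a b. norm a < d' \<Longrightarrow> norm b < d' \<Longrightarrow> P a b \<in> ball x r" using P_near[OF r] by blast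
      from inf d'(1) have "S.infinite_orbit_within d'" by blast
      then obtain p where p: "\<And>n. norm (fst ((S.\<Phi> ^^ n) p)) < d' \<and> norm (snd ((S.\<Phi> ^^ n) p)) < d'"
        "infinite (range (\<lambda>n. (S.\<Phi> ^^ n) p))"
        unfolding S.infinite_orbit_within_def by blast
      define Q where "Q = (\<lambda>p. P (fst p) (snd p))"
      have it: "(f ^^ n) (Q p) = Q ((S.\<Phi> ^^ n) p)" for n
        by (induction n) (simp_all add: Q_def fP S.\<Phi>_def)
      have "inj Q" unfolding inj_on_def Q_def by (auto simp: P_eq_iff prod_eq_iff)
      have "range (\<lambda>n. (f ^^ n) (Q p)) = Q ` range (\<lambda>n. (S.\<Phi> ^^ n) p)" unfolding it by auto
      then have "infinite (range (\<lambda>n. (f ^^ n) (Q p)))"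
        using p(2) finite_imageD[of Q] \<open>inj Q\<close> by (metis inj_on_subset subset_UNIV)
      moreover have "(f ^^ n) (Q p) \<in> ball x r" for n
      proof -
        have "Q ((S.\<Phi> ^^ n) p) \<in> ball x r" unfolding Q_def using p(1)[of n] by (intro d'(2)) simp_all
        then show ?thesis by (simp only: it)
      qed
      ultimately show ?thesis by (intro exI[of _ "Q p"] conjI allI)
    qed
    then show ?thesis by blast
  qed
qed

section \<open>Closedness of the sets \<open>E m\<close> and a nonisolated fixed point at the
  origin\<close>

context finite_orbit_rep
begin

lemma E_closed:
  assumes m: "m \<ge> 1"
  shows "closed (E m)"
  unfolding closed_limpt
proof (intro allI impI)
  fix x assume lim: "x islimpt E m"
  have EK: "E m \<subseteq> K" by (auto simp: E_def)
  have xK: "x \<in> K" using islimpt_subset[OF lim EK] K_closed by (simp add: closed_limpt)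
  have w: "y \<in> staying m" if "y \<in> K" for y using that K_staying by blast
  have cG: "continuous_on (staying m) (G ^^ m)"
    using cderiv_dG cderiv_continuous by (meson continuous_at_imp_continuous_on)
  have fixx: "(G ^^ m) x = x"
  proof -
    have "continuous_on K (\<lambda>z. (G ^^ m) z - z)"
      using continuous_on_subset[OF cG K_staying] by (intro continuous_intros)
    from continuous_closed_preimage_constant[OF this K_closed, of 0]
    have "closed {z \<in> K. (G ^^ m) z = z}" by simp
    moreover have "E m \<subseteq> {z \<in> K. (G ^^ m) z = z}" by (auto simp: E_def)
    ultimately show ?thesis using islimpt_subset[OF lim] unfolding closed_limpt by blast
  qed
  have lim': "x islimpt {z. (G ^^ m) z = z}" by (rule islimpt_subset[OF lim]) (auto simp: E_def)
  show "x \<in> E m"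
  proof (rule ccontr)
    assume "x \<notin> E m"
    then have "\<not> torsion_free_spectrum (dG m x)" using xK fixx by (simp add: E_def)
    then obtain \<zeta> k where k: "k \<ge> 1" "\<zeta> ^ k = 1" "eigenvalue (dG m x) \<zeta>" "\<zeta> \<noteq> 1"
      unfolding torsion_free_spectrum_def by blast
    have "norm \<zeta> ^ k = 1" using k(2) by (metis norm_power norm_one)
    then have n\<zeta>: "norm \<zeta> = 1" using k(1) power_eq_imp_eq_base[of "norm \<zeta>" k 1] by simp
    have D: "cderiv (G ^^ m) (dG m x) x" by (rule cderiv_dG[OF w[OF xK]])
    obtain e1 where e1: "e1 \<noteq> 0" "dG m x e1 = e1"
      using nonisolated_fixed_point_eigenvalue[OF hol_funpow w[OF xK] fixx D lim'] by (auto simp: eigenvalue_def)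
    obtain e2 where e2: "e2 \<noteq> 0" "dG m x e2 = \<zeta> *s e2" using k(3) by (auto simp: eigenvalue_def)
    from fixed_curve_dichotomy[OF hol_funpow w[OF xK] fixx D e1(2,1) e2(2,1) k(4) n\<zeta> lim']
    show False
    proof
      assume "\<exists>r>0. \<forall>z\<in>ball x r. \<forall>D. (G ^^ m) z = z \<longrightarrow> cderiv (G ^^ m) D z \<longrightarrow> eigenvalue D \<zeta>"
      then obtain r where r: "r > 0" "\<And>z D. z \<in> ball x r \<Longrightarrow> (G ^^ m) z = z \<Longrightarrow> cderiv (G ^^ m) D z \<Longrightarrow> eigenvalue D \<zeta>"
        by blast
      obtain y where y: "y \<in> E m" "dist y x < r" using lim r(1) unfolding islimpt_approachable by blast
      then have "y \<in> K" "(G ^^ m) y = y" "y \<in> ball x r" by (auto simp: E_def dist_commute)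
      then have "eigenvalue (dG m y) \<zeta>" using r(2)[OF _ _ cderiv_dG[OF w]] by blast
      then show False using y(1) k unfolding E_def torsion_free_spectrum_def by blast
    next
      assume inf: "\<forall>r>0. \<exists>z. (\<forall>n. ((G ^^ m) ^^ n) z \<in> ball x r) \<and> infinite (range (\<lambda>n. ((G ^^ m) ^^ n) z))"
      obtain r where r: "r > 0" "ball x r \<subseteq> staying m" using open_staying w[OF xK] by (meson openE)
      obtain z where z: "\<And>n. ((G ^^ m) ^^ n) z \<in> ball x r" "infinite (range (\<lambda>n. ((G ^^ m) ^^ n) z))"
        using inf r(1) by blast
      \<comment> \<open>The hypothesis concerns orbits of \<open>G\<close>, not of
        \<open>G ^^ m\<close>. At multiples of \<open>m\<close> the orbit lies in
        \<open>staying m\<close>, which controls the steps up to the next multiple.\<close>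
      have "(G ^^ n) z \<in> A" for n
      proof -
        have "n = n mod m + m * (n div m)" by simp
        then have "(G ^^ n) z = (G ^^ (n mod m)) (((G ^^ m) ^^ (n div m)) z)"
          by (metis comp_apply funpow_add funpow_mult)
        moreover have "((G ^^ m) ^^ (n div m)) z \<in> staying m" using z(1) r(2) by blast
        moreover have "n mod m \<le> m" using m by (simp add: less_imp_le)
        ultimately have "(G ^^ n) z \<in> ball 0 R0" unfolding staying_def by simp
        then show ?thesis using R(3) ball_subset_cball[of 0 R0] by blast
      qed
      then have "finite (range (\<lambda>n. (G ^^ n) z))" by (rule forward_orbit_finite)
      moreover have "range (\<lambda>n. ((G ^^ m) ^^ n) z) \<subseteq> range (\<lambda>n. (G ^^ n) z)"
        by (auto simp: funpow_mult)
      ultimately show False using z(2) finite_subset by blast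
    qed
  qed
qed

text \<open>The closed sets \<open>E (j!)\<close> increase to \<open>K\<close> and each is relatively open in the next, so their
  successive differences are disjoint closed sets to which Sierpinski's theorem applies.\<close>

lemma zero_limit_of_fixed_points: "\<exists>M\<ge>1. 0 islimpt {z. (G ^^ M) z = z}"
proof -
  obtain C where C: "compact C" "connected C" "0 \<in> C" "C \<subseteq> K" "C \<inter> sphere 0 R \<noteq> {}"
    by (rule continuum_of_bounded_orbits)
  define L where "L j = E (fact j)" for j :: nat
  define Q where "Q j = (case j of 0 \<Rightarrow> L 0 | Suc i \<Rightarrow> L (Suc i) - L i)" for j
  have f1: "(fact j :: nat) \<ge> 1" for j by (simp add: Suc_le_eq)
  have clL: "closed (L j)" for j unfolding L_def by (rule E_closed[OF f1])
  have fs: "(fact (Suc j) :: nat) = fact j * Suc j" for j by (simp add: mult.commute)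
  have inc: "L j \<subseteq> L (Suc j)" for j unfolding L_def fs by (rule E_subset_mult) simp
  have mono: "L i \<subseteq> L j" if "i \<le> j" for i j using lift_Suc_mono_le[of L, OF inc that] .
  have clQ: "closed (Q j)" for j
  proof (cases j)
    case 0 then show ?thesis by (simp add: Q_def clL)
  next
    case (Suc i)
    have "closed (L (Suc i) - L i)"
      unfolding closed_limpt
    proof (intro allI impI)
      fix x assume lim: "x islimpt (L (Suc i) - L i)"
      have "x islimpt L (Suc i)" by (rule islimpt_subset[OF lim]) simp
      then have xL: "x \<in> L (Suc i)" using clL by (simp add: closed_limpt)
      have "x \<notin> L i"
      proof
        assume x: "x \<in> L i"
        have "Suc i \<ge> 1" by simp
        from E_relatively_open[OF x[unfolded L_def] this]
        obtain d where d: "d > 0" "\<And>z. z \<in> ball x d \<Longrightarrow> z \<in> L (Suc i) \<Longrightarrow> z \<in> L i"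
          unfolding L_def fs by blast
        obtain z where "z \<in> L (Suc i) - L i" "dist z x < d" using lim d(1) unfolding islimpt_approachable by blast
        then show False using d(2)[of z] by (simp add: dist_commute)
      qed
      then show "x \<in> L (Suc i) - L i" using xL by simp
    qed
    then show ?thesis using Suc by (simp add: Q_def)
  qed
  have disj: "disjoint_family Q"
  proof -
    have "Q i \<inter> Q j = {}" if ij: "i < j" for i j
    proof -
      obtain l where l: "j = Suc l" using ij by (cases j) auto
      have "Q i \<subseteq> L i" by (cases i) (auto simp: Q_def)
      also have "L i \<subseteq> L l" using ij l by (intro mono) simp
      finally show ?thesis using l by (auto simp: Q_def)
    qed
    then show ?thesis unfolding disjoint_family_on_def by (metis Int_commute linorder_neqE_nat)
  qed
  have LQ: "L j \<subseteq> (\<Union>i. Q i)" for j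
  proof (induction j)
    case 0 then show ?case by (auto simp: Q_def intro!: exI[of _ 0])
  next
    case (Suc j)
    have "L (Suc j) \<subseteq> L j \<union> Q (Suc j)" by (auto simp: Q_def)
    then show ?case using Suc by blast
  qed
  have "C \<subseteq> (\<Union>i. Q i)"
  proof
    fix x assume "x \<in> C"
    then have "x \<in> K" using C(4) by blast
    then obtain m where m: "m \<ge> 1" "x \<in> E m" by (rule E_cover)
    \<comment> \<open>The factorials are cofinal for divisibility, so the sets \<open>L j\<close>
      still exhaust \<open>K\<close>.\<close>
    have "m dvd fact m" using m(1) by (intro dvd_fact) auto
    then obtain q :: nat where q: "fact m = m * q" by (elim dvdE)
    have "q \<ge> 1" using q f1[of m] by (cases q) auto
    then have "x \<in> L m" unfolding L_def q using E_subset_mult m(2) by blast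
    then show "x \<in> (\<Union>i. Q i)" using LQ by blast
  qed
  from Sierpinski_continuum[OF C(1,2) this clQ disj] obtain n where n: "C \<subseteq> Q n" by blast
  have "Q n \<subseteq> L n" by (cases n) (auto simp: Q_def)
  then have CF: "C \<subseteq> {z. (G ^^ fact n) z = z}" using n by (auto simp: L_def E_def)
  obtain p where "p \<in> C \<inter> sphere 0 R" using C(5) by blast
  then have p: "p \<in> C" "norm p = R" by auto
  have "p \<noteq> 0" using p R by auto
  \<comment> \<open>A connected set with the two points 0 and \<open>p\<close> has no isolated
    points.\<close>
  then have "0 islimpt C"
    using connected_imp_perfect[OF C(2)] C(3) p(1) by (metis singletonD)
  then have "0 islimpt {z. (G ^^ fact n) z = z}" using CF by (rule islimpt_subset)
  then show ?thesis using f1[of n] by blast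
qed

end

section \<open>Holomorphic dependence on parameters\<close>

lemma deriv_difference_bound:
  assumes "u holomorphic_on ball z r" "v holomorphic_on ball z r" "continuous_on (cball z r) u" "continuous_on (cball z r) v"
    and "r > 0" and B: "\<And>w. w \<in> cball z r \<Longrightarrow> norm (u w - v w) \<le> B"
  shows "norm (deriv u z - deriv v z) \<le> B / r"
proof -
  have "norm ((deriv ^^ 1) (\<lambda>w. u w - v w) z) \<le> fact 1 * B / r ^ 1"
  proof (rule Cauchy_inequality)
    show "(\<lambda>w. u w - v w) holomorphic_on ball z r" by (intro holomorphic_on_diff assms)
    show "continuous_on (cball z r) (\<lambda>w. u w - v w)" by (intro continuous_on_diff assms)
    show "norm (u x - v x) \<le> B" if "norm (z - x) = r" for x using that by (intro B) (simp add: dist_norm)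
  qed fact
  moreover have "deriv (\<lambda>w. u w - v w) z = deriv u z - deriv v z"
    using assms by (intro deriv_diff) (auto intro: holomorphic_on_imp_differentiable_at[OF _ open_ball])
  ultimately show ?thesis by simp
qed

text \<open>By compactness of a disc, \<open>\<Psi> x t\<close> is uniformly close to
  \<open>\<Psi> x t0\<close> there, and Cauchy's estimate transfers this to the derivatives. The
  result feeds Leibniz's rule for contour integrals.\<close>

lemma continuous_on_deriv_parameter:
  fixes \<Psi> :: "complex \<Rightarrow> 't::metric_space \<Rightarrow> complex"
  assumes D: "open D" and cont: "continuous_on (D \<times> T) (\<lambda>(x, t). \<Psi> x t)"
    and hol: "\<And>t. t \<in> T \<Longrightarrow> (\<lambda>x. \<Psi> x t) holomorphic_on D"
  shows "continuous_on (D \<times> T) (\<lambda>(x, t). deriv (\<lambda>x. \<Psi> x t) x)"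
  unfolding continuous_on_iff
proof (intro ballI allI impI)
  fix p0 and e :: real assume p0: "p0 \<in> D \<times> T" and e: "e > 0"
  obtain x0 t0 where xt0: "p0 = (x0, t0)" by (cases p0)
  have 1: "x0 \<in> D" "t0 \<in> T" "e > 0" using p0 e xt0 by auto
  obtain r where r: "r > 0" "cball x0 (2 * r) \<subseteq> D"
  proof -
    obtain r' where "r' > 0" "cball x0 r' \<subseteq> D" using D 1 by (meson open_contains_cball)
    then show ?thesis using that[of "r' / 2"] by simp
  qed
  have cont': "continuous_on (T \<times> cball x0 (2 * r)) (\<lambda>p. \<Psi> (snd p) (fst p))"
  proof -
    have a: "continuous_on (T \<times> cball x0 (2 * r)) (\<lambda>p. (snd p, fst p))" by (intro continuous_intros)
    have b: "(\<lambda>p. (snd p, fst p)) ` (T \<times> cball x0 (2 * r)) \<subseteq> D \<times> T" using r by auto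
    from continuous_on_compose2[OF cont a b] show ?thesis by simp
  qed
  have "e * r / 3 > 0" using 1 r by simp
  from continuous_on_prod_compactE[OF cont' compact_cball 1(2) this]
  obtain X where X: "t0 \<in> X" "open X" and X': "\<forall>t\<in>X \<inter> T. \<forall>x\<in>cball x0 (2 * r).
      dist (\<Psi> (snd (t, x)) (fst (t, x))) (\<Psi> (snd (t0, x)) (fst (t0, x))) \<le> e * r / 3" .
  have X3: "norm (\<Psi> x t - \<Psi> x t0) \<le> e * r / 3" if "t \<in> X \<inter> T" "x \<in> cball x0 (2 * r)" for t x
    using X'[rule_format, OF that] by (simp add: dist_norm)
  obtain d1 where d1: "d1 > 0" "\<And>t. dist t t0 < d1 \<Longrightarrow> t \<in> X" using X(1,2) by (metis open_dist)
  have "(\<lambda>x. deriv (\<lambda>x. \<Psi> x t0) x) holomorphic_on D" using hol[OF 1(2)] D by (rule holomorphic_deriv)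
  then have "isCont (deriv (\<lambda>x. \<Psi> x t0)) x0"
    using holomorphic_on_imp_continuous_on continuous_on_eq_continuous_at[OF D] 1(1) by blast
  then obtain d2 where d2: "d2 > 0" "\<And>x. dist x x0 < d2 \<Longrightarrow> dist (deriv (\<lambda>x. \<Psi> x t0) x) (deriv (\<lambda>x. \<Psi> x t0) x0) < e / 3"
    using 1(3) unfolding continuous_at_eps_delta by (metis divide_pos_pos zero_less_numeral)
  show "\<exists>d>0. \<forall>p\<in>D \<times> T. dist p p0 < d \<longrightarrow>
      dist (case p of (x, t) \<Rightarrow> deriv (\<lambda>x. \<Psi> x t) x) (case p0 of (x, t) \<Rightarrow> deriv (\<lambda>x. \<Psi> x t) x) < e"
  proof (intro exI[of _ "min r (min d1 d2)"] conjI ballI impI)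
    show "min r (min d1 d2) > 0" using r d1 d2 by simp
    fix p assume p: "p \<in> D \<times> T" "dist p p0 < min r (min d1 d2)"
    obtain x t where xt: "p = (x, t)" by (cases p)
    have dx: "dist x x0 < r" "dist x x0 < d2" and dt: "dist t t0 < d1"
      using p(2) dist_fst_le[of p p0] dist_snd_le[of p p0] unfolding xt xt0 by auto
    have tT: "t \<in> T" using p xt by simp
    have sub: "cball x r \<subseteq> cball x0 (2 * r)"
    proof
      fix y assume "y \<in> cball x r"
      then show "y \<in> cball x0 (2 * r)" using dx(1) dist_triangle[of x0 y x] by (simp add: dist_commute)
    qed
    then have sD: "cball x r \<subseteq> D" using r by blast
    have h: "(\<lambda>x. \<Psi> x s) holomorphic_on ball x r" "continuous_on (cball x r) (\<lambda>x. \<Psi> x s)" if "s \<in> T" for s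
      using hol[OF that] sD ball_subset_cball[of x r] holomorphic_on_subset holomorphic_on_imp_continuous_on
      by (meson continuous_on_subset subset_trans)+
    have "norm (deriv (\<lambda>x. \<Psi> x t) x - deriv (\<lambda>x. \<Psi> x t0) x) \<le> (e * r / 3) / r"
    proof (rule deriv_difference_bound)
      show "norm (\<Psi> w t - \<Psi> w t0) \<le> e * r / 3" if "w \<in> cball x r" for w
        using d1(2)[OF dt] tT sub that by (intro X3) auto
    qed (use h tT 1(2) r in auto)
    then have "dist (deriv (\<lambda>x. \<Psi> x t) x) (deriv (\<lambda>x. \<Psi> x t0) x) \<le> e / 3" using r by (simp add: dist_norm)
    moreover have "dist (deriv (\<lambda>x. \<Psi> x t0) x) (deriv (\<lambda>x. \<Psi> x t0) x0) < e / 3" using d2(2)[OF dx(2)] .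
    ultimately have "dist (deriv (\<lambda>x. \<Psi> x t) x) (deriv (\<lambda>x. \<Psi> x t0) x0) < e"
      using dist_triangle[of "deriv (\<lambda>x. \<Psi> x t) x" "deriv (\<lambda>x. \<Psi> x t0) x0" "deriv (\<lambda>x. \<Psi> x t0) x"] 1(3) by linarith
    then show "dist (case p of (x, t) \<Rightarrow> deriv (\<lambda>x. \<Psi> x t) x) (case p0 of (x, t) \<Rightarrow> deriv (\<lambda>x. \<Psi> x t) x) < e"
      by (simp add: xt xt0)
  qed
qed

lemma holomorphic_contour_integral_circlepath:
  assumes D: "open D" "convex D" and \<rho>: "\<rho> \<ge> 0"
    and cont: "continuous_on (D \<times> sphere z \<rho>) (\<lambda>(x, u). \<Phi> x u)"
    and hol: "\<And>u. u \<in> sphere z \<rho> \<Longrightarrow> (\<lambda>x. \<Phi> x u) holomorphic_on D"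
  shows "(\<lambda>x. contour_integral (circlepath z \<rho>) (\<Phi> x)) holomorphic_on D"
proof -
  let ?g = "circlepath z \<rho>"
  have img: "?g t \<in> sphere z \<rho>" if "t \<in> {0..1}" for t
    using that \<rho> path_image_circlepath[of z \<rho>] unfolding path_image_def by auto
  have cg: "continuous_on {0..1} ?g" using path_circlepath[of z \<rho>] by (simp add: path_def)
  define g' where "g' t = 2 * pi * \<i> * \<rho> * exp (2 * of_real pi * \<i> * t)" for t :: real
  have vd: "vector_derivative ?g (at t) = g' t" for t
    by (simp add: vector_derivative_circlepath g'_def)
  have cg': "continuous_on S g'" for S unfolding g'_def by (intro continuous_intros)
  define f where "f x t = \<Phi> x (?g t) * g' t" for x t
  have contf: "continuous_on (D \<times> {0..1}) (\<lambda>(x, t). f x t)"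
  proof -
    have a: "continuous_on (D \<times> {0..1}) (\<lambda>p. (fst p, ?g (snd p)))"
      by (intro continuous_intros continuous_on_compose2[OF cg]) auto
    have b: "(\<lambda>p. (fst p, ?g (snd p))) ` (D \<times> {0..1}) \<subseteq> D \<times> sphere z \<rho>"
    proof
      fix q assume "q \<in> (\<lambda>p. (fst p, ?g (snd p))) ` (D \<times> {0..1})"
      then obtain a t where "q = (a, ?g t)" "a \<in> D" "t \<in> {0..1}" by auto
      then show "q \<in> D \<times> sphere z \<rho>" using img by blast
    qed
    from continuous_on_compose2[OF cont a b]
    have "continuous_on (D \<times> {0..1}) (\<lambda>p. \<Phi> (fst p) (?g (snd p)))" by simp
    then show ?thesis unfolding f_def split_beta
      by (intro continuous_intros continuous_on_compose2[OF cg'[of UNIV]]) auto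
  qed
  have holf: "(\<lambda>x. f x t) holomorphic_on D" if "t \<in> {0..1}" for t
    unfolding f_def using hol[OF img[OF that]] by (intro holomorphic_intros)
  have "(\<lambda>x. integral (cbox 0 1) (f x)) holomorphic_on D"
  proof (rule leibniz_rule_holomorphic)
    show "((\<lambda>x. f x t) has_field_derivative deriv (\<lambda>x. f x t) x) (at x within D)" if "x \<in> D" "t \<in> cbox 0 1" for x t
      using holomorphic_derivI[OF holf D(1)] that by (simp add: has_field_derivative_at_within)
    show "f x integrable_on cbox 0 1" if "x \<in> D" for x
    proof (rule integrable_continuous)
      have "continuous_on {0..1} (\<lambda>t. (x, t))" by (intro continuous_intros)
      from continuous_on_compose2[OF contf this] show "continuous_on (cbox 0 1) (f x)" using that by auto
    qed
    show "continuous_on (D \<times> cbox 0 1) (\<lambda>(x, t). deriv (\<lambda>x. f x t) x)"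
      using continuous_on_deriv_parameter[OF D(1), of "{0..1}" f] contf holf by simp
  qed fact
  moreover have "contour_integral ?g (\<Phi> x) = integral (cbox 0 1) (f x)" for x
    unfolding contour_integral_integral f_def using vd by (auto intro!: integral_cong)
  ultimately show ?thesis by simp
qed

text \<open>Cauchy's formula turns the derivative in \<open>y\<close> into a contour integral of
  \<open>\<phi> x\<close>, which depends holomorphically on \<open>x\<close>.\<close>

lemma holomorphic_deriv_parameter:
  assumes D: "open D" "convex D" and E: "open E"
    and cont: "continuous_on (D \<times> E) (\<lambda>(x, y). \<phi> x y)"
    and holx: "\<And>y. y \<in> E \<Longrightarrow> (\<lambda>x. \<phi> x y) holomorphic_on D" and holy: "\<And>x. x \<in> D \<Longrightarrow> \<phi> x holomorphic_on E"
    and y: "y \<in> E"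
  shows "(\<lambda>x. deriv (\<phi> x) y) holomorphic_on D"
proof -
  obtain r where r: "r > 0" "cball y r \<subseteq> E" using E y by (meson open_contains_cball)
  have sE: "sphere y r \<subseteq> E" using r(2) by auto
  have ny: "u - y \<noteq> 0" if "u \<in> sphere y r" for u using that r by auto
  have "(\<lambda>x. contour_integral (circlepath y r) (\<lambda>u. \<phi> x u / (u - y)\<^sup>2)) holomorphic_on D"
  proof (rule holomorphic_contour_integral_circlepath[OF D])
    show "r \<ge> 0" using r by simp
    have "continuous_on (D \<times> sphere y r) (\<lambda>p. \<phi> (fst p) (snd p))"
      using continuous_on_subset[OF cont, of "D \<times> sphere y r"] sE by (auto simp: split_beta)
    then show "continuous_on (D \<times> sphere y r) (\<lambda>(x, u). \<phi> x u / (u - y)\<^sup>2)"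
      unfolding split_beta using ny by (intro continuous_intros) auto
    show "(\<lambda>x. \<phi> x u / (u - y)\<^sup>2) holomorphic_on D" if "u \<in> sphere y r" for u
      using holx[of u] sE that ny[OF that] by (intro holomorphic_intros) auto
  qed
  then have "(\<lambda>x. contour_integral (circlepath y r) (\<lambda>u. \<phi> x u / (u - y)\<^sup>2) / (2 * pi * \<i>)) holomorphic_on D"
    by (intro holomorphic_intros) auto
  moreover have "contour_integral (circlepath y r) (\<lambda>u. \<phi> x u / (u - y)\<^sup>2) / (2 * pi * \<i>) = deriv (\<phi> x) y" if "x \<in> D" for x
  proof -
    have "contour_integral (circlepath y r) (\<lambda>u. \<phi> x u / (u - y)\<^sup>2) = 2 * pi * \<i> * deriv (\<phi> x) y"
    proof (rule Cauchy_contour_integral_circlepath_2)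
      show "continuous_on (cball y r) (\<phi> x)"
        by (rule continuous_on_subset[OF holomorphic_on_imp_continuous_on[OF holy[OF that]] r(2)])
      show "\<phi> x holomorphic_on ball y r"
        by (rule holomorphic_on_subset[OF holy[OF that] subset_trans[OF ball_subset_cball r(2)]])
    qed (use r in simp)
    then show ?thesis by simp
  qed
  ultimately show ?thesis by (simp cong: holomorphic_cong)
qed

text \<open>The Lagrange basis for the nodes \<open>t l\<close>. It does not depend on
  \<open>p\<close>, so coefficients of a family of polynomials are fixed linear combinations of the
  values at the nodes and inherit their holomorphy.\<close>

lemma interpolation_basis:
  fixes t :: "nat \<Rightarrow> complex"
  assumes inj: "inj_on t {..n}"
  shows "\<exists>L. \<forall>p. degree p \<le> n \<longrightarrow> p = (\<Sum>l\<le>n. smult (poly p (t l)) (L l))"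
proof -
  define L where "L l = (\<Prod>m\<in>{..n} - {l}. smult (1 / (t l - t m)) [:- t m, 1:])" for l
  have ev: "poly (L l) (t i) = (if i = l then 1 else 0)" if il: "i \<le> n" "l \<le> n" for i l
  proof (cases "i = l")
    case True
    have "t l - t m \<noteq> 0" if "m \<in> {..n} - {l}" for m using inj il that by (auto simp: inj_on_def)
    then have "poly (smult (1 / (t l - t m)) [:- t m, 1:]) (t l) = 1" if "m \<in> {..n} - {l}" for m
      using that by (simp add: diff_divide_distrib[symmetric])
    then have "(\<Prod>m\<in>{..n} - {l}. poly (smult (1 / (t l - t m)) [:- t m, 1:]) (t l)) = 1"
      by (intro prod.neutral) auto
    then show ?thesis using True unfolding L_def poly_prod by simp
  next
    case False
    then have "i \<in> {..n} - {l}" using il by simp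
    then have "poly (L l) (t i) = 0" unfolding L_def poly_prod by (intro prod_zero) auto
    then show ?thesis using False by simp
  qed
  have degL: "degree (L l) \<le> n" if "l \<le> n" for l
  proof -
    have "degree (L l) \<le> (\<Sum>m\<in>{..n} - {l}. degree (smult (1 / (t l - t m)) [:- t m, 1:]))"
      unfolding L_def by (rule degree_prod_sum_le[unfolded comp_def]) simp
    also have "\<dots> \<le> (\<Sum>m\<in>{..n} - {l}. 1)" by (intro sum_mono) (simp add: degree_smult_eq)
    also have "\<dots> = n" using that by simp
    finally show ?thesis .
  qed
  have "p = (\<Sum>l\<le>n. smult (poly p (t l)) (L l))" if p: "degree p \<le> n" for p
  proof (rule poly_eqI_degree[where A = "t ` {..n}"])
    have c: "card (t ` {..n}) = Suc n" using inj by (simp add: card_image)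
    show "degree p < card (t ` {..n})" using p c by simp
    have "degree (\<Sum>l\<le>n. smult (poly p (t l)) (L l)) \<le> n"
      using degL by (intro degree_sum_le) (auto intro: order_trans[OF degree_smult_le])
    then show "degree (\<Sum>l\<le>n. smult (poly p (t l)) (L l)) < card (t ` {..n})" using c by simp
    fix x assume "x \<in> t ` {..n}"
    then obtain i where i: "i \<le> n" "x = t i" by auto
    have "poly (\<Sum>l\<le>n. smult (poly p (t l)) (L l)) x = (\<Sum>l\<le>n. poly p (t l) * (if i = l then 1 else 0))"
      unfolding poly_sum i(2) poly_smult using i by (intro sum.cong) (auto simp: ev)
    also have "\<dots> = (\<Sum>l\<le>n. if i = l then poly p (t l) else 0)" by (intro sum.cong) auto
    also have "\<dots> = poly p x" using i by simp
    finally show "poly p x = poly (\<Sum>l\<le>n. smult (poly p (t l)) (L l)) x" by simp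
  qed
  then show ?thesis by blast
qed

section \<open>Common zeros of two holomorphic functions\<close>

text \<open>The zero-free annulus \<open>\<epsilon> \<le> |y| < \<epsilon>2\<close> confines the
  zeros of \<open>\<phi>1 x\<close> to the disc bounded by a fixed circle, for all small
  \<open>x\<close> at once. By \<open>z0\<close> they can only collapse to 0 as \<open>x\<close>
  tends to 0.\<close>

locale weierstrass_pair =
  fixes \<phi>1 \<phi>2 :: "complex \<Rightarrow> complex \<Rightarrow> complex" and r \<epsilon> \<epsilon>2 M :: real
  assumes r: "r > 0" and \<epsilon>: "0 < \<epsilon>" "\<epsilon> < \<epsilon>2"
    and cont1: "continuous_on (ball 0 r \<times> ball 0 \<epsilon>2) (\<lambda>(x, y). \<phi>1 x y)"
    and cont2: "continuous_on (ball 0 r \<times> ball 0 \<epsilon>2) (\<lambda>(x, y). \<phi>2 x y)"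
    and holx1: "\<And>y. y \<in> ball 0 \<epsilon>2 \<Longrightarrow> (\<lambda>x. \<phi>1 x y) holomorphic_on ball 0 r"
    and holx2: "\<And>y. y \<in> ball 0 \<epsilon>2 \<Longrightarrow> (\<lambda>x. \<phi>2 x y) holomorphic_on ball 0 r"
    and holy1: "\<And>x. x \<in> ball 0 r \<Longrightarrow> \<phi>1 x holomorphic_on ball 0 \<epsilon>2"
    and holy2: "\<And>x. x \<in> ball 0 r \<Longrightarrow> \<phi>2 x holomorphic_on ball 0 \<epsilon>2"
    and nz: "\<And>x y. norm x < r \<Longrightarrow> \<epsilon> \<le> norm y \<Longrightarrow> norm y < \<epsilon>2 \<Longrightarrow> \<phi>1 x y \<noteq> 0"
    and z0: "\<And>y. norm y < \<epsilon>2 \<Longrightarrow> \<phi>1 0 y = 0 \<Longrightarrow> y = 0"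
    and M: "\<And>x y. norm x < r \<Longrightarrow> norm y < \<epsilon>2 \<Longrightarrow> norm (\<phi>2 x y) \<le> M"
    and accum: "\<And>e. e > 0 \<Longrightarrow> \<exists>x y. norm x < e \<and> norm y < e \<and> (x \<noteq> 0 \<or> y \<noteq> 0) \<and> \<phi>1 x y = 0 \<and> \<phi>2 x y = 0"
begin

section \<open>Sums over the zeros of \<phi>1 in the second variable\<close>

text \<open>Joint continuity with separate holomorphy: enough for parameter integrals, and preserved
  by the algebraic operations used below.\<close>

definition adm :: "(complex \<Rightarrow> complex \<Rightarrow> complex) \<Rightarrow> bool" where
  "adm g \<longleftrightarrow> continuous_on (ball 0 r \<times> ball 0 \<epsilon>2) (\<lambda>(x, y). g x y) \<and>
    (\<forall>y\<in>ball 0 \<epsilon>2. (\<lambda>x. g x y) holomorphic_on ball 0 r) \<and> (\<forall>x\<in>ball 0 r. g x holomorphic_on ball 0 \<epsilon>2)"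

definition Z :: "complex \<Rightarrow> complex set" where "Z x = {y \<in> ball 0 \<epsilon>2. \<phi>1 x y = 0}"

definition \<nu> :: "complex \<Rightarrow> complex \<Rightarrow> nat" where "\<nu> x y = nat (zorder (\<phi>1 x) y)"

definition fs :: "(complex \<Rightarrow> complex \<Rightarrow> complex) \<Rightarrow> complex \<Rightarrow> complex" where
  "fs g x = (\<Sum>y\<in>Z x. of_nat (\<nu> x y) * g x y)"

lemma adm2: "adm \<phi>2" using cont2 holx2 holy2 by (simp add: adm_def)

lemma adm_const: "adm (\<lambda>x y. c)" by (simp add: adm_def split_beta)

lemma adm_snd: "adm (\<lambda>x y. y)"
  by (auto simp: adm_def split_beta intro!: continuous_intros holomorphic_intros)

lemma adm_mult: "adm f \<Longrightarrow> adm g \<Longrightarrow> adm (\<lambda>x y. f x y * g x y)"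
  by (auto simp: adm_def split_beta intro!: continuous_intros holomorphic_intros)

lemma adm_power: "adm f \<Longrightarrow> adm (\<lambda>x y. f x y ^ n)"
  by (auto simp: adm_def split_beta intro!: continuous_intros holomorphic_intros)

lemma adm_sum: "(\<And>i. i \<in> I \<Longrightarrow> adm (f i)) \<Longrightarrow> adm (\<lambda>x y. \<Sum>i\<in>I. f i x y)"
  by (auto simp: adm_def split_beta intro!: continuous_intros holomorphic_intros)

lemma adm_fst: "c holomorphic_on ball 0 r \<Longrightarrow> adm (\<lambda>x y. c x)"
  using holomorphic_on_imp_continuous_on[of c "ball 0 r"]
  by (auto simp: adm_def split_beta intro!: continuous_on_compose2[of "ball 0 r" c _ fst] continuous_intros)

lemma adm_Ln:
  assumes g: "adm g" and n: "\<And>x y. norm x < r \<Longrightarrow> norm y < \<epsilon>2 \<Longrightarrow> norm (g x y) < 1"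
  shows "adm (\<lambda>x y. Ln (1 - g x y))"
proof -
  have np: "1 - g x y \<notin> \<real>\<^sub>\<le>\<^sub>0" if "norm x < r" "norm y < \<epsilon>2" for x y
  proof
    assume a: "1 - g x y \<in> \<real>\<^sub>\<le>\<^sub>0"
    have "Re (g x y) < 1" using n[OF that] complex_Re_le_cmod[of "g x y"] by linarith
    then show False using a by (auto simp: complex_nonpos_Reals_iff)
  qed
  show ?thesis unfolding adm_def split_beta
    using g np by (auto simp: adm_def split_beta intro!: continuous_intros holomorphic_intros)
qed

lemma in_annulus: "complex_of_real \<epsilon> \<in> ball 0 \<epsilon>2" "norm (complex_of_real \<epsilon>) = \<epsilon>"
  using \<epsilon> by auto

lemma Z_subset: "norm x < r \<Longrightarrow> Z x \<subseteq> ball 0 \<epsilon>"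
  using nz[of x] by (force simp: Z_def)

lemma finite_Z:
  assumes x: "norm x < r"
  shows "finite (Z x)"
proof (cases "\<phi>1 x constant_on ball 0 \<epsilon>2")
  case True
  then obtain c where "\<And>y. y \<in> ball 0 \<epsilon>2 \<Longrightarrow> \<phi>1 x y = c" unfolding constant_on_def by blast
  moreover have "\<phi>1 x \<epsilon> \<noteq> 0" using nz[OF x, of \<epsilon>] \<epsilon> by simp
  ultimately have "Z x = {}" using in_annulus by (auto simp: Z_def)
  then show ?thesis by simp
next
  case False
  have "finite {y \<in> cball 0 \<epsilon>. \<phi>1 x y = 0}"
    using x \<epsilon> False by (intro holomorphic_compact_finite_zeros[OF holy1]) auto
  moreover have "Z x \<subseteq> {y \<in> cball 0 \<epsilon>. \<phi>1 x y = 0}"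
    using Z_subset[OF x] by (auto simp: Z_def)
  ultimately show ?thesis by (rule finite_subset[rotated])
qed

lemma zorder_pos:
  assumes x: "norm x < r" and y: "y \<in> Z x"
  shows "zorder (\<phi>1 x) y > 0"
proof -
  have "\<exists>w\<in>ball 0 \<epsilon>2. \<phi>1 x w \<noteq> 0" using nz[OF x, of \<epsilon>] in_annulus \<epsilon> by (intro bexI[of _ "complex_of_real \<epsilon>"]) auto
  then show ?thesis
    using zorder_exist_zero[OF holy1 open_ball connected_ball, of x y] x y by (auto simp: Z_def)
qed

lemma \<nu>_pos: "norm x < r \<Longrightarrow> y \<in> Z x \<Longrightarrow> \<nu> x y > 0"
  using zorder_pos by (simp add: \<nu>_def)

text \<open>By the argument principle \<open>fs g x\<close> is the contour integral of
  \<open>g \<phi>1' / \<phi>1\<close> over \<open>|y| = \<epsilon>\<close>, divided by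
  \<open>2 * pi * \<i>\<close>. The contour is free of zeros and independent of
  \<open>x\<close>.\<close>

lemma fs_holomorphic:
  assumes g: "adm g"
  shows "fs g holomorphic_on ball 0 r"
proof -
  have sub: "sphere 0 \<epsilon> \<subseteq> ball (0::complex) \<epsilon>2" using \<epsilon> by auto
  have adm1: "continuous_on (ball 0 r \<times> sphere 0 \<epsilon>) (\<lambda>p. \<phi>1 (fst p) (snd p))"
    "continuous_on (ball 0 r \<times> sphere 0 \<epsilon>) (\<lambda>p. g (fst p) (snd p))"
    using cont1 g sub by (auto simp: adm_def split_beta intro: continuous_on_subset)
  have "continuous_on (ball 0 \<epsilon>2 \<times> ball 0 r) (\<lambda>(y, x). deriv (\<lambda>y. \<phi>1 x y) y)"
  proof (rule continuous_on_deriv_parameter[OF open_ball])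
    have a: "continuous_on (ball 0 \<epsilon>2 \<times> ball 0 r) (\<lambda>p. (snd p, fst p) :: complex \<times> complex)"
      by (intro continuous_intros)
    have b: "(\<lambda>p. (snd p, fst p)) ` (ball 0 \<epsilon>2 \<times> ball 0 r) \<subseteq> ball (0::complex) r \<times> ball (0::complex) \<epsilon>2" by auto
    from continuous_on_compose2[OF cont1 a b]
    show "continuous_on (ball 0 \<epsilon>2 \<times> ball 0 r) (\<lambda>(y, x). \<phi>1 x y)" by (simp add: split_beta)
  qed (rule holy1)
  moreover have "continuous_on (ball 0 r \<times> sphere 0 \<epsilon>) (\<lambda>p. (snd p, fst p) :: complex \<times> complex)"
    by (intro continuous_intros)
  moreover have "(\<lambda>p. (snd p, fst p)) ` (ball 0 r \<times> sphere 0 \<epsilon>) \<subseteq> ball (0::complex) \<epsilon>2 \<times> ball (0::complex) r"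
    using sub by auto
  ultimately have contd: "continuous_on (ball 0 r \<times> sphere 0 \<epsilon>) (\<lambda>p. deriv (\<phi>1 (fst p)) (snd p))"
    using continuous_on_compose2[of "ball 0 \<epsilon>2 \<times> ball 0 r" "\<lambda>(y, x). deriv (\<phi>1 x) y" "ball 0 r \<times> sphere 0 \<epsilon>" "\<lambda>p. (snd p, fst p)"]
    by (simp add: split_beta)
  have nz': "\<phi>1 x u \<noteq> 0" if "x \<in> ball 0 r" "u \<in> sphere 0 \<epsilon>" for x u using that nz[of x u] \<epsilon> by simp
  have "(\<lambda>x. contour_integral (circlepath 0 \<epsilon>) (\<lambda>u. deriv (\<phi>1 x) u * g x u / \<phi>1 x u)) holomorphic_on ball 0 r"
  proof (rule holomorphic_contour_integral_circlepath[OF open_ball convex_ball])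
    show "continuous_on (ball 0 r \<times> sphere 0 \<epsilon>) (\<lambda>(x, u). deriv (\<phi>1 x) u * g x u / \<phi>1 x u)"
      unfolding split_beta using nz' by (intro continuous_intros contd adm1) auto
    show "(\<lambda>x. deriv (\<phi>1 x) u * g x u / \<phi>1 x u) holomorphic_on ball 0 r" if u: "u \<in> sphere 0 \<epsilon>" for u
    proof -
      have uE: "u \<in> ball 0 \<epsilon>2" using u sub by blast
      have "(\<lambda>x. deriv (\<phi>1 x) u) holomorphic_on ball 0 r"
        by (rule holomorphic_deriv_parameter[OF open_ball convex_ball open_ball cont1 holx1 holy1 uE])
      moreover have "(\<lambda>x. g x u) holomorphic_on ball 0 r" using g uE by (simp add: adm_def)
      ultimately show ?thesis using holx1[OF uE] nz' u by (intro holomorphic_intros) auto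
    qed
  qed (use \<epsilon> in simp)
  then have "(\<lambda>x. contour_integral (circlepath 0 \<epsilon>) (\<lambda>u. deriv (\<phi>1 x) u * g x u / \<phi>1 x u) / (2 * pi * \<i>)) holomorphic_on ball 0 r"
    by (intro holomorphic_intros) auto
  moreover have "contour_integral (circlepath 0 \<epsilon>) (\<lambda>u. deriv (\<phi>1 x) u * g x u / \<phi>1 x u) / (2 * pi * \<i>) = fs g x"
    if x: "x \<in> ball 0 r" for x
  proof -
    have xr: "norm x < r" using x by simp
    have pz: "{w \<in> ball 0 \<epsilon>2. \<phi>1 x w = 0 \<or> w \<in> {}} = Z x" by (auto simp: Z_def)
    have "contour_integral (circlepath 0 \<epsilon>) (\<lambda>u. deriv (\<phi>1 x) u * g x u / \<phi>1 x u) =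
      2 * pi * \<i> * (\<Sum>p\<in>{w \<in> ball 0 \<epsilon>2. \<phi>1 x w = 0 \<or> w \<in> {}}. winding_number (circlepath 0 \<epsilon>) p * g x p * zorder (\<phi>1 x) p)"
    proof (rule argument_principle)
      show "\<phi>1 x holomorphic_on ball 0 \<epsilon>2 - {}" using holy1[OF x] by simp
      show "g x holomorphic_on ball 0 \<epsilon>2" using g x by (simp add: adm_def)
      show "path_image (circlepath 0 \<epsilon>) \<subseteq> ball 0 \<epsilon>2 - {w \<in> ball 0 \<epsilon>2. \<phi>1 x w = 0 \<or> w \<in> {}}"
        unfolding pz using \<epsilon> sub Z_subset[OF xr] by (auto simp: path_image_circlepath)
      show "\<forall>z. z \<notin> ball 0 \<epsilon>2 \<longrightarrow> winding_number (circlepath 0 \<epsilon>) z = 0"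
      proof (intro allI impI)
        fix z :: complex assume "z \<notin> ball 0 \<epsilon>2"
        then show "winding_number (circlepath 0 \<epsilon>) z = 0"
          using \<epsilon> by (intro winding_number_zero_outside[of _ "cball 0 \<epsilon>"]) (auto simp: path_image_circlepath)
      qed
      show "finite {w \<in> ball 0 \<epsilon>2. \<phi>1 x w = 0 \<or> w \<in> {}}" unfolding pz by (rule finite_Z[OF xr])
    qed auto
    also have "(\<Sum>p\<in>{w \<in> ball 0 \<epsilon>2. \<phi>1 x w = 0 \<or> w \<in> {}}. winding_number (circlepath 0 \<epsilon>) p * g x p * zorder (\<phi>1 x) p) = fs g x"
      unfolding pz fs_def
    proof (rule sum.cong[OF refl])
      fix y assume y: "y \<in> Z x"
      have "winding_number (circlepath 0 \<epsilon>) y = 1"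
        using y Z_subset[OF xr] by (intro winding_number_circlepath) (auto simp: dist_norm)
      moreover have "(of_int (zorder (\<phi>1 x) y) :: complex) = of_nat (\<nu> x y)"
        using zorder_pos[OF xr y] by (simp add: \<nu>_def)
      ultimately show "winding_number (circlepath 0 \<epsilon>) y * g x y * of_int (zorder (\<phi>1 x) y) = of_nat (\<nu> x y) * g x y"
        by (simp add: mult.commute)
    qed
    finally show ?thesis by simp
  qed
  ultimately show ?thesis by (rule holomorphic_transform)
qed

lemma nat_valued_holomorphic_constant:
  assumes S: "connected S" and f: "continuous_on S f" and nat: "\<And>x. x \<in> S \<Longrightarrow> f x = complex_of_nat (n x)"
  shows "\<exists>N. \<forall>x\<in>S. n x = N"
proof -
  have "f constant_on S"
  proof (rule continuous_discrete_range_constant[OF S f])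
    fix x assume x: "x \<in> S"
    show "\<exists>e>0. \<forall>y. y \<in> S \<and> f y \<noteq> f x \<longrightarrow> e \<le> norm (f y - f x)"
    proof (intro exI[of _ 1] conjI allI impI)
      fix y assume y: "y \<in> S \<and> f y \<noteq> f x"
      then have ne: "int (n y) - int (n x) \<noteq> 0" using x nat by auto
      have "f y - f x = of_int (int (n y) - int (n x))" using x y nat by simp
      then have "norm (f y - f x) = \<bar>of_int (int (n y) - int (n x))\<bar>" by (simp only: norm_of_int)
      then show "1 \<le> norm (f y - f x)" using ne by linarith
    qed simp
  qed
  then obtain c where "\<And>x. x \<in> S \<Longrightarrow> f x = c" unfolding constant_on_def by blast
  then have "\<And>x y. x \<in> S \<Longrightarrow> y \<in> S \<Longrightarrow> n x = n y" using nat by (metis of_nat_eq_iff)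
  then show ?thesis by blast
qed

text \<open>The number of zeros is \<open>fs\<close> of the constant 1, a continuous function with
  natural values on a connected set.\<close>

lemma total_multiplicity: "\<exists>N. \<forall>x\<in>ball 0 r. (\<Sum>y\<in>Z x. \<nu> x y) = N"
proof (rule nat_valued_holomorphic_constant[OF connected_ball])
  show "continuous_on (ball 0 r) (fs (\<lambda>x y. 1))"
    by (intro holomorphic_on_imp_continuous_on fs_holomorphic adm_const)
  show "fs (\<lambda>x y. 1) x = complex_of_nat (\<Sum>y\<in>Z x. \<nu> x y)" for x by (simp add: fs_def)
qed

definition N :: nat where "N = (SOME N. \<forall>x\<in>ball 0 r. (\<Sum>y\<in>Z x. \<nu> x y) = N)"

lemma N: "norm x < r \<Longrightarrow> (\<Sum>y\<in>Z x. \<nu> x y) = N"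
  using someI_ex[OF total_multiplicity] unfolding N_def[symmetric] by simp

section \<open>Elimination: separating the zeros of \<phi>1 at which \<phi>2 vanishes\<close>

text \<open>The characteristic polynomial of multiplication by \<phi>2 modulo
  \<open>\<phi>1 x\<close>. Its constant term is, up to sign, the resultant; how many low
  coefficients vanish identically counts the generic common zeros.\<close>

definition Q :: "complex \<Rightarrow> complex poly" where
  "Q x = (\<Prod>y\<in>Z x. [:- \<phi>2 x y, 1:] ^ \<nu> x y)"

lemma poly_Q: "poly (Q x) t = (\<Prod>y\<in>Z x. (t - \<phi>2 x y) ^ \<nu> x y)"
  by (simp add: Q_def poly_prod poly_power)

lemma degree_prod_linear:
  "degree (\<Prod>y\<in>A. [:- f y, 1::complex:] ^ m y) = (\<Sum>y\<in>A. m y)"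
  by (subst degree_prod_eq_sum_degree) (auto simp: degree_power_eq)

lemma degree_Q: "norm x < r \<Longrightarrow> degree (Q x) = N"
  unfolding Q_def degree_prod_linear by (rule N)

lemma coeff_Q_N: "norm x < r \<Longrightarrow> coeff (Q x) N = 1"
proof -
  assume x: "norm x < r"
  have "lead_coeff (Q x) = 1" unfolding Q_def by (simp add: lead_coeff_prod lead_coeff_power)
  then show ?thesis by (simp add: degree_Q[OF x])
qed

lemma exp_fs:
  assumes "\<And>y. y \<in> A \<Longrightarrow> u y \<noteq> (0::complex)"
  shows "exp (\<Sum>y\<in>A. of_nat (m y) * Ln (u y)) = (\<Prod>y\<in>A. u y ^ m y)"
proof (cases "finite A")
  case True
  have "exp (\<Sum>y\<in>A. of_nat (m y) * Ln (u y)) = (\<Prod>y\<in>A. exp (of_nat (m y) * Ln (u y)))"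
    by (rule exp_sum[OF True])
  also have "\<dots> = (\<Prod>y\<in>A. u y ^ m y)"
    using assms by (intro prod.cong refl) (simp add: exp_of_nat_mult)
  finally show ?thesis .
qed simp

lemma M0: "M \<ge> 0"
  by (rule order_trans[OF norm_ge_zero M[of 0 0]]) (use r \<epsilon> in auto)

text \<open>For \<open>|t| > M\<close> the numbers \<open>1 - \<phi>2 x y / t\<close> stay in the
  disc of radius 1 around 1, where the principal logarithm is holomorphic.\<close>

lemma Q_value_holomorphic:
  assumes t: "norm t > M"
  shows "(\<lambda>x. poly (Q x) t) holomorphic_on ball 0 r"
proof -
  have t0: "t \<noteq> 0" using t M0 by auto
  have lt: "norm (\<phi>2 x y / t) < 1" if "norm x < r" "norm y < \<epsilon>2" for x y
    using M[OF that] t t0 by (simp add: norm_divide)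
  have "adm (\<lambda>x y. \<phi>2 x y * (1 / t))" by (intro adm_mult adm2 adm_const)
  then have "adm (\<lambda>x y. \<phi>2 x y / t)" by simp
  then have "adm (\<lambda>x y. Ln (1 - \<phi>2 x y / t))" using lt by (rule adm_Ln)
  then have "(\<lambda>x. t ^ N * exp (fs (\<lambda>x y. Ln (1 - \<phi>2 x y / t)) x)) holomorphic_on ball 0 r"
    by (intro holomorphic_intros fs_holomorphic)
  moreover have "t ^ N * exp (fs (\<lambda>x y. Ln (1 - \<phi>2 x y / t)) x) = poly (Q x) t" if x: "x \<in> ball 0 r" for x
  proof -
    have xr: "norm x < r" using x by simp
    have "exp (fs (\<lambda>x y. Ln (1 - \<phi>2 x y / t)) x) = (\<Prod>y\<in>Z x. (1 - \<phi>2 x y / t) ^ \<nu> x y)"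
      unfolding fs_def
    proof (rule exp_fs)
      fix y assume "y \<in> Z x"
      then have "norm (\<phi>2 x y / t) < 1" using lt[OF xr] by (simp add: Z_def)
      then show "1 - \<phi>2 x y / t \<noteq> 0" by auto
    qed
    moreover have "t ^ N = (\<Prod>y\<in>Z x. t ^ \<nu> x y)" unfolding N[OF xr, symmetric] by (rule power_sum)
    ultimately have "t ^ N * exp (fs (\<lambda>x y. Ln (1 - \<phi>2 x y / t)) x) = (\<Prod>y\<in>Z x. t ^ \<nu> x y * (1 - \<phi>2 x y / t) ^ \<nu> x y)"
      by (simp add: prod.distrib)
    also have "\<dots> = poly (Q x) t" unfolding poly_Q
      using t0 by (intro prod.cong refl) (simp add: power_mult_distrib[symmetric] right_diff_distrib)
    finally show ?thesis .
  qed
  ultimately show ?thesis by (rule holomorphic_transform)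
qed

text \<open>Only the values of \<open>Q x\<close> at large arguments are exponentials of holomorphic sums of logarithms; the
  coefficients are recovered from them by Lagrange interpolation.\<close>

lemma Q_coeff_holomorphic: "(\<lambda>x. coeff (Q x) j) holomorphic_on ball 0 r"
proof -
  define t where "t l = complex_of_real (M + 1 + real l)" for l
  have nt: "norm (t l) > M" for l unfolding t_def norm_of_real using M0 by simp
  have "inj_on t {..N}" by (auto simp: t_def inj_on_def)
  then obtain L where L: "\<And>p. degree p \<le> N \<Longrightarrow> p = (\<Sum>l\<le>N. smult (poly p (t l)) (L l))"
    using interpolation_basis by blast
  have "(\<lambda>x. \<Sum>l\<le>N. poly (Q x) (t l) * coeff (L l) j) holomorphic_on ball 0 r"
    by (intro holomorphic_intros Q_value_holomorphic nt)
  moreover have "(\<Sum>l\<le>N. poly (Q x) (t l) * coeff (L l) j) = coeff (Q x) j" if "x \<in> ball 0 r" for x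
  proof -
    have "Q x = (\<Sum>l\<le>N. smult (poly (Q x) (t l)) (L l))" using that by (intro L) (simp add: degree_Q)
    then have "coeff (Q x) j = coeff (\<Sum>l\<le>N. smult (poly (Q x) (t l)) (L l)) j" by simp
    then show ?thesis by (simp add: coeff_sum)
  qed
  ultimately show ?thesis by (rule holomorphic_transform)
qed

text \<open>With \<open>Q\<^sub>x(t) = t\<^sup>k q\<^sub>x(t)\<close>, \<open>k\<close> maximal for generic \<open>x\<close>, the function \<open>q\<^sub>x(\<phi>\<^sub>2(x, y)) / q\<^sub>x(0)\<close> is the
  indicator of \<open>\<phi>\<^sub>2 = 0\<close> on the zeros of \<open>\<phi>\<^sub>1(x, \<cdot>)\<close>; it turns sums over these zeros into sums over the
  common zeros without losing holomorphy in \<open>x\<close>.\<close>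

definition k :: nat where "k = (LEAST j. \<exists>x\<in>ball 0 r. coeff (Q x) j \<noteq> 0)"

definition c :: "complex \<Rightarrow> complex" where "c x = coeff (Q x) k"

definition qv :: "complex \<Rightarrow> complex \<Rightarrow> complex" where
  "qv x t = (\<Sum>j\<le>N. coeff (Q x) (j + k) * t ^ j)"

lemma c_nonzero_somewhere: "\<exists>x\<in>ball 0 r. c x \<noteq> 0"
proof -
  have "\<exists>x\<in>ball 0 r. coeff (Q x) N \<noteq> 0" using r coeff_Q_N[of 0] by (intro bexI[of _ 0]) auto
  then show ?thesis unfolding c_def k_def by (rule LeastI)
qed

lemma low_coeff: "norm x < r \<Longrightarrow> j < k \<Longrightarrow> coeff (Q x) j = 0"
  using not_less_Least[of j "\<lambda>j. \<exists>x\<in>ball 0 r. coeff (Q x) j \<noteq> 0"] unfolding k_def by auto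

lemma Q_factor:
  assumes x: "norm x < r"
  shows "poly (Q x) t = t ^ k * qv x t"
proof -
  have "poly (Q x) t = (\<Sum>i\<le>N. coeff (Q x) i * t ^ i)" by (simp add: poly_altdef degree_Q[OF x])
  also have "\<dots> = (\<Sum>i\<in>{0 + k..N + k}. coeff (Q x) i * t ^ i)"
  proof -
    have "(\<Sum>i\<le>N. coeff (Q x) i * t ^ i) = (\<Sum>i\<le>N + k. coeff (Q x) i * t ^ i)"
      by (intro sum.mono_neutral_left) (auto simp: coeff_eq_0 degree_Q[OF x])
    also have "\<dots> = (\<Sum>i\<in>{0 + k..N + k}. coeff (Q x) i * t ^ i)"
      by (intro sum.mono_neutral_right) (auto simp: low_coeff[OF x])
    finally show ?thesis .
  qed
  also have "\<dots> = (\<Sum>j\<in>{0..N}. coeff (Q x) (j + k) * t ^ (j + k))" by (rule sum.shift_bounds_cl_nat_ivl)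
  also have "\<dots> = t ^ k * qv x t"
    by (simp add: qv_def sum_distrib_left power_add mult_ac atMost_atLeast0)
  finally show ?thesis .
qed

lemma qv_indicator:
  assumes x: "norm x < r" and y: "y \<in> Z x"
  shows "qv x (\<phi>2 x y) = (if \<phi>2 x y = 0 then c x else 0)"
proof (cases "\<phi>2 x y = 0")
  case True
  have "qv x 0 = (\<Sum>j\<in>{0}. coeff (Q x) (j + k) * 0 ^ j)"
    unfolding qv_def by (intro sum.mono_neutral_right) auto
  then show ?thesis using True by (simp add: c_def)
next
  case False
  have "poly (Q x) (\<phi>2 x y) = 0"
    unfolding poly_Q using finite_Z[OF x] y \<nu>_pos[OF x y] by (intro prod_zero) auto
  then show ?thesis using False Q_factor[OF x] by simp
qed

lemma adm_qv: "adm (\<lambda>x y. qv x (\<phi>2 x y))"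
  unfolding qv_def by (intro adm_sum adm_mult adm_fst Q_coeff_holomorphic adm_power adm2)

definition Zc :: "complex \<Rightarrow> complex set" where "Zc x = {y \<in> Z x. \<phi>2 x y = 0}"

lemma fs_common:
  assumes x: "norm x < r"
  shows "fs (\<lambda>x y. qv x (\<phi>2 x y) * g x y) x = c x * (\<Sum>y\<in>Zc x. of_nat (\<nu> x y) * g x y)"
proof -
  have "fs (\<lambda>x y. qv x (\<phi>2 x y) * g x y) x = (\<Sum>y\<in>Z x. if \<phi>2 x y = 0 then c x * (of_nat (\<nu> x y) * g x y) else 0)"
    unfolding fs_def by (intro sum.cong refl) (simp add: qv_indicator[OF x])
  also have "\<dots> = (\<Sum>y\<in>Zc x. c x * (of_nat (\<nu> x y) * g x y))"
    unfolding Zc_def by (rule sum.inter_filter[symmetric]) (rule finite_Z[OF x])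
  finally show ?thesis by (simp add: sum_distrib_left)
qed

lemma c_holomorphic: "c holomorphic_on ball 0 r"
  using Q_coeff_holomorphic by (simp add: c_def[abs_def])

text \<open>\<open>c\<close> may vanish at the origin, so dividing by it leaves a punctured disc;
  the origin is recovered later by removing a singularity.\<close>

lemma c_nonzero_punctured: "\<exists>\<rho>>0. \<rho> \<le> r \<and> (\<forall>x. 0 < norm x \<longrightarrow> norm x < \<rho> \<longrightarrow> c x \<noteq> 0)"
proof (cases "c 0 = 0")
  case True
  obtain \<beta> where \<beta>: "\<beta> \<in> ball 0 r" "c \<beta> \<noteq> 0" using c_nonzero_somewhere by blast
  have z: "0 \<in> ball (0::complex) r" using r by simp
  show ?thesis
  proof (rule isolated_zeros[OF c_holomorphic open_ball connected_ball z True \<beta>])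
    fix \<rho> :: real
    assume \<rho>: "\<rho> > 0" "ball 0 \<rho> \<subseteq> ball (0::complex) r" "\<And>z. z \<in> ball 0 \<rho> - {0} \<Longrightarrow> c z \<noteq> 0"
    have "\<rho> \<le> r" using \<rho>(1,2) by (simp add: ball_subset_ball_iff)
    then show ?thesis using \<rho>(1) \<rho>(3) by (intro exI[of _ \<rho>]) simp
  qed
next
  case False
  have "isCont c 0"
    using holomorphic_on_imp_continuous_on[OF c_holomorphic] r by (simp add: continuous_on_eq_continuous_at)
  from continuous_at_avoid[OF this False] obtain d where "d > 0" "\<And>x. dist 0 x < d \<Longrightarrow> c x \<noteq> 0" by blast
  then show ?thesis using r by (intro exI[of _ "min d r"]) auto
qed

definition \<rho> :: real where "\<rho> = (SOME \<rho>. \<rho> > 0 \<and> \<rho> \<le> r \<and> (\<forall>x. 0 < norm x \<longrightarrow> norm x < \<rho> \<longrightarrow> c x \<noteq> 0))"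

lemma \<rho>: "\<rho> > 0" "\<rho> \<le> r" "x \<noteq> 0 \<Longrightarrow> norm x < \<rho> \<Longrightarrow> c x \<noteq> 0"
  using someI_ex[OF c_nonzero_punctured] unfolding \<rho>_def[symmetric] by auto

lemma common_sum_holomorphic:
  assumes g: "adm g"
  shows "(\<lambda>x. \<Sum>y\<in>Zc x. of_nat (\<nu> x y) * g x y) holomorphic_on (ball 0 \<rho> - {0})"
proof -
  have sub: "ball 0 \<rho> - {0} \<subseteq> ball (0::complex) r" using \<rho> by auto
  have "fs (\<lambda>x y. qv x (\<phi>2 x y) * g x y) holomorphic_on (ball 0 \<rho> - {0})"
    by (rule holomorphic_on_subset[OF fs_holomorphic[OF adm_mult[OF adm_qv g]] sub])
  moreover have "c holomorphic_on (ball 0 \<rho> - {0})" by (rule holomorphic_on_subset[OF c_holomorphic sub])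
  ultimately have "(\<lambda>x. fs (\<lambda>x y. qv x (\<phi>2 x y) * g x y) x / c x) holomorphic_on (ball 0 \<rho> - {0})"
    using \<rho>(3) by (intro holomorphic_intros) auto
  moreover have "fs (\<lambda>x y. qv x (\<phi>2 x y) * g x y) x / c x = (\<Sum>y\<in>Zc x. of_nat (\<nu> x y) * g x y)"
    if x: "x \<in> ball 0 \<rho> - {0}" for x
    using fs_common[of x g] \<rho>(2) \<rho>(3)[of x] x by simp
  ultimately show ?thesis by (rule holomorphic_transform)
qed

lemma common_multiplicity: "\<exists>K. \<forall>x\<in>ball 0 \<rho> - {0}. (\<Sum>y\<in>Zc x. \<nu> x y) = K"
proof (rule nat_valued_holomorphic_constant)
  show "connected (ball 0 \<rho> - {0::complex})" by (rule connected_punctured_ball) simp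
  show "continuous_on (ball 0 \<rho> - {0}) (\<lambda>x. \<Sum>y\<in>Zc x. complex_of_nat (\<nu> x y) * 1)"
    by (rule holomorphic_on_imp_continuous_on[OF common_sum_holomorphic[OF adm_const[of 1]]])
qed simp

definition K :: nat where "K = (SOME K. \<forall>x\<in>ball 0 \<rho> - {0}. (\<Sum>y\<in>Zc x. \<nu> x y) = K)"

lemma K: "x \<noteq> 0 \<Longrightarrow> norm x < \<rho> \<Longrightarrow> (\<Sum>y\<in>Zc x. \<nu> x y) = K"
  using someI_ex[OF common_multiplicity] unfolding K_def[symmetric] by simp

text \<open>Some common zero other than the origin lies close to it. It has
  \<open>x \<noteq> 0\<close> by \<open>z0\<close>, so it is counted by the constant multiplicity
  over the punctured disc.\<close>

lemma K_pos: "K > 0"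
proof -
  have "min \<rho> \<epsilon>2 > 0" using \<rho>(1) \<epsilon> by simp
  from accum[OF this] obtain x y where xy: "norm x < \<rho>" "norm y < \<epsilon>2" "x \<noteq> 0 \<or> y \<noteq> 0" "\<phi>1 x y = 0" "\<phi>2 x y = 0"
    by auto
  have "x \<noteq> 0" using xy z0[of y] by auto
  have xr: "norm x < r" using xy \<rho> by linarith
  have y: "y \<in> Zc x" using xy by (simp add: Zc_def Z_def)
  have "finite (Zc x)" using finite_Z[OF xr] by (simp add: Zc_def)
  moreover have "\<nu> x y > 0" using y by (intro \<nu>_pos[OF xr]) (simp add: Zc_def)
  ultimately have "(\<Sum>y\<in>Zc x. \<nu> x y) > 0" using y by (meson sum_pos2 le0)
  then show ?thesis using K[OF \<open>x \<noteq> 0\<close> xy(1)] by simp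
qed

text \<open>On the compact set \<open>e \<le> |y| \<le> \<epsilon>\<close> the modulus of
  \<open>\<phi>1 0\<close> has a positive minimum, and \<open>\<phi>1 x\<close> is uniformly close
  to it for small \<open>x\<close>.\<close>

lemma Z_small:
  assumes e: "e > 0"
  shows "\<exists>\<delta>>0. \<forall>x. norm x < \<delta> \<longrightarrow> norm x < r \<longrightarrow> (\<forall>y\<in>Z x. norm y < e)"
proof -
  define A where "A = cball 0 \<epsilon> - ball (0::complex) e"
  have cA: "compact A" unfolding A_def by (intro compact_diff) auto
  have AE: "A \<subseteq> ball 0 \<epsilon>2" using \<epsilon> by (auto simp: A_def)
  show ?thesis
  proof (cases "A = {}")
    case True
    have "norm y < e" if "norm x < r" "y \<in> Z x" for x y
      using Z_subset[OF that(1)] that(2) True by (force simp: A_def)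
    then show ?thesis by (intro exI[of _ 1]) auto
  next
    case False
    have "continuous_on A (\<lambda>y. norm (\<phi>1 0 y))"
      using continuous_on_subset[OF holomorphic_on_imp_continuous_on[OF holy1] AE, of 0] r by (intro continuous_intros) auto
    then obtain y0 where y0: "y0 \<in> A" "\<And>y. y \<in> A \<Longrightarrow> norm (\<phi>1 0 y0) \<le> norm (\<phi>1 0 y)"
      using continuous_attains_inf[OF cA False] by blast
    have "y0 \<noteq> 0" using y0(1) e by (auto simp: A_def)
    then have m: "norm (\<phi>1 0 y0) > 0" using z0[of y0] y0(1) AE by auto
    then have m2: "norm (\<phi>1 0 y0) / 2 > 0" by simp
    have "continuous_on (ball 0 r \<times> A) (\<lambda>(x, y). \<phi>1 x y)"
      by (rule continuous_on_subset[OF cont1]) (use AE in auto)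
    from continuous_on_prod_compactE[OF this cA, of 0, OF _ m2]
    obtain X where X: "0 \<in> X" "open X" and X': "\<forall>x\<in>X \<inter> ball 0 r. \<forall>y\<in>A. dist (\<phi>1 x y) (\<phi>1 0 y) \<le> norm (\<phi>1 0 y0) / 2"
      using r by (auto simp del: mem_ball)
    obtain \<delta> where \<delta>: "\<delta> > 0" "ball 0 \<delta> \<subseteq> X" using X by (meson openE)
    have "norm y < e" if x: "norm x < \<delta>" "norm x < r" and y: "y \<in> Z x" for x y
    proof (rule ccontr)
      assume "\<not> norm y < e"
      then have yA: "y \<in> A" using Z_subset[OF x(2)] y by (auto simp: A_def)
      have "x \<in> X \<inter> ball 0 r" using x \<delta>(2) by auto
      then have "dist (\<phi>1 x y) (\<phi>1 0 y) \<le> norm (\<phi>1 0 y0) / 2" using X' yA by blast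
      moreover have "\<phi>1 x y = 0" using y by (simp add: Z_def)
      ultimately show False using y0(2)[OF yA] m by simp
    qed
    then show ?thesis using \<delta>(1) by blast
  qed
qed

section \<open>The Weierstrass polynomial of the common zeros\<close>

definition P :: "complex \<Rightarrow> complex poly" where "P x = (\<Prod>y\<in>Zc x. [:- y, 1:] ^ \<nu> x y)"

lemma poly_P: "poly (P x) s = (\<Prod>y\<in>Zc x. (s - y) ^ \<nu> x y)"
  by (simp add: P_def poly_prod poly_power)

lemma degree_P: "x \<noteq> 0 \<Longrightarrow> norm x < \<rho> \<Longrightarrow> degree (P x) = K"
  unfolding P_def degree_prod_linear by (rule K)

lemma P_value:
  assumes s: "norm s > \<epsilon>2" and x: "x \<noteq> 0" "norm x < \<rho>"
  shows "poly (P x) s = s ^ K * exp (\<Sum>y\<in>Zc x. of_nat (\<nu> x y) * Ln (1 - y / s))"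
proof -
  have s0: "s \<noteq> 0" using s \<epsilon> by auto
  have "exp (\<Sum>y\<in>Zc x. of_nat (\<nu> x y) * Ln (1 - y / s)) = (\<Prod>y\<in>Zc x. (1 - y / s) ^ \<nu> x y)"
  proof (rule exp_fs)
    fix y assume "y \<in> Zc x"
    then have "norm y < \<epsilon>2" by (simp add: Zc_def Z_def)
    then show "1 - y / s \<noteq> 0" using s by auto
  qed
  moreover have "s ^ K = (\<Prod>y\<in>Zc x. s ^ \<nu> x y)" unfolding K[OF x, symmetric] by (rule power_sum)
  ultimately have "s ^ K * exp (\<Sum>y\<in>Zc x. of_nat (\<nu> x y) * Ln (1 - y / s)) = (\<Prod>y\<in>Zc x. s ^ \<nu> x y * (1 - y / s) ^ \<nu> x y)"
    by (simp add: prod.distrib)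
  also have "\<dots> = poly (P x) s" unfolding poly_P
    using s0 by (intro prod.cong refl) (simp add: power_mult_distrib[symmetric] right_diff_distrib)
  finally show ?thesis by simp
qed

text \<open>The \<open>K\<close> common zeros over \<open>x\<close>, counted with multiplicity, all
  tend to 0. This limit is what makes the singularity at \<open>x = 0\<close> removable.\<close>

lemma P_value_limit:
  assumes s: "norm s > \<epsilon>2"
  shows "((\<lambda>x. poly (P x) s) \<longlongrightarrow> s ^ K) (at 0)"
proof -
  have s0: "s \<noteq> 0" using s \<epsilon> by auto
  have lim0: "((\<lambda>x. \<Sum>y\<in>Zc x. of_nat (\<nu> x y) * Ln (1 - y / s)) \<longlongrightarrow> 0) (at 0)"
    unfolding LIM_eq
  proof (intro allI impI)
    fix e :: real assume e: "e > 0"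
    have "isCont (\<lambda>y. Ln (1 - y / s)) 0" using s0 by (intro continuous_intros) auto
    moreover have "e / (real K + 1) > 0" using e by simp
    ultimately obtain d where d: "d > 0" "\<And>y. dist y 0 < d \<Longrightarrow> dist (Ln (1 - y / s)) (Ln (1 - 0 / s)) < e / (real K + 1)"
      unfolding continuous_at_eps_delta by blast
    obtain \<delta> where \<delta>: "\<delta> > 0" "\<And>x y. norm x < \<delta> \<Longrightarrow> norm x < r \<Longrightarrow> y \<in> Z x \<Longrightarrow> norm y < d"
      using Z_small[OF d(1)] by blast
    show "\<exists>s'>0. \<forall>x. x \<noteq> 0 \<and> norm (x - 0) < s' \<longrightarrow> norm ((\<Sum>y\<in>Zc x. of_nat (\<nu> x y) * Ln (1 - y / s)) - 0) < e"
    proof (intro exI[of _ "min \<delta> \<rho>"] conjI allI impI)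
      show "min \<delta> \<rho> > 0" using \<delta> \<rho> by simp
      fix x :: complex assume x: "x \<noteq> 0 \<and> norm (x - 0) < min \<delta> \<rho>"
      have xr: "norm x < r" using x \<rho> by simp
      have "norm (\<Sum>y\<in>Zc x. of_nat (\<nu> x y) * Ln (1 - y / s)) \<le> (\<Sum>y\<in>Zc x. real (\<nu> x y) * (e / (real K + 1)))"
      proof (rule sum_norm_le)
        fix y assume "y \<in> Zc x"
        then have "norm y < d" using \<delta>(2)[of x y] x xr by (simp add: Zc_def)
        then have "norm (Ln (1 - y / s)) < e / (real K + 1)" using d(2)[of y] by simp
        then show "norm (of_nat (\<nu> x y) * Ln (1 - y / s)) \<le> real (\<nu> x y) * (e / (real K + 1))"
          by (simp only: norm_mult norm_of_nat) (intro mult_left_mono, auto)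
      qed
      also have "\<dots> = real (\<Sum>y\<in>Zc x. \<nu> x y) * (e / (real K + 1))" by (simp only: sum_distrib_right of_nat_sum)
      also have "\<dots> = real K * (e / (real K + 1))" using K[of x] x by simp
      also have "\<dots> < e" using e by (simp add: field_simps)
      finally show "norm ((\<Sum>y\<in>Zc x. of_nat (\<nu> x y) * Ln (1 - y / s)) - 0) < e" by simp
    qed
  qed
  have "((\<lambda>x. s ^ K * exp (\<Sum>y\<in>Zc x. of_nat (\<nu> x y) * Ln (1 - y / s))) \<longlongrightarrow> s ^ K * exp 0) (at 0)"
    by (intro tendsto_intros lim0)
  then have L: "((\<lambda>x. s ^ K * exp (\<Sum>y\<in>Zc x. of_nat (\<nu> x y) * Ln (1 - y / s))) \<longlongrightarrow> s ^ K) (at 0)" by simp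
  have "\<forall>\<^sub>F x in at 0. s ^ K * exp (\<Sum>y\<in>Zc x. of_nat (\<nu> x y) * Ln (1 - y / s)) = poly (P x) s"
    unfolding eventually_at using \<rho>(1) P_value[OF s] by (intro exI[of _ \<rho>]) auto
  from Lim_transform_eventually[OF L this] show ?thesis .
qed

lemma P_value_holomorphic:
  assumes s: "norm s > \<epsilon>2"
  shows "(\<lambda>x. if x = 0 then s ^ K else poly (P x) s) holomorphic_on ball 0 \<rho>"
proof (rule removable_singularity[OF _ open_ball P_value_limit[OF s]])
  have s0: "s \<noteq> 0" using s \<epsilon> by auto
  have "adm (\<lambda>x y. y * (1 / s))" by (intro adm_mult adm_snd adm_const)
  then have "adm (\<lambda>x y. y / s)" by simp
  then have "adm (\<lambda>x y. Ln (1 - y / s))" using s s0 by (intro adm_Ln) (auto simp: norm_divide)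
  then have "(\<lambda>x. s ^ K * exp (\<Sum>y\<in>Zc x. of_nat (\<nu> x y) * Ln (1 - y / s))) holomorphic_on (ball 0 \<rho> - {0})"
    by (intro holomorphic_intros common_sum_holomorphic)
  then show "(\<lambda>x. poly (P x) s) holomorphic_on ball 0 \<rho> - {0}"
    by (rule holomorphic_transform) (use P_value[OF s] in auto)
qed

text \<open>The polynomial is encoded by its values \<open>T l\<close> at \<open>K + 1\<close> large
  nodes, where they are known to be holomorphic, and by the Lagrange basis \<open>L l\<close>. The
  value \<open>s l ^ K\<close> put in at \<open>x = 0\<close> interpolates to
  \<open>y ^ K\<close>.\<close>

lemma common_zero_polynomial:
  "\<exists>T L. (\<forall>l. T l holomorphic_on ball 0 \<rho>) \<and>
     (\<forall>x y. norm x < \<rho> \<longrightarrow> (\<Sum>l\<le>K. T l x * poly (L l) y) = 0 \<longrightarrow> norm y < \<epsilon>2 \<and> \<phi>1 x y = 0 \<and> \<phi>2 x y = 0) \<and>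
     (\<forall>y. (\<Sum>l\<le>K. T l 0 * poly (L l) y) = y ^ K)"
proof -
  define s where "s l = complex_of_real (\<epsilon>2 + 1 + real l)" for l
  have ns: "norm (s l) > \<epsilon>2" for l unfolding s_def norm_of_real using \<epsilon> by simp
  have "inj_on s {..K}" by (auto simp: s_def inj_on_def)
  then obtain L where L: "\<And>p. degree p \<le> K \<Longrightarrow> p = (\<Sum>l\<le>K. smult (poly p (s l)) (L l))"
    using interpolation_basis by blast
  have Lp: "(\<Sum>l\<le>K. poly p (s l) * poly (L l) y) = poly p y" if "degree p \<le> K" for p y
  proof -
    have "poly p y = poly (\<Sum>l\<le>K. smult (poly p (s l)) (L l)) y" using L[OF that] by simp
    then show ?thesis by (simp add: poly_sum)
  qed
  define T where "T l x = (if x = 0 then s l ^ K else poly (P x) (s l))" for l x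
  have T0: "(\<Sum>l\<le>K. T l 0 * poly (L l) y) = y ^ K" for y
    using Lp[of "monom 1 K" y] by (simp add: T_def poly_monom degree_monom_eq)
  have Tx: "(\<Sum>l\<le>K. T l x * poly (L l) y) = poly (P x) y" if "x \<noteq> 0" "norm x < \<rho>" for x y
    using Lp[of "P x" y] degree_P[OF that] that by (simp add: T_def)
  \<comment> \<open>The origin is a limit of common zeros, so it is one by continuity.\<close>
  have zero: "\<phi>1 0 0 = 0" "\<phi>2 0 0 = 0"
  proof -
    have c: "isCont (\<lambda>p. (\<phi>1 (fst p) (snd p), \<phi>2 (fst p) (snd p))) (0, 0)"
    proof -
      have "open (ball (0::complex) r \<times> ball (0::complex) \<epsilon>2)" by (intro open_Times) auto
      moreover have "(0, 0) \<in> ball (0::complex) r \<times> ball (0::complex) \<epsilon>2" using r \<epsilon> by simp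
      ultimately show ?thesis
        using cont1 cont2 by (auto simp: continuous_on_eq_continuous_at split_beta intro!: continuous_intros)
    qed
    have "(\<phi>1 0 0, \<phi>2 0 0) = (0, 0)"
    proof (rule ccontr)
      assume ne: "(\<phi>1 0 0, \<phi>2 0 0) \<noteq> (0, 0)"
      have "\<exists>d>0. \<forall>p. dist (0, 0) p < d \<longrightarrow> (\<phi>1 (fst p) (snd p), \<phi>2 (fst p) (snd p)) \<noteq> (0, 0)"
        by (rule continuous_at_avoid[OF c]) (use ne in simp)
      then obtain d where d: "d > 0" "\<And>p. dist (0, 0) p < d \<Longrightarrow> (\<phi>1 (fst p) (snd p), \<phi>2 (fst p) (snd p)) \<noteq> (0, 0)"
        by blast
      have "d / 2 > 0" using d by simp
      from accum[OF this] obtain x y where xy: "norm x < d / 2" "norm y < d / 2" "\<phi>1 x y = 0" "\<phi>2 x y = 0" by blast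
      have "dist (0, 0) (x, y) \<le> norm x + norm y"
        using sqrt_sum_squares_le_sum_abs[of "norm x" "norm y"] by (simp add: dist_Pair_Pair)
      then show False using d(2)[of "(x, y)"] xy by simp
    qed
    then show "\<phi>1 0 0 = 0" "\<phi>2 0 0 = 0" by auto
  qed
  show ?thesis
  proof (intro exI[of _ T] exI[of _ L] conjI allI impI)
    show "T l holomorphic_on ball 0 \<rho>" for l
      using P_value_holomorphic[OF ns[of l]] by (simp add: T_def[abs_def])
    show "(\<Sum>l\<le>K. T l 0 * poly (L l) y) = y ^ K" for y by (rule T0)
    fix x y assume x: "norm x < \<rho>" and s0: "(\<Sum>l\<le>K. T l x * poly (L l) y) = 0"
    have "norm y < \<epsilon>2 \<and> \<phi>1 x y = 0 \<and> \<phi>2 x y = 0"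
    proof (cases "x = 0")
      case True
      then have "y = 0" using s0 T0 by simp
      then show ?thesis using True zero \<epsilon> by simp
    next
      case False
      have xr: "norm x < r" using x \<rho> by linarith
      have "poly (P x) y = 0" using Tx[OF False x] s0 by simp
      moreover have "finite (Zc x)" using finite_Z[OF xr] by (simp add: Zc_def)
      ultimately obtain w where "w \<in> Zc x" "(y - w) ^ \<nu> x w = 0" unfolding poly_P by (auto simp: prod_zero_iff)
      then have "y \<in> Zc x" by simp
      then show ?thesis by (simp add: Zc_def Z_def)
    qed
    then show "norm y < \<epsilon>2" "\<phi>1 x y = 0" "\<phi>2 x y = 0" by auto
  qed
qed

end

section \<open>From the Weierstrass polynomial to a curve germ\<close>

lemma mv_holomorphic_on_mult:
  assumes "mv_holomorphic_on f U" "mv_holomorphic_on g U"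
  shows "mv_holomorphic_on (\<lambda>p. f p * g p) U"
  unfolding mv_holomorphic_on_def
proof (intro conjI ballI)
  show "open U" using assms by (simp add: mv_holomorphic_on_def)
  fix p assume "p \<in> U"
  then obtain D E where D: "(f has_derivative D) (at p)" "\<forall>c v. D (c *s v) = c * D v"
    "(g has_derivative E) (at p)" "\<forall>c v. E (c *s v) = c * E v"
    using assms unfolding mv_holomorphic_on_def by metis
  from has_derivative_mult[OF D(1,3)] D(2,4)
  show "\<exists>D. ((\<lambda>p. f p * g p) has_derivative D) (at p) \<and> (\<forall>c v. D (c *s v) = c * D v)"
    by (intro exI[of _ "\<lambda>h. f p * E h + D h * g p"]) (auto simp: algebra_simps)
qed

lemma mv_holomorphic_on_sum:
  assumes "open U" "\<And>i. i \<in> I \<Longrightarrow> mv_holomorphic_on (f i) U"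
  shows "mv_holomorphic_on (\<lambda>p. \<Sum>i\<in>I. f i p) U"
  unfolding mv_holomorphic_on_def
proof (intro conjI ballI)
  fix p assume "p \<in> U"
  then have "\<forall>i\<in>I. \<exists>D. (f i has_derivative D) (at p) \<and> (\<forall>c v. D (c *s v) = c * D v)"
    using assms unfolding mv_holomorphic_on_def by blast
  then obtain D where D: "\<And>i. i \<in> I \<Longrightarrow> (f i has_derivative D i) (at p)" "\<And>i c v. i \<in> I \<Longrightarrow> D i (c *s v) = c * D i v"
    by metis
  show "\<exists>D. ((\<lambda>p. \<Sum>i\<in>I. f i p) has_derivative D) (at p) \<and> (\<forall>c v. D (c *s v) = c * D v)"
  proof (intro exI[of _ "\<lambda>h. \<Sum>i\<in>I. D i h"] conjI allI)
    show "((\<lambda>p. \<Sum>i\<in>I. f i p) has_derivative (\<lambda>h. \<Sum>i\<in>I. D i h)) (at p)"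
      using D(1) by (rule has_derivative_sum)
    show "(\<Sum>i\<in>I. D i (c *s v)) = c * (\<Sum>i\<in>I. D i v)" for c v
      unfolding sum_distrib_left using D(2) by (rule sum.cong[OF refl])
  qed
qed fact

lemma mv_holomorphic_on_compose_linear:
  fixes a :: "complex ^ 'n \<Rightarrow> complex"
  assumes f: "f holomorphic_on S" and S: "open S" and a: "linear a" "\<And>c v. a (c *s v) = c * a v"
    and U: "open U" "\<And>p. p \<in> U \<Longrightarrow> a p \<in> S"
  shows "mv_holomorphic_on (\<lambda>p. f (a p)) U"
  unfolding mv_holomorphic_on_def
proof (intro conjI ballI)
  fix p assume p: "p \<in> U"
  have "(a has_derivative a) (at p)"
    using a(1) by (simp add: linear_conv_bounded_linear bounded_linear_imp_has_derivative)
  moreover have "(f has_derivative (\<lambda>h. deriv f (a p) * h)) (at (a p))"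
    using holomorphic_derivI[OF f S U(2)[OF p]] by (simp add: has_field_derivative_def)
  ultimately have "((\<lambda>p. f (a p)) has_derivative (\<lambda>h. deriv f (a p) * a h)) (at p)"
    by (rule has_derivative_compose)
  then show "\<exists>D. ((\<lambda>p. f (a p)) has_derivative D) (at p) \<and> (\<forall>c v. D (c *s v) = c * D v)"
    using a(2) by (intro exI[of _ "\<lambda>h. deriv f (a p) * a h"]) simp
qed fact

text \<open>In suitable linear coordinates \<open>g\<^sub>1\<close> is regular in the second variable, and the common zeros are
  then the zeros of a Weierstrass polynomial.\<close>

lemma nonisolated_common_zeros_contain_curve:
  fixes g1 g2 :: "complex ^ 2 \<Rightarrow> complex"
  assumes g: "mv_holomorphic_on g1 W" "mv_holomorphic_on g2 W" and W: "0 \<in> W"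
    and ne: "\<not> eventually (\<lambda>p. g1 p = 0) (nhds 0)"
    and lim: "0 islimpt {p \<in> W. g1 p = 0 \<and> g2 p = 0}"
  shows "\<exists>\<Gamma>. curve_germ \<Gamma> \<and> eventually (\<lambda>p. p \<in> \<Gamma> \<longrightarrow> g1 p = 0 \<and> g2 p = 0) (nhds 0)"
proof -
  have oW: "open W" using g by (simp add: mv_holomorphic_on_def)
  have cg: "continuous_on W g1" "continuous_on W g2" using g mv_holomorphic_on_continuous by auto
  then have ic: "isCont g1 0" "isCont g2 0" using oW W by (auto simp: continuous_on_eq_continuous_at)
  have g10: "g1 0 = 0"
  proof (rule ccontr)
    assume "g1 0 \<noteq> 0"
    from continuous_at_avoid[OF ic(1) this] obtain e where "e > 0" "\<And>y. dist 0 y < e \<Longrightarrow> g1 y \<noteq> 0" by blast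
    moreover obtain y where "g1 y = 0" "dist y 0 < e" using lim \<open>e > 0\<close> unfolding islimpt_approachable by blast
    ultimately show False by (simp add: dist_commute)
  qed
  obtain R1 where R1: "R1 > 0" "ball 0 R1 \<subseteq> W" using oW W by (meson openE)
  obtain R2 where R2: "R2 > 0" "\<And>p. dist p 0 < R2 \<Longrightarrow> dist (g2 p) (g2 0) < 1"
    using ic(2) unfolding continuous_at_eps_delta by (metis zero_less_one)
  define R where "R = min R1 R2"
  have R: "R > 0" "ball 0 R \<subseteq> W" using R1 R2 by (auto simp: R_def)
  define M where "M = norm (g2 0) + 1"
  have M: "norm (g2 p) \<le> M" if "p \<in> ball 0 R" for p
  proof -
    have "norm (g2 p - g2 0) < 1" using R2(2)[of p] that by (simp add: R_def dist_norm)
    then show ?thesis using norm_triangle_sub[of "g2 p" "g2 0"] by (simp add: M_def)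
  qed
  \<comment> \<open>The line through \<open>e2\<close>, on which \<open>g1\<close> is not
    identically 0, becomes the second axis. The factor 1/2 keeps the disc of parameters of radius 2
    on this line, which contains the parameter 1 of \<open>e2\<close>, inside the ball of radius
    \<open>R\<close>.\<close>
  obtain e2 where e2: "norm e2 < R / 2" "g1 e2 \<noteq> 0"
  proof -
    have "\<not> (\<forall>p. dist p 0 < R / 2 \<longrightarrow> g1 p = 0)"
      using ne R(1) unfolding eventually_nhds_metric by (metis half_gt_zero)
    then show ?thesis using that by auto
  qed
  then have e20: "e2 \<noteq> 0" using g10 by auto
  define e1 :: "complex ^ 2" where "e1 = (if e2 $ 1 = 0 then axis 1 1 else axis 2 1)"
  have "cross2 e1 e2 \<noteq> 0"
    using e20 by (auto simp: e1_def cross2_def axis_def vec_eq_iff forall_2)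
  then interpret C: plane_coords 0 e1 e2 by unfold_locales
  define \<phi>1 where "\<phi>1 x y = g1 (C.P x y)" for x y
  define \<phi>2 where "\<phi>2 x y = g2 (C.P x y)" for x y
  obtain d where d: "d > 0" "\<And>a b. norm a < d \<Longrightarrow> norm b < d \<Longrightarrow> C.P a b \<in> ball 0 R"
    using C.P_near[OF R(1)] by blast
  have P0: "C.P 0 y = y *s e2" for y by (simp add: C.P_def)
  obtain d0 where d0: "d0 > 0" "\<And>y. norm y < d0 \<Longrightarrow> y \<noteq> 0 \<Longrightarrow> \<phi>1 0 y \<noteq> 0"
  proof -
    have "\<phi>1 0 holomorphic_on ball 0 2"
      unfolding \<phi>1_def
    proof (rule C.mv_holomorphic_on_P[OF g(1) open_ball])
      show "C.P 0 s \<in> W" if "s \<in> ball 0 2" for s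
      proof -
        have "norm (s *s e2) < 2 * (R / 2)"
          unfolding norm_vector_smult using that e2(1) e20 by (intro mult_strict_mono) auto
        then show ?thesis using R(2) by (auto simp: P0 subset_iff)
      qed
    qed (auto intro!: holomorphic_intros)
    moreover have "\<phi>1 0 0 = 0" "\<phi>1 0 1 \<noteq> 0" using g10 e2(2) by (simp_all add: \<phi>1_def P0)
    ultimately obtain q where "q > 0" "\<And>z. z \<in> ball 0 q - {0} \<Longrightarrow> \<phi>1 0 z \<noteq> 0"
      using isolated_zeros[of "\<phi>1 0" "ball 0 2" 0 1] by (metis centre_in_ball connected_ball dist_0_norm mem_ball norm_one one_less_numeral_iff open_ball semiring_norm(76) zero_less_numeral)
    then show ?thesis using that[of q] by auto
  qed
  define \<epsilon>2 where "\<epsilon>2 = min d d0 / 2"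
  have \<epsilon>2: "\<epsilon>2 > 0" "\<epsilon>2 < d" "\<epsilon>2 < d0" using d d0 by (auto simp: \<epsilon>2_def)
  have contP: "continuous_on S (\<lambda>p. C.P (fst p) (snd p))" for S
  proof -
    have "continuous_on S (\<lambda>p. \<chi> i. fst p * e1 $ i + snd p * e2 $ i)"
      by (intro continuous_on_vec_lambda continuous_intros)
    moreover have "(\<chi> i. fst p * e1 $ i + snd p * e2 $ i) = C.P (fst p) (snd p)" for p
      by (simp add: C.P_def vec_eq_iff)
    ultimately show ?thesis by (simp only:)
  qed
  have contd: "continuous_on (ball 0 d \<times> ball 0 d) (\<lambda>(x, y). \<phi>1 x y)" "continuous_on (ball 0 d \<times> ball 0 d) (\<lambda>(x, y). \<phi>2 x y)"
  proof -
    have sub: "(\<lambda>p. C.P (fst p) (snd p)) ` (ball 0 d \<times> ball 0 d) \<subseteq> W" using d(2) R(2) by fastforce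
    show "continuous_on (ball 0 d \<times> ball 0 d) (\<lambda>(x, y). \<phi>1 x y)"
      using continuous_on_compose2[OF cg(1) contP sub] by (simp add: \<phi>1_def split_beta)
    show "continuous_on (ball 0 d \<times> ball 0 d) (\<lambda>(x, y). \<phi>2 x y)"
      using continuous_on_compose2[OF cg(2) contP sub] by (simp add: \<phi>2_def split_beta)
  qed
  \<comment> \<open>On the compact annulus \<open>\<phi>1 0\<close> is bounded away from 0, and this
    persists for small \<open>x\<close>.\<close>
  obtain r where r: "r > 0" "r \<le> d" "\<And>x y. norm x < r \<Longrightarrow> \<epsilon>2 / 2 \<le> norm y \<Longrightarrow> norm y < \<epsilon>2 \<Longrightarrow> \<phi>1 x y \<noteq> 0"
  proof -
    define A where "A = cball 0 \<epsilon>2 - ball (0::complex) (\<epsilon>2 / 2)"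
    have cA: "compact A" unfolding A_def by (intro compact_diff) auto
    have Ad: "A \<subseteq> ball 0 d" using \<epsilon>2 by (auto simp: A_def)
    have "complex_of_real \<epsilon>2 \<in> A" using \<epsilon>2 by (simp add: A_def)
    then have nA: "A \<noteq> {}" by blast
    have contA: "continuous_on (ball 0 d \<times> A) (\<lambda>(x, y). \<phi>1 x y)"
      by (rule continuous_on_subset[OF contd(1)]) (use Ad in auto)
    have c0: "continuous_on A (\<lambda>y. (0::complex, y))" by (intro continuous_intros)
    have s0: "(\<lambda>y. (0, y)) ` A \<subseteq> ball (0::complex) d \<times> A" using d(1) by auto
    have "continuous_on A (\<lambda>y. norm (\<phi>1 0 y))"
      using continuous_on_compose2[OF contA c0 s0] by (intro continuous_intros) simp
    then obtain y0 where y0: "y0 \<in> A" "\<And>y. y \<in> A \<Longrightarrow> norm (\<phi>1 0 y0) \<le> norm (\<phi>1 0 y)"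
      using continuous_attains_inf[OF cA nA] by blast
    have "y0 \<noteq> 0" "norm y0 < d0" using y0(1) \<epsilon>2 by (auto simp: A_def)
    then have m: "norm (\<phi>1 0 y0) > 0" using d0(2) by simp
    then have m2: "norm (\<phi>1 0 y0) / 2 > 0" by simp
    have z: "0 \<in> ball (0::complex) d" using d(1) by simp
    from continuous_on_prod_compactE[OF contA cA z m2]
    obtain X where X: "0 \<in> X" "open X" and X': "\<forall>x\<in>X \<inter> ball 0 d. \<forall>y\<in>A.
        dist (case (x, y) of (x, y) \<Rightarrow> \<phi>1 x y) (case (0, y) of (x, y) \<Rightarrow> \<phi>1 x y) \<le> norm (\<phi>1 0 y0) / 2" .
    obtain \<delta> where \<delta>: "\<delta> > 0" "ball 0 \<delta> \<subseteq> X" using X by (meson openE)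
    show ?thesis
    proof (rule that[of "min \<delta> d"])
      show "min \<delta> d > 0" "min \<delta> d \<le> d" using \<delta> d by auto
      fix x y :: complex assume x: "norm x < min \<delta> d" and y: "\<epsilon>2 / 2 \<le> norm y" "norm y < \<epsilon>2"
      have yA: "y \<in> A" using y by (simp add: A_def)
      have "x \<in> X \<inter> ball 0 d" using x \<delta>(2) by auto
      then have "dist (\<phi>1 x y) (\<phi>1 0 y) \<le> norm (\<phi>1 0 y0) / 2" using X' yA by auto
      then have "\<phi>1 x y = 0 \<Longrightarrow> norm (\<phi>1 0 y) \<le> norm (\<phi>1 0 y0) / 2" by (simp add: dist_norm)
      then show "\<phi>1 x y \<noteq> 0" using y0(2)[OF yA] m by linarith
    qed
  qed
  have inW: "C.P x y \<in> W" if "norm x < r" "norm y < \<epsilon>2" for x y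
    using d(2)[of x y] that r(2) \<epsilon>2(2) R(2) by auto
  interpret S: weierstrass_pair \<phi>1 \<phi>2 r "\<epsilon>2 / 2" \<epsilon>2 M
  proof
    show "r > 0" "0 < \<epsilon>2 / 2" "\<epsilon>2 / 2 < \<epsilon>2" using r \<epsilon>2 by auto
    have sub: "ball 0 r \<times> ball 0 \<epsilon>2 \<subseteq> ball (0::complex) d \<times> ball (0::complex) d" using r(2) \<epsilon>2(2) by auto
    show "continuous_on (ball 0 r \<times> ball 0 \<epsilon>2) (\<lambda>(x, y). \<phi>1 x y)" "continuous_on (ball 0 r \<times> ball 0 \<epsilon>2) (\<lambda>(x, y). \<phi>2 x y)"
      by (rule continuous_on_subset[OF contd(1) sub], rule continuous_on_subset[OF contd(2) sub])
    show "(\<lambda>x. \<phi>1 x y) holomorphic_on ball 0 r" "(\<lambda>x. \<phi>2 x y) holomorphic_on ball 0 r" if "y \<in> ball 0 \<epsilon>2" for y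
      unfolding \<phi>1_def \<phi>2_def using inW that
      by (auto intro!: C.mv_holomorphic_on_P[OF g(1)] C.mv_holomorphic_on_P[OF g(2)] holomorphic_intros)
    show "\<phi>1 x holomorphic_on ball 0 \<epsilon>2" "\<phi>2 x holomorphic_on ball 0 \<epsilon>2" if "x \<in> ball 0 r" for x
      unfolding \<phi>1_def[abs_def] \<phi>2_def[abs_def] using inW that
      by (auto intro!: C.mv_holomorphic_on_P[OF g(1)] C.mv_holomorphic_on_P[OF g(2)] holomorphic_intros)
    show "\<phi>1 x y \<noteq> 0" if "norm x < r" "\<epsilon>2 / 2 \<le> norm y" "norm y < \<epsilon>2" for x y using r(3)[OF that] .
    show "y = 0" if "norm y < \<epsilon>2" "\<phi>1 0 y = 0" for y using d0(2)[of y] that \<epsilon>2(3) by auto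
    show "norm (\<phi>2 x y) \<le> M" if "norm x < r" "norm y < \<epsilon>2" for x y
      unfolding \<phi>2_def using that r(2) \<epsilon>2(2) by (intro M d(2)) auto
    fix e :: real assume e: "e > 0"
    obtain r' where r': "r' > 0" "\<And>z. z \<in> ball 0 r' \<Longrightarrow> norm (C.\<alpha> (z - 0)) < e \<and> norm (C.\<beta> (z - 0)) < e"
      using C.coords_near[OF e] by blast
    obtain z where z: "g1 z = 0" "g2 z = 0" "z \<noteq> 0" "dist z 0 < r'"
      using lim r'(1) unfolding islimpt_approachable by blast
    have zP: "C.P (C.\<alpha> (z - 0)) (C.\<beta> (z - 0)) = z" by (rule C.P_coords)
    have "C.P 0 0 = 0" by (simp add: C.P_def)
    then have "C.\<alpha> (z - 0) \<noteq> 0 \<or> C.\<beta> (z - 0) \<noteq> 0" using zP z(3) by metis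
    moreover have "norm (C.\<alpha> (z - 0)) < e \<and> norm (C.\<beta> (z - 0)) < e" using r'(2) z(4) by simp
    moreover have "\<phi>1 (C.\<alpha> (z - 0)) (C.\<beta> (z - 0)) = 0" "\<phi>2 (C.\<alpha> (z - 0)) (C.\<beta> (z - 0)) = 0"
      unfolding \<phi>1_def \<phi>2_def zP using z by auto
    ultimately show "\<exists>x y. norm x < e \<and> norm y < e \<and> (x \<noteq> 0 \<or> y \<noteq> 0) \<and> \<phi>1 x y = 0 \<and> \<phi>2 x y = 0" by blast
  qed
  from S.common_zero_polynomial obtain T L where T: "\<And>l. T l holomorphic_on ball 0 S.\<rho>"
    and zeros: "\<And>x y. norm x < S.\<rho> \<Longrightarrow> (\<Sum>l\<le>S.K. T l x * poly (L l) y) = 0 \<Longrightarrow> norm y < \<epsilon>2 \<and> \<phi>1 x y = 0 \<and> \<phi>2 x y = 0"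
    and at0: "\<And>y. (\<Sum>l\<le>S.K. T l 0 * poly (L l) y) = y ^ S.K" by blast
  define W' where "W' = {p. C.\<alpha> p \<in> ball 0 S.\<rho>}"
  define h where "h p = (\<Sum>l\<le>S.K. T l (C.\<alpha> p) * poly (L l) (C.\<beta> p))" for p
  have oW': "open W'"
  proof -
    have "continuous_on UNIV C.\<alpha>" using C.linear_\<alpha> by (simp add: linear_continuous_on linear_conv_bounded_linear)
    then show ?thesis using continuous_open_vimage[of "ball 0 S.\<rho>" C.\<alpha>]
      by (simp add: W'_def vimage_def continuous_on_eq_continuous_at)
  qed
  have hol: "mv_holomorphic_on h W'"
    unfolding h_def
  proof (intro mv_holomorphic_on_sum mv_holomorphic_on_mult oW')
    show "mv_holomorphic_on (\<lambda>p. T l (C.\<alpha> p)) W'" for l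
      by (rule mv_holomorphic_on_compose_linear[OF T open_ball C.linear_\<alpha> C.\<alpha>_smult oW']) (simp add: W'_def)
    show "mv_holomorphic_on (\<lambda>p. poly (L l) (C.\<beta> p)) W'" for l
      by (rule mv_holomorphic_on_compose_linear[where S = UNIV, OF _ _ C.linear_\<beta> C.\<beta>_smult oW'])
        (auto intro!: holomorphic_intros)
  qed
  have ab0: "C.\<alpha> 0 = 0" "C.\<beta> 0 = 0" using linear_0[OF C.linear_\<alpha>] linear_0[OF C.linear_\<beta>] by auto
  have h0: "h 0 = 0" using at0[of 0] S.K_pos by (simp add: h_def ab0)
  have W'0: "0 \<in> W'" using S.\<rho>(1) by (simp add: W'_def ab0)
  \<comment> \<open>On the second axis \<open>h\<close> is a pure power, so its germ is not
    zero.\<close>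
  have hy: "h (C.P 0 y) = y ^ S.K" for y
    using at0[of y] C.coords_P[of 0 y] by (simp add: h_def)
  have nz: "\<not> eventually (\<lambda>p. h p = 0) (nhds 0)"
  proof
    assume "eventually (\<lambda>p. h p = 0) (nhds 0)"
    then obtain \<delta> where \<delta>: "\<delta> > 0" "\<And>p. dist p 0 < \<delta> \<Longrightarrow> h p = 0" unfolding eventually_nhds_metric by blast
    obtain d' where d': "d' > 0" "\<And>a b. norm a < d' \<Longrightarrow> norm b < d' \<Longrightarrow> C.P a b \<in> ball 0 \<delta>"
      using C.P_near[OF \<delta>(1)] by blast
    have "C.P 0 (complex_of_real (d' / 2)) \<in> ball 0 \<delta>" using d'(1) by (intro d'(2)) (simp_all add: norm_of_real del: of_real_divide)
    then have "h (C.P 0 (complex_of_real (d' / 2))) = 0" using \<delta>(2) by simp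
    then show False using hy d'(1) by simp
  qed
  define \<Gamma> where "\<Gamma> = {p \<in> W'. h p = 0}"
  have "curve_germ \<Gamma>" unfolding curve_germ_def
    using W'0 hol h0 nz by (intro exI[of _ W'] exI[of _ h]) (auto simp: \<Gamma>_def)
  moreover have "g1 p = 0 \<and> g2 p = 0" if "p \<in> \<Gamma>" for p
  proof -
    have "norm (C.\<alpha> p) < S.\<rho>" "h p = 0" using that by (auto simp: \<Gamma>_def W'_def)
    then have "\<phi>1 (C.\<alpha> p) (C.\<beta> p) = 0 \<and> \<phi>2 (C.\<alpha> p) (C.\<beta> p) = 0" using zeros unfolding h_def by blast
    moreover have "C.P (C.\<alpha> p) (C.\<beta> p) = p" using C.P_coords[of p] by simp
    ultimately show ?thesis by (simp add: \<phi>1_def \<phi>2_def)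
  qed
  ultimately show ?thesis by (intro exI[of _ \<Gamma>]) simp
qed

text \<open>Serves the degenerate case where both functions vanish near 0, that is, where a power of
  the map is the identity germ.\<close>

lemma coordinate_axis_curve_germ: "curve_germ {p. p $ 1 = 0}"
proof -
  have "mv_holomorphic_on (\<lambda>p :: complex ^ 2. p $ 1) UNIV"
    unfolding mv_holomorphic_on_def
    by (auto intro!: exI[of _ "\<lambda>p. p $ 1"] bounded_linear_imp_has_derivative bounded_linear_vec_nth)
  moreover have "\<not> eventually (\<lambda>p :: complex ^ 2. p $ 1 = 0) (nhds 0)"
  proof
    assume "eventually (\<lambda>p :: complex ^ 2. p $ 1 = 0) (nhds 0)"
    then obtain d where d: "d > 0" "\<And>p :: complex ^ 2. dist p 0 < d \<Longrightarrow> p $ 1 = 0"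
      unfolding eventually_nhds_metric by blast
    have "norm (complex_of_real (d / 2) *s axis 1 1 :: complex ^ 2) = d / 2"
      unfolding norm_vector_smult norm_of_real using d(1) by simp
    then have "(complex_of_real (d / 2) *s axis 1 1 :: complex ^ 2) $ 1 = 0" using d by (intro d(2)) simp
    then show False using d(1) by (simp add: axis_def)
  qed
  ultimately show ?thesis unfolding curve_germ_def
    by (intro exI[of _ UNIV] exI[of _ "\<lambda>p. p $ 1"]) auto
qed

lemma common_zeros_contain_curve:
  fixes g1 g2 :: "complex ^ 2 \<Rightarrow> complex"
  assumes g: "mv_holomorphic_on g1 W" "mv_holomorphic_on g2 W" and W: "0 \<in> W"
    and lim: "0 islimpt {p \<in> W. g1 p = 0 \<and> g2 p = 0}"
  shows "\<exists>\<Gamma>. curve_germ \<Gamma> \<and> eventually (\<lambda>p. p \<in> \<Gamma> \<longrightarrow> g1 p = 0 \<and> g2 p = 0) (nhds 0)"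
proof (cases "eventually (\<lambda>p. g1 p = 0) (nhds 0)")
  case False
  then show ?thesis by (rule nonisolated_common_zeros_contain_curve[OF g W _ lim])
next
  case e1: True
  show ?thesis
  proof (cases "eventually (\<lambda>p. g2 p = 0) (nhds 0)")
    case False
    have "0 islimpt {p \<in> W. g2 p = 0 \<and> g1 p = 0}" by (rule islimpt_subset[OF lim]) auto
    from nonisolated_common_zeros_contain_curve[OF g(2,1) W False this]
    show ?thesis by (auto elim!: eventually_mono)
  next
    case True
    have "eventually (\<lambda>p. p \<in> {p. p $ 1 = 0} \<longrightarrow> g1 p = 0 \<and> g2 p = 0) (nhds 0)"
      using eventually_conj[OF e1 True] by (rule eventually_mono) simp
    then show ?thesis using coordinate_axis_curve_germ by blast
  qed
qed

theorem mainTheorem4: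
  fixes F :: "complex ^ 2 \<Rightarrow> complex ^ 2"
  assumes "diff_germ F"
    and "finite_orbits_property F"
  shows "\<exists>m\<ge>1. \<exists>\<Gamma>. curve_germ \<Gamma> \<and> eventually (\<lambda>p. p \<in> \<Gamma> \<longrightarrow> (F ^^ m) p = p) (nhds 0)"
proof -
  obtain G U V A where G: "diff_rep G U V" "eventually (\<lambda>p. G p = F p) (nhds 0)"
    "A \<subseteq> U \<inter> V" "0 \<in> interior A" "finite_orbits_in G U A"
    using assms(2) unfolding finite_orbits_property_def by blast
  obtain R0 where R0: "R0 > 0" "cball 0 R0 \<subseteq> A" using G(4) unfolding mem_interior_cball by blast
  interpret finite_orbit_rep G U V A R0 "R0 / 2" using G R0 by unfold_locales auto
  obtain M where M: "M \<ge> 1" "0 islimpt {z. (G ^^ M) z = z}" using zero_limit_of_fixed_points by blast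
  have G0n: "(G ^^ n) 0 = 0" for n by (induction n) (simp_all add: G0)
  have zero_st: "0 \<in> staying n" for n using R0(1) by (simp add: staying_def G0n)
  define g where "g i p = (G ^^ M) p $ i - p $ i" for i p
  have hol: "mv_holomorphic_on (g i) (staying M)" for i
    unfolding g_def
  proof (rule mv_holomorphic_on_diff)
    show "mv_holomorphic_on (\<lambda>p. (G ^^ M) p $ i) (staying M)"
      using hol_funpow[of M] by (simp add: holomorphic_map_on_def)
    show "mv_holomorphic_on (\<lambda>p. p $ i) (staying M)"
      unfolding mv_holomorphic_on_def using open_staying
      by (auto intro!: exI[of _ "\<lambda>p. p $ i"] bounded_linear_imp_has_derivative bounded_linear_vec_nth)
  qed
  have fixed: "(G ^^ M) p = p \<longleftrightarrow> g 1 p = 0 \<and> g 2 p = 0" for p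
    by (auto simp: g_def vec_eq_iff forall_2)
  have "0 islimpt {p \<in> staying M. g 1 p = 0 \<and> g 2 p = 0}"
    unfolding islimpt_approachable
  proof (intro allI impI)
    fix e :: real assume e: "e > 0"
    obtain \<delta> where \<delta>: "\<delta> > 0" "ball 0 \<delta> \<subseteq> staying M" using open_staying zero_st by (meson openE)
    have "min e \<delta> > 0" using e \<delta> by simp
    then obtain z where z: "(G ^^ M) z = z" "z \<noteq> 0" "dist z 0 < min e \<delta>"
      using M(2) unfolding islimpt_approachable by blast
    have "z \<in> staying M" using z(3) \<delta>(2) by (auto simp: subset_iff)
    then show "\<exists>x'\<in>{p \<in> staying M. g 1 p = 0 \<and> g 2 p = 0}. x' \<noteq> 0 \<and> dist x' 0 < e"
      using z fixed by (intro bexI[of _ z]) auto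
  qed
  from common_zeros_contain_curve[OF hol hol zero_st this]
  obtain \<Gamma> where \<Gamma>: "curve_germ \<Gamma>" "eventually (\<lambda>p. p \<in> \<Gamma> \<longrightarrow> (G ^^ M) p = p) (nhds 0)"
    unfolding fixed by blast
  \<comment> \<open>\<open>F\<close> agrees with the representative \<open>G\<close> only near 0;
    continuity of the iterates at the fixed point 0 carries the agreement over to powers.\<close>
  have "eventually (\<lambda>p. (G ^^ n) p = (F ^^ n) p) (nhds 0)" for n
  proof (induction n)
    case 0 then show ?case by simp
  next
    case (Suc n)
    have "isCont (G ^^ n) 0" using cderiv_continuous[OF cderiv_dG[OF zero_st]] .
    then have "filterlim (G ^^ n) (nhds 0) (nhds 0)"
      by (metis G0n isCont_def tendsto_at_iff_tendsto_nhds)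
    with G(2) have "eventually (\<lambda>p. G ((G ^^ n) p) = F ((G ^^ n) p)) (nhds 0)"
      by (rule eventually_compose_filterlim)
    with Suc show ?case by eventually_elim simp
  qed
  from this[of M] \<Gamma>(2) have "eventually (\<lambda>p. p \<in> \<Gamma> \<longrightarrow> (F ^^ M) p = p) (nhds 0)"
    by eventually_elim simp
  then show ?thesis using M(1) \<Gamma>(1) by blast
qed

end
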